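(* Let $d\geq 1$, let $p=p_d=\frac{2d+1}{4d}$, let $(S_n)$ be the $d$-dimensional elephant random walk with memory parameter $p$, and let $G_n=\frac{1}{n}\sum_{k=1}^n S_k$. Then $$\lim_{n\to\infty}\frac{1}{\log\log n}\sum_{k=2}^n\frac{1}{(k\log k)^2}G_kG_k^T=\frac{4}{9d}I_d\quad\text{a.s.},$$ in particular $$\lim_{n\to\infty}\frac{1}{\log\log n}\sum_{k=2}^n\frac{\|G_k\|^2}{(k\log k)^2}=\frac{4}{9}\quad\text{a.s.},$$ and moreover $$\limsup_{n\to\infty}\frac{\|G_n\|^2}{2n\log n\log\log\log n}=\frac{4}{9d}\quad\text{a.s.}$$
   Context: The $d$-dimensional elephant random walk (ERW) with memory parameter $p\in[0,1]$ is defined as follows. Let $e_1,\dots,e_d$ be the standard basis of $\mathbb{R}^d$; the $2d$ directions are $\pm e_1,\dots,\pm e_d$. Set $S_0=0$. The first step $X_1$ is uniformly distributed on the $2d$ directions. For $n\geq 1$, given $X_1,\dots,X_n$, an index $k$ is chosen uniformly at random in $\{1,\dots,n\}$, and then $X_{n+1}=X_k$ with probability $p$, while $X_{n+1}$ equals each of the $2d-1$ remaining directions with probability $(1-p)/(2d-1)$. The position is $S_{n+1}=S_n+X_{n+1}$. $I_d$ is the identity matrix of order $d$ and $\|\cdot\|$ the Euclidean norm. *)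

theory Defs
  imports "HOL-Probability.Probability"
begin

definition erw_dirs :: "(real^'d) set" where
  "erw_dirs = (\<lambda>(i, s). axis i s) ` (UNIV \<times> {-1, 1::real})"

definition erw_step :: "real \<Rightarrow> (real^'d) list \<Rightarrow> (real^'d) pmf" where
  "erw_step p xs =
     bind_pmf (pmf_of_set {0..<length xs}) (\<lambda>k.
       bind_pmf (bernoulli_pmf p) (\<lambda>b.
         if b then return_pmf (xs ! k) else pmf_of_set (erw_dirs - {xs ! k})))"

fun erw_path :: "real \<Rightarrow> nat \<Rightarrow> (real^'d) list pmf" where
  "erw_path p 0 = return_pmf []"
| "erw_path p (Suc 0) = map_pmf (\<lambda>x. [x]) (pmf_of_set erw_dirs)"
| "erw_path p (Suc (Suc n)) =
     bind_pmf (erw_path p (Suc n)) (\<lambda>xs. map_pmf (\<lambda>x. xs @ [x]) (erw_step p xs))"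

definition erw_S :: "(nat \<Rightarrow> 'a \<Rightarrow> real^'d) \<Rightarrow> nat \<Rightarrow> 'a \<Rightarrow> real^'d" where
  "erw_S X n \<omega> = (\<Sum>k\<in>{1..n}. X k \<omega>)"

definition erw_G :: "(nat \<Rightarrow> 'a \<Rightarrow> real^'d) \<Rightarrow> nat \<Rightarrow> 'a \<Rightarrow> real^'d" where
  "erw_G X n \<omega> = (1 / real n) *\<^sub>R (\<Sum>k\<in>{1..n}. erw_S X k \<omega>)"

definition outer :: "real^'d \<Rightarrow> real^'d^'d" where
  "outer v = (\<chi> i j. v $ i * v $ j)"

end

theory Submission
  imports Defs "HOL-Real_Asymp.Real_Asymp"
begin

text \<open>At \<open>p = (2d + 1) / (4d)\<close> the next step is, with probability one half each, a copy of a uniformly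
  chosen past step or a fresh uniform direction. Hence for every function \<open>h\<close> on the directions with
  mean zero the sum \<open>H\<^sub>n\<close> of \<open>h\<close> over the first \<open>n\<close> steps satisfies \<open>E[H\<^sub>n\<^sub>+\<^sub>1 | F\<^sub>n] = (1 + 1/(2n)) H\<^sub>n\<close>, so that
  \<open>\<alpha>\<^sub>n\<^sub>-\<^sub>1 H\<^sub>n\<close> is a martingale for suitable \<open>\<alpha>\<^sub>n\<close> of order \<open>n\<^sup>-\<^sup>1\<^sup>/\<^sup>2\<close>; its increments are bounded and its
  bracket grows like \<open>log n\<close>.

  The upper half of the law of the iterated logarithm follows from exponential supermartingales on
  blocks ending at \<open>exp (\<rho>\<^sup>k)\<close>. For the lower half, two-sided bounds on the exponential moments of a
  block increment, restricted to the event that the conditional variance stays close to its limit,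
  yield a lower tail bound of order \<open>1/k\<close> by tilting; the exceptional event has probability
  polynomially small in the time, hence doubly exponentially small in \<open>k\<close>. A conditional
  Borel-Cantelli argument concludes.

  For the quadratic law, \<open>(H\<^sub>n\<^sup>2 + \<Sum> h(X\<^sub>k)\<^sup>2) / n\<close> minus a multiple of the harmonic number is an exact
  martingale, so the weighted sums have variance \<open>O(log log n)\<close>; Chebyshev along
  \<open>exp (exp (j\<^sup>2))\<close> and monotonicity give almost sure convergence. The center of mass differs from
  two thirds of the position by a martingale term of order \<open>n\<^sup>1\<^sup>/\<^sup>2\<close>, which is negligible. Vectors are
  handled by polarization and by a finite net of directions.\<close>

section \<open>Conditional expectations of the walk\<close>

text \<open>The normalizations come from the bracket. Since \<open>alpha k\<close> squared is
  asymptotic to \<open>alpha_lim / k\<close>, the variance of \<open>wsum h alpha\<close> is about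
  \<open>s * alpha_lim * ln n\<close>, where \<open>s\<close> is the uniform average of the square
  of \<open>h\<close>. The natural clock is \<open>ln n\<close>, so blocks are geometric in that
  clock and one more iterated logarithm appears than for independent steps. The factor
  \<open>1/d\<close> is \<open>s\<close> for a unit vector, \<open>4/9\<close> is the square of the
  \<open>2/3\<close> in \<open>gsum_eq\<close>, and \<open>alpha_lim\<close> cancels.

  The obstacle is that the conditional variance is random and depends on the whole path. For upper
  bounds the paths on which it is far from \<open>s\<close> are simply discarded. For lower bounds
  the discarded part must be negligible even under an exponential weight and conditionally on the
  start of the block; the weight costs only a power of the block index.

  Conditioning is on explicit finite paths, through the recursive operator \<open>erw_ex\<close>.
  Martingale arguments thus become inductions, and measure theory enters only when path events are
  transferred to \<open>M\<close>.\<close>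

lemma axis_pm_inj: "inj_on (\<lambda>(i, s). axis i s :: real^'d) (UNIV \<times> {-1, 1})"
  by (auto simp: inj_on_def axis_eq_axis)

lemma finite_erw_dirs [simp]: "finite (erw_dirs :: (real^'d) set)"
  unfolding erw_dirs_def by simp

lemma card_erw_dirs: "card (erw_dirs :: (real^'d) set) = 2 * CARD('d)"
  unfolding erw_dirs_def by (subst card_image[OF axis_pm_inj]) (simp add: card_cartesian_product)

lemma erw_dirs_nonempty [simp]: "(erw_dirs :: (real^'d) set) \<noteq> {}"
  unfolding erw_dirs_def by auto

lemma sum_erw_dirs:
  "(\<Sum>x\<in>(erw_dirs :: (real^'d) set). f x) = (\<Sum>i\<in>UNIV. f (axis i (-1)) + f (axis i 1))"
proof -
  have "(\<Sum>x\<in>(erw_dirs :: (real^'d) set). f x)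
      = (\<Sum>p\<in>(UNIV::'d set) \<times> {-1, 1::real}. f (case p of (i, s) \<Rightarrow> axis i s))"
    unfolding erw_dirs_def by (subst sum.reindex[OF axis_pm_inj]) simp
  also have "\<dots> = (\<Sum>i\<in>(UNIV::'d set). \<Sum>s\<in>{-1, 1::real}. f (axis i s))"
    by (subst sum.cartesian_product) (simp add: case_prod_unfold)
  finally show ?thesis by simp
qed

definition erw_avg :: "(real^'d \<Rightarrow> real) \<Rightarrow> real" where
  "erw_avg f = (\<Sum>x\<in>erw_dirs. f x) / (2 * real CARD('d))"

text \<open>The one-step conditional expectation given the past \<open>xs\<close>, in the mixture
  form justified by \<open>expectation_erw_step\<close>. The empty past is a separate case because
  the first step has nothing to copy.\<close>

definition erw_next :: "(real^'d) list \<Rightarrow> (real^'d \<Rightarrow> real) \<Rightarrow> real" where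
  "erw_next xs f = (if xs = [] then erw_avg f
     else (sum_list (map f xs) / real (length xs) + erw_avg f) / 2)"

text \<open>Conditional expectation of \<open>f\<close>, evaluated on the path \<open>j\<close>
  steps later, given the present path \<open>xs\<close>. Conditioning on a concrete list replaces
  filtrations. The recursion peels off the earliest new step, so inductions must generalize
  \<open>xs\<close>.\<close>

primrec erw_ex :: "nat \<Rightarrow> ((real^'d) list \<Rightarrow> real) \<Rightarrow> (real^'d) list \<Rightarrow> real" where
  "erw_ex 0 f xs = f xs"
| "erw_ex (Suc j) f xs = erw_next xs (\<lambda>x. erw_ex j f (xs @ [x]))"

lemma erw_avg_add: "erw_avg (\<lambda>x. f x + g x) = erw_avg f + erw_avg g"
  by (simp add: erw_avg_def sum.distrib add_divide_distrib)

lemma erw_avg_cmult: "erw_avg (\<lambda>x. c * f x) = c * erw_avg f"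
  by (simp add: erw_avg_def sum_distrib_left[symmetric])

lemma erw_avg_const: "erw_avg (\<lambda>x. c) = c"
  by (simp add: erw_avg_def card_erw_dirs)

lemma erw_avg_mono:
  assumes "\<And>x. x \<in> erw_dirs \<Longrightarrow> f x \<le> g x"
  shows "erw_avg f \<le> erw_avg g"
  unfolding erw_avg_def using assms by (intro divide_right_mono sum_mono) auto

lemma erw_next_add: "erw_next xs (\<lambda>x. f x + g x) = erw_next xs f + erw_next xs g"
  by (simp add: erw_next_def erw_avg_add sum_list_addf field_simps)

lemma erw_next_cmult: "erw_next xs (\<lambda>x. c * f x) = c * erw_next xs f"
  by (simp add: erw_next_def erw_avg_cmult sum_list_const_mult algebra_simps)

lemma erw_next_const [simp]: "erw_next xs (\<lambda>x. c) = c"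
  by (simp add: erw_next_def erw_avg_const sum_list_triv)

lemma erw_next_diff: "erw_next xs (\<lambda>x. f x - g x) = erw_next xs f - erw_next xs g"
  using erw_next_add[of xs f "\<lambda>x. (-1) * g x"] erw_next_cmult[of xs "-1" g] by simp

lemma erw_next_mono:
  assumes "xs \<in> lists erw_dirs" "\<And>x. x \<in> erw_dirs \<Longrightarrow> f x \<le> g x"
  shows "erw_next xs f \<le> erw_next xs g"
proof -
  have "sum_list (map f xs) \<le> sum_list (map g xs)"
    using assms by (intro sum_list_mono) auto
  then show ?thesis
    using erw_avg_mono[OF assms(2)] by (auto simp: erw_next_def intro!: add_mono divide_right_mono)
qed

lemma erw_ex_add: "erw_ex j (\<lambda>ys. f ys + g ys) xs = erw_ex j f xs + erw_ex j g xs"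
  by (induction j arbitrary: xs) (simp_all add: erw_next_add)

lemma erw_ex_cmult: "erw_ex j (\<lambda>ys. c * f ys) xs = c * erw_ex j f xs"
  by (induction j arbitrary: xs) (simp_all add: erw_next_cmult)

lemma erw_ex_const [simp]: "erw_ex j (\<lambda>ys. c) xs = c"
  by (induction j arbitrary: xs) simp_all

lemma erw_ex_diff: "erw_ex j (\<lambda>ys. f ys - g ys) xs = erw_ex j f xs - erw_ex j g xs"
  using erw_ex_add[of j f "\<lambda>x. (-1) * g x"] erw_ex_cmult[of j "-1" g] by simp

lemma erw_ex_sum: "erw_ex j (\<lambda>ys. \<Sum>i\<in>I. f i ys) xs = (\<Sum>i\<in>I. erw_ex j (f i) xs)"
  by (induction I rule: infinite_finite_induct) (simp_all add: erw_ex_add)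

lemma take_length_snocD: "take (Suc (length xs)) ys = xs @ [x] \<Longrightarrow> take (length xs) ys = xs"
  by (metis append_eq_conv_conj append_take_drop_id append.assoc)

text \<open>The comparison is demanded only on reachable lists, namely extensions of
  \<open>xs\<close> by \<open>j\<close> directions. This is what lets later integrands be simplified
  using the known length and prefix.\<close>

lemma erw_ex_mono:
  assumes "xs \<in> lists erw_dirs"
    and "\<And>ys. ys \<in> lists erw_dirs \<Longrightarrow> length ys = length xs + j \<Longrightarrow> take (length xs) ys = xs
      \<Longrightarrow> f ys \<le> g ys"
  shows "erw_ex j f xs \<le> erw_ex j g xs"
  using assms
proof (induction j arbitrary: xs)
  case (Suc j)
  show ?case unfolding erw_ex.simps
  proof (rule erw_next_mono[OF Suc.prems(1)])
    fix x :: "real^'a" assume x: "x \<in> erw_dirs"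
    show "erw_ex j f (xs @ [x]) \<le> erw_ex j g (xs @ [x])"
    proof (rule Suc.IH)
      fix ys assume "ys \<in> lists erw_dirs" "length ys = length (xs @ [x]) + j"
        "take (length (xs @ [x])) ys = xs @ [x]"
      then show "f ys \<le> g ys"
        by (intro Suc.prems(2)) (auto dest: take_length_snocD)
    qed (use x Suc.prems(1) in auto)
  qed
qed simp

lemma erw_ex_cong:
  assumes "xs \<in> lists erw_dirs"
    and "\<And>ys. ys \<in> lists erw_dirs \<Longrightarrow> length ys = length xs + j \<Longrightarrow> take (length xs) ys = xs
      \<Longrightarrow> f ys = g ys"
  shows "erw_ex j f xs = erw_ex j g xs"
  using assms by (intro antisym erw_ex_mono) auto

lemma erw_ex_compose: "erw_ex (i + j) f xs = erw_ex i (erw_ex j f) xs"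
  by (induction i arbitrary: xs) simp_all

text \<open>The definition splits off the first new step; this form splits off the last one. It is
  the form that suits compensators and that matches \<open>erw_path\<close>, which appends at the
  right end.\<close>

lemma erw_ex_Suc_right: "erw_ex (Suc j) f xs = erw_ex j (\<lambda>ys. erw_next ys (\<lambda>x. f (ys @ [x]))) xs"
proof -
  have "erw_ex (Suc 0) f = (\<lambda>ys. erw_next ys (\<lambda>x. f (ys @ [x])))" by (rule ext) simp
  then show ?thesis using erw_ex_compose[of j "Suc 0" f xs] by simp
qed

text \<open>The one-step inequality is iterated by the tower property. It is required only along
  extensions of \<open>xs\<close> and at lengths below \<open>length xs + j\<close>, the range in
  which smallness of the weights is available.\<close>

lemma erw_ex_supermartingale:
  assumes "xs \<in> lists erw_dirs"
    and "\<And>ys. ys \<in> lists erw_dirs \<Longrightarrow> length xs \<le> length ys \<Longrightarrow> length ys < length xs + j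
      \<Longrightarrow> take (length xs) ys = xs \<Longrightarrow> erw_next ys (\<lambda>x. f (ys @ [x])) \<le> f ys"
  shows "erw_ex j f xs \<le> f xs"
  using assms
proof (induction j arbitrary: xs)
  case (Suc j)
  have "erw_ex (Suc j) f xs \<le> erw_next xs (\<lambda>x. f (xs @ [x]))" unfolding erw_ex.simps
  proof (rule erw_next_mono[OF Suc.prems(1)])
    fix x :: "real^'a" assume x: "x \<in> erw_dirs"
    show "erw_ex j f (xs @ [x]) \<le> f (xs @ [x])"
    proof (rule Suc.IH)
      fix ys assume "ys \<in> lists erw_dirs" "length (xs @ [x]) \<le> length ys"
        "length ys < length (xs @ [x]) + j" "take (length (xs @ [x])) ys = xs @ [x]"
      then show "erw_next ys (\<lambda>x. f (ys @ [x])) \<le> f ys"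
        by (intro Suc.prems(2)) (auto dest: take_length_snocD)
    qed (use x Suc.prems(1) in auto)
  qed
  also have "\<dots> \<le> f xs" using Suc.prems by auto
  finally show ?case .
qed simp

lemma erw_ex_submartingale:
  assumes "xs \<in> lists erw_dirs"
    and "\<And>ys. ys \<in> lists erw_dirs \<Longrightarrow> length xs \<le> length ys \<Longrightarrow> length ys < length xs + j
      \<Longrightarrow> take (length xs) ys = xs \<Longrightarrow> f ys \<le> erw_next ys (\<lambda>x. f (ys @ [x]))"
  shows "f xs \<le> erw_ex j f xs"
proof -
  have "erw_ex j (\<lambda>ys. (-1) * f ys) xs \<le> (-1) * f xs"
    using assms(1)
  proof (rule erw_ex_supermartingale)
    fix ys assume "ys \<in> lists erw_dirs" "length xs \<le> length ys" "length ys < length xs + j"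
      "take (length xs) ys = xs"
    from assms(2)[OF this] show "erw_next ys (\<lambda>x. (-1) * f (ys @ [x])) \<le> (-1) * f ys"
      unfolding erw_next_cmult by simp
  qed
  then show ?thesis unfolding erw_ex_cmult by simp
qed

text \<open>Here the value of \<open>p\<close> enters. Each direction other than the remembered one
  has probability \<open>(1 - p) / (2d - 1) = 1 / (4d)\<close>, half its uniform weight, while the
  remembered one has \<open>p = 1/2 + 1 / (4d)\<close>: the step law is the equal mixture of copying
  and a fresh uniform direction.\<close>

lemma expectation_erw_step:
  fixes xs :: "(real^'d) list"
  assumes "xs \<in> lists erw_dirs" "xs \<noteq> []"
  shows "measure_pmf.expectation (erw_step ((2 * real CARD('d) + 1) / (4 * real CARD('d))) xs) f
    = erw_next xs f"
proof -
  define d where "d = real CARD('d)"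
  define p where "p = (2 * d + 1) / (4 * d)"
  have d1: "d \<ge> 1" by (simp add: d_def Suc_le_eq)
  have p01: "0 \<le> p" "p \<le> 1" using d1 by (auto simp: p_def field_simps)
  have card_minus: "card (erw_dirs - {x} :: (real^'d) set) = 2 * CARD('d) - 1" if "x \<in> erw_dirs" for x
    using that by (simp add: card_erw_dirs)
  have ne: "(erw_dirs - {x} :: (real^'d) set) \<noteq> {}" if "x \<in> erw_dirs" for x
  proof -
    have "card (erw_dirs - {x} :: (real^'d) set) > 0"
      unfolding card_minus[OF that] using zero_less_card_finite[where 'a='d] by linarith
    then show ?thesis by (metis card.empty less_irrefl)
  qed
  let ?s = "\<Sum>x\<in>erw_dirs. f x"
  have inner: "measure_pmf.expectation (bernoulli_pmf p \<bind> (\<lambda>b.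
         if b then return_pmf x else pmf_of_set (erw_dirs - {x}))) f = (f x + ?s / (2 * d)) / 2"
    if x: "x \<in> erw_dirs" for x
  proof -
    have "measure_pmf.expectation (bernoulli_pmf p \<bind> (\<lambda>b.
         if b then return_pmf x else pmf_of_set (erw_dirs - {x}))) f
      = (\<Sum>b\<in>UNIV. pmf (bernoulli_pmf p) b *\<^sub>R measure_pmf.expectation
          (if b then return_pmf x else pmf_of_set (erw_dirs - {x})) f)"
      using ne[OF x] by (intro pmf_expectation_bind) auto
    also have "\<dots> = p * f x + (1 - p) * (sum f (erw_dirs - {x}) / real (2 * CARD('d) - 1))"
      using p01 ne[OF x] by (simp add: UNIV_bool integral_pmf_of_set card_minus[OF x])
    also have "sum f (erw_dirs - {x}) = ?s - f x"
      using x by (simp add: sum_diff1)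
    also have "real (2 * CARD('d) - 1) = 2 * d - 1"
      using zero_less_card_finite[where 'a='d] unfolding d_def by (subst of_nat_diff) auto
    also have "(1 - p) * ((?s - f x) / (2 * d - 1)) = (?s - f x) / (4 * d)"
    proof -
      have "1 - p = (2 * d - 1) / (4 * d)" using d1 by (simp add: p_def field_simps)
      then show ?thesis using d1 by simp
    qed
    also have "p * f x + (?s - f x) / (4 * d) = (f x + ?s / (2 * d)) / 2"
      using d1 by (simp add: p_def field_simps)
    finally show ?thesis .
  qed
  have n0: "{0..<length xs} \<noteq> {}" using assms(2) by auto
  have fin: "finite (set_pmf (bernoulli_pmf p \<bind> (\<lambda>b.
         if b then return_pmf x else pmf_of_set (erw_dirs - {x}))))" if "x \<in> erw_dirs" for x :: "real^'d"
    using ne[OF that] by (auto split: if_splits)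
  have mem: "xs ! k \<in> erw_dirs" if "k \<in> {0..<length xs}" for k
    using assms(1) that by (auto simp: in_lists_conv_set)
  have "measure_pmf.expectation (erw_step p xs) f
     = (\<Sum>k\<in>{0..<length xs}. pmf (pmf_of_set {0..<length xs}) k *\<^sub>R
          measure_pmf.expectation (bernoulli_pmf p \<bind> (\<lambda>b.
            if b then return_pmf (xs ! k) else pmf_of_set (erw_dirs - {xs ! k}))) f)"
    unfolding erw_step_def
  proof (rule pmf_expectation_bind)
    show "set_pmf (pmf_of_set {0..<length xs}) \<subseteq> {0..<length xs}" using n0 by simp
  qed (simp, rule fin[OF mem])
  also have "\<dots> = (\<Sum>k\<in>{0..<length xs}. pmf (pmf_of_set {0..<length xs}) k *\<^sub>R
      ((f (xs ! k) + ?s / (2 * d)) / 2))"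
    by (intro sum.cong refl) (simp only: inner[OF mem])
  also have "\<dots> = (\<Sum>k\<in>{0..<length xs}. f (xs ! k)) / real (length xs) / 2 + ?s / (2 * d) / 2"
  proof -
    have "(\<Sum>k\<in>{0..<length xs}. pmf (pmf_of_set {0..<length xs}) k *\<^sub>R ((f (xs ! k) + ?s / (2 * d)) / 2))
      = (\<Sum>k\<in>{0..<length xs}. (1 / real (length xs)) * (f (xs ! k) / 2) + (1 / real (length xs)) * (?s / (2 * d) / 2))"
      using n0 by (intro sum.cong refl) (simp add: add_divide_distrib mult.commute)
    also have "\<dots> = (1 / real (length xs)) * ((\<Sum>k\<in>{0..<length xs}. f (xs ! k)) / 2) + ?s / (2 * d) / 2"
      using assms(2) by (simp only: sum.distrib sum_distrib_left[symmetric] sum_divide_distrib[symmetric]) simp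
    finally show ?thesis by simp
  qed
  also have "(\<Sum>k\<in>{0..<length xs}. f (xs ! k)) = sum_list (map f xs)"
    by (simp add: sum_list_sum_nth)
  finally show ?thesis
    using assms(2) by (simp add: erw_next_def erw_avg_def p_def d_def add_divide_distrib)
qed

lemma finite_set_pmf_erw_step:
  fixes xs :: "(real^'d) list"
  assumes "xs \<in> lists erw_dirs" "xs \<noteq> []"
  shows "finite (set_pmf (erw_step p xs))" "set_pmf (erw_step p xs) \<subseteq> erw_dirs"
proof -
  have ne: "(erw_dirs - {x} :: (real^'d) set) \<noteq> {}" if "x \<in> erw_dirs" for x
  proof -
    have "card (erw_dirs - {x} :: (real^'d) set) = 2 * CARD('d) - 1"
      using that by (simp add: card_erw_dirs)
    then have "card (erw_dirs - {x} :: (real^'d) set) > 0"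
      using zero_less_card_finite[where 'a='d] by linarith
    then show ?thesis by (metis card.empty less_irrefl)
  qed
  have n0: "{0..<length xs} \<noteq> {}" using assms(2) by auto
  show "set_pmf (erw_step p xs) \<subseteq> erw_dirs"
    unfolding erw_step_def using assms(1) n0 ne
    by (auto split: if_splits simp: in_lists_conv_set)
  then show "finite (set_pmf (erw_step p xs))" by (rule finite_subset) simp
qed

lemma set_pmf_erw_path:
  "set_pmf (erw_path p n) \<subseteq> {xs :: (real^'d) list. xs \<in> lists erw_dirs \<and> length xs = n}"
proof (induction p n rule: erw_path.induct)
  case (3 p n)
  then show ?case
    using finite_set_pmf_erw_step(2)[of _ p] by (fastforce simp: in_lists_conv_set)
qed auto

lemma finite_erw_lists: "finite {xs :: (real^'d) list. xs \<in> lists erw_dirs \<and> length xs = n}"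
  using finite_lists_length_eq[of "erw_dirs :: (real^'d) set" n]
  by (simp add: lists_eq_set)

lemma expectation_erw_path:
  "measure_pmf.expectation (erw_path ((2 * real CARD('d) + 1) / (4 * real CARD('d))) n) f
    = erw_ex n f ([] :: (real^'d) list)"
proof (induction "(2 * real CARD('d) + 1) / (4 * real CARD('d))" n arbitrary: f rule: erw_path.induct)
  case 2
  show ?case
    by (simp add: integral_map_pmf integral_pmf_of_set erw_next_def erw_avg_def card_erw_dirs)
next
  case (3 n)
  let ?p = "(2 * real CARD('d) + 1) / (4 * real CARD('d))"
  let ?A = "{xs :: (real^'d) list. xs \<in> lists erw_dirs \<and> length xs = Suc n}"
  note sub = set_pmf_erw_path[where 'd='d, of ?p "Suc n"]
  have "measure_pmf.expectation (erw_path ?p (Suc (Suc n))) f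
     = (\<Sum>xs\<in>?A. pmf (erw_path ?p (Suc n)) xs *\<^sub>R
         measure_pmf.expectation (map_pmf (\<lambda>x. xs @ [x]) (erw_step ?p xs)) f)"
    unfolding erw_path.simps using sub
    by (intro pmf_expectation_bind finite_erw_lists) (auto intro!: finite_imageI finite_set_pmf_erw_step)
  also have "\<dots> = (\<Sum>xs\<in>?A. pmf (erw_path ?p (Suc n)) xs *\<^sub>R erw_next xs (\<lambda>x. f (xs @ [x])))"
  proof (intro sum.cong refl)
    fix xs assume "xs \<in> ?A"
    then have "xs \<in> lists erw_dirs" "xs \<noteq> []" by auto
    note * = expectation_erw_step[OF this]
    show "pmf (erw_path ?p (Suc n)) xs *\<^sub>R
         measure_pmf.expectation (map_pmf (\<lambda>x. xs @ [x]) (erw_step ?p xs)) f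
       = pmf (erw_path ?p (Suc n)) xs *\<^sub>R erw_next xs (\<lambda>x. f (xs @ [x]))"
      by (simp only: integral_map_pmf *)
  qed
  also have "\<dots> = measure_pmf.expectation (erw_path ?p (Suc n)) (\<lambda>xs. erw_next xs (\<lambda>x. f (xs @ [x])))"
  proof (rule integral_measure_pmf[OF finite_erw_lists, symmetric])
    fix xs :: "(real^'d) list" assume "xs \<in> set_pmf (erw_path ?p (Suc n))"
    then show "xs \<in> ?A" using sub by (rule rev_subsetD)
  qed
  also have "\<dots> = erw_ex (Suc n) (\<lambda>xs. erw_next xs (\<lambda>x. f (xs @ [x]))) []"
    by (rule 3)
  also have "\<dots> = erw_ex (Suc (Suc n)) f []" by (rule erw_ex_Suc_right[symmetric])
  finally show ?case .
qed simp_all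

section \<open>Transfer to the probability space\<close>

text \<open>The walk is given only through its finite-dimensional laws. Steps are indexed from
  \<open>1\<close>; \<open>X 0\<close> is a free measurable function.\<close>

locale erw = prob_space M for M :: "'a measure" +
  fixes X :: "nat \<Rightarrow> 'a \<Rightarrow> real^'d"
  assumes X_measurable [measurable]: "\<And>k. X k \<in> borel_measurable M"
    and X_path: "\<And>n xs. measure M {\<omega> \<in> space M. map (\<lambda>k. X k \<omega>) [1..<n+1] = xs}
           = pmf (erw_path ((2 * real CARD('d) + 1) / (4 * real CARD('d))) n) xs"
begin

text \<open>The steps are directions only almost surely; redefining them on the null set makes every
  function of a finite path a simple random variable.\<close>

definition Xd :: "nat \<Rightarrow> 'a \<Rightarrow> real^'d" where
  "Xd k \<omega> = (if X k \<omega> \<in> erw_dirs then X k \<omega> else axis undefined 1)"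

definition path :: "nat \<Rightarrow> 'a \<Rightarrow> (real^'d) list" where
  "path n \<omega> = map (\<lambda>k. Xd k \<omega>) [1..<n+1]"

lemma Xd_in_dirs: "Xd k \<omega> \<in> erw_dirs"
  by (auto simp: Xd_def erw_dirs_def)

lemma path_in_lists: "path n \<omega> \<in> lists erw_dirs"
  by (auto simp: path_def Xd_in_dirs)

lemma length_path [simp]: "length (path n \<omega>) = n"
  by (simp add: path_def)

lemma path_0 [simp]: "path 0 \<omega> = []"
  by (simp add: path_def)

lemma path_Suc: "path (Suc n) \<omega> = path n \<omega> @ [Xd (Suc n) \<omega>]"
  by (simp add: path_def)

lemma take_path: "m \<le> n \<Longrightarrow> take m (path n \<omega>) = path m \<omega>"
  by (simp add: path_def take_map del: upt_Suc)

abbreviation L :: "nat \<Rightarrow> (real^'d) list set" where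
  "L n \<equiv> {xs. xs \<in> lists erw_dirs \<and> length xs = n}"

lemma Xd_measurable [measurable]: "Xd k \<in> borel_measurable M"
proof -
  have [measurable]: "(erw_dirs :: (real^'d) set) \<in> sets borel"
    by (intro borel_closed finite_imp_closed) simp
  show ?thesis unfolding Xd_def by measurable
qed

lemma X_eq_sets:
  "{\<omega> \<in> space M. map (\<lambda>k. X k \<omega>) [1..<n+1] = xs} \<in> sets M" (is "?A \<in> _")
proof (cases "length xs = n")
  case True
  have "?A = {\<omega> \<in> space M. \<forall>i\<in>{..<n}. X (Suc i) \<omega> = xs ! i}"
    using True by (auto simp: list_eq_iff_nth_eq simp del: upt_Suc)
  also have "\<dots> \<in> sets M" by measurable
  finally show ?thesis .
next
  case False
  then have "?A = {}" by auto
  then show ?thesis by (simp only: sets.empty_sets)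
qed

lemma path_eq_sets: "{\<omega> \<in> space M. path n \<omega> = xs} \<in> sets M" (is "?A \<in> _")
proof (cases "length xs = n")
  case True
  have "?A = {\<omega> \<in> space M. \<forall>i\<in>{..<n}. Xd (Suc i) \<omega> = xs ! i}"
    using True by (auto simp: path_def list_eq_iff_nth_eq simp del: upt_Suc)
  also have "\<dots> \<in> sets M" by measurable
  finally show ?thesis .
next
  case False
  then have "?A = {}" by auto
  then show ?thesis by (simp only: sets.empty_sets)
qed

text \<open>The finitely many lists of \<open>n\<close> directions carry the full mass of
  \<open>erw_path\<close>, so each prefix consists of directions almost surely; countably many
  \<open>n\<close> are then combined.\<close>

lemma AE_Xd_eq: "AE \<omega> in M. \<forall>k\<ge>1. X k \<omega> = Xd k \<omega>"
proof -
  let ?p = "erw_path ((2 * real CARD('d) + 1) / (4 * real CARD('d)))"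
  have "AE \<omega> in M. map (\<lambda>k. X k \<omega>) [1..<n+1] \<in> L n" for n
  proof -
    let ?A = "\<lambda>xs. {\<omega> \<in> space M. map (\<lambda>k. X k \<omega>) [1..<n+1] = xs}"
    have "prob (\<Union>xs\<in>L n. ?A xs) = (\<Sum>xs\<in>L n. prob (?A xs))"
      using X_eq_sets by (intro finite_measure_finite_Union finite_erw_lists)
         (auto simp: disjoint_family_on_def simp del: upt_Suc One_nat_def Suc_eq_plus1)
    also have "\<dots> = (\<Sum>xs\<in>L n. pmf (?p n) xs)" by (simp only: X_path)
    also have "\<dots> = 1"
      by (rule sum_pmf_eq_1[OF finite_erw_lists set_pmf_erw_path])
    finally have "AE \<omega> in M. \<omega> \<in> (\<Union>xs\<in>L n. ?A xs)" by (rule AE_prob_1)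
    then show ?thesis by eventually_elim auto
  qed
  then have "AE \<omega> in M. \<forall>n. map (\<lambda>k. X k \<omega>) [1..<n+1] \<in> L n" by (subst AE_all_countable) blast
  then show ?thesis
  proof eventually_elim
    case (elim \<omega>)
    show ?case
    proof safe
      fix k :: nat assume "k \<ge> 1"
      then have "X k \<omega> \<in> set (map (\<lambda>k. X k \<omega>) [1..<k+1])" by simp
      moreover have "map (\<lambda>k. X k \<omega>) [1..<k+1] \<in> lists erw_dirs" using elim by blast
      ultimately have "X k \<omega> \<in> erw_dirs" by (metis in_lists_conv_set)
      then show "X k \<omega> = Xd k \<omega>" by (simp add: Xd_def)
    qed
  qed
qed

lemma prob_path_eq:
  "prob {\<omega> \<in> space M. path n \<omega> = xs} = pmf (erw_path ((2 * real CARD('d) + 1) / (4 * real CARD('d))) n) xs"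
proof -
  have "prob {\<omega> \<in> space M. path n \<omega> = xs}
      = prob {\<omega> \<in> space M. map (\<lambda>k. X k \<omega>) [1..<n+1] = xs}"
  proof (rule measure_eq_AE)
    show "AE \<omega> in M. \<omega> \<in> {\<omega> \<in> space M. path n \<omega> = xs}
        \<longleftrightarrow> \<omega> \<in> {\<omega> \<in> space M. map (\<lambda>k. X k \<omega>) [1..<n+1] = xs}"
      using AE_Xd_eq
    proof eventually_elim
      case (elim \<omega>)
      then have "map (\<lambda>k. X k \<omega>) [1..<n+1] = path n \<omega>"
        unfolding path_def by (intro map_cong refl) (auto simp del: upt_Suc)
      then show ?case by (simp del: upt_Suc)
    qed
  qed (rule path_eq_sets X_eq_sets)+
  then show ?thesis by (simp only: X_path)
qed

text \<open>Any function of a finite path is a finite combination of indicators of path atoms, so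
  measurability and integrability hold without conditions on \<open>f\<close>.\<close>

lemma path_function_decomp:
  fixes f :: "(real^'d) list \<Rightarrow> real"
  assumes "\<omega> \<in> space M"
  shows "f (path n \<omega>) = (\<Sum>xs\<in>L n. f xs * indicator {\<omega> \<in> space M. path n \<omega> = xs} \<omega>)"
proof -
  have "(\<Sum>xs\<in>L n. f xs * indicator {\<omega> \<in> space M. path n \<omega> = xs} \<omega>)
     = (\<Sum>xs\<in>L n. if xs = path n \<omega> then f xs else (0::real))"
    using assms by (intro sum.cong refl) (auto simp: indicator_def)
  also have "\<dots> = f (path n \<omega>)"
    by (subst sum.delta[OF finite_erw_lists]) (use path_in_lists in auto)
  finally show ?thesis by simp
qed

lemma integrable_path: "integrable M (\<lambda>\<omega>. f (path n \<omega>) :: real)"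
proof -
  have "integrable M (\<lambda>\<omega>. \<Sum>xs\<in>L n. f xs * indicator {\<omega> \<in> space M. path n \<omega> = xs} \<omega>)"
    by (intro Bochner_Integration.integrable_sum integrable_mult_right integrable_real_indicator path_eq_sets)
       (simp add: emeasure_eq_measure)
  then show ?thesis
    by (subst Bochner_Integration.integrable_cong[OF refl path_function_decomp])
qed

lemma path_sets: "{\<omega> \<in> space M. P (path n \<omega>)} \<in> sets M"
proof -
  have "{\<omega> \<in> space M. P (path n \<omega>)} = (\<Union>xs\<in>{xs \<in> L n. P xs}. {\<omega> \<in> space M. path n \<omega> = xs})"
    using path_in_lists by auto
  also have "\<dots> \<in> sets M"
    by (intro sets.finite_UN path_eq_sets) (rule finite_subset[OF _ finite_erw_lists[of n]], auto)
  finally show ?thesis .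
qed

lemma expectation_path: "expectation (\<lambda>\<omega>. f (path n \<omega>)) = erw_ex n f []"
proof -
  have "expectation (\<lambda>\<omega>. f (path n \<omega>))
     = expectation (\<lambda>\<omega>. \<Sum>xs\<in>L n. f xs * indicator {\<omega> \<in> space M. path n \<omega> = xs} \<omega>)"
    by (rule Bochner_Integration.integral_cong[OF refl path_function_decomp])
  also have "\<dots> = (\<Sum>xs\<in>L n. f xs * prob {\<omega> \<in> space M. path n \<omega> = xs})"
  proof (subst Bochner_Integration.integral_sum)
    fix xs
    show "integrable M (\<lambda>\<omega>. f xs * indicator {\<omega> \<in> space M. path n \<omega> = xs} \<omega>)"
      by (intro integrable_mult_right integrable_real_indicator path_eq_sets) (simp add: emeasure_eq_measure)
  next
    show "(\<Sum>xs\<in>L n. expectation (\<lambda>\<omega>. f xs * indicator {\<omega> \<in> space M. path n \<omega> = xs} \<omega>))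
      = (\<Sum>xs\<in>L n. f xs * prob {\<omega> \<in> space M. path n \<omega> = xs})"
      by (intro sum.cong refl) (simp add: path_eq_sets)
  qed
  also have "\<dots> = (\<Sum>xs\<in>L n. f xs * pmf (erw_path ((2 * real CARD('d) + 1) / (4 * real CARD('d))) n) xs)"
    by (simp only: prob_path_eq)
  also have "\<dots> = measure_pmf.expectation (erw_path ((2 * real CARD('d) + 1) / (4 * real CARD('d))) n) f"
    by (rule integral_measure_pmf_real[symmetric, OF finite_erw_lists])
       (rule subsetD[OF set_pmf_erw_path])
  finally show ?thesis by (simp only: expectation_erw_path)
qed

lemma prob_path: "prob {\<omega> \<in> space M. P (path n \<omega>)} = erw_ex n (\<lambda>xs. of_bool (P xs)) []"
proof -
  have "prob {\<omega> \<in> space M. P (path n \<omega>)} = expectation (indicator {\<omega> \<in> space M. P (path n \<omega>)})"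
    using path_sets[of P n] by simp
  also have "\<dots> = expectation (\<lambda>\<omega>. of_bool (P (path n \<omega>)))"
    by (intro Bochner_Integration.integral_cong refl) (auto simp: indicator_def)
  also have "\<dots> = erw_ex n (\<lambda>xs. of_bool (P xs)) []" by (rule expectation_path)
  finally show ?thesis .
qed

section \<open>Borel-Cantelli lemmas for path events\<close>

lemma path_borel_cantelli:
  assumes "summable g"
    and "eventually (\<lambda>k. erw_ex (N k) (\<lambda>xs. of_bool (P k xs)) [] \<le> g k) sequentially"
  shows "AE \<omega> in M. eventually (\<lambda>k. \<not> P k (path (N k) \<omega>)) sequentially"
proof -
  let ?A = "\<lambda>k. {\<omega> \<in> space M. P k (path (N k) \<omega>)}"
  have "summable (\<lambda>k. prob (?A k))"
  proof (rule summable_comparison_test_ev[OF _ assms(1)])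
    show "eventually (\<lambda>k. norm (prob (?A k)) \<le> g k) sequentially"
      using assms(2) by eventually_elim (simp add: prob_path[symmetric])
  qed
  then have "AE \<omega> in M. eventually (\<lambda>k. \<omega> \<in> space M - ?A k) sequentially"
    by (intro borel_cantelli_AE1 path_sets) (simp_all add: emeasure_eq_measure)
  then show ?thesis
    by eventually_elim (auto elim: eventually_mono)
qed

text \<open>A second Borel-Cantelli lemma without independence. From a good start at time
  \<open>N k\<close> the event fails with conditional probability at most \<open>1 - p k\<close>, so
  an uninterrupted run of good starts and failures has probability at most the product of these
  factors, which tends to zero by divergence of the series.\<close>

lemma path_conditional_borel_cantelli:
  fixes N :: "nat \<Rightarrow> nat"
  assumes "mono N"
    and cond: "\<And>k zs. k \<ge> K0 \<Longrightarrow> zs \<in> lists erw_dirs \<Longrightarrow> length zs = N k \<Longrightarrow> G k zs \<Longrightarrow>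
        p k \<le> erw_ex (N (Suc k) - N k) (\<lambda>ys. of_bool (A k ys)) zs"
    and p: "\<And>k. 0 \<le> p k" "\<And>k. p k \<le> 1" "\<not> summable p"
    and G: "AE \<omega> in M. eventually (\<lambda>k. G k (path (N k) \<omega>)) sequentially"
  shows "AE \<omega> in M. frequently (\<lambda>k. A k (path (N (Suc k)) \<omega>)) sequentially"
proof -
  define B where "B K l ys \<longleftrightarrow> (\<forall>k\<in>{K..<l}. G k (take (N k) ys) \<and> \<not> A k (take (N (Suc k)) ys))"
    for K l and ys :: "(real^'d) list"
  have Nle: "N i \<le> N j" if "i \<le> j" for i j using \<open>mono N\<close> that by (rule monoD)
  have bound: "erw_ex (N l) (\<lambda>ys. of_bool (B K l ys)) [] \<le> (\<Prod>k\<in>{K..<l}. 1 - p k)"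
    if "K \<ge> K0" "K \<le> l" for K l
    using that(2)
  proof (induction l rule: dec_induct)
    case (step l)
    \<comment> \<open>Condition on the path \<open>zs\<close> at time \<open>N l\<close>: it already
      decides \<open>B K l\<close> and \<open>G l\<close>, so only the failure of \<open>A l\<close>
      is still random.\<close>
    have *: "erw_ex (N (Suc l) - N l) (\<lambda>ys. of_bool (B K (Suc l) ys)) zs \<le> (1 - p l) * of_bool (B K l zs)"
      if zs: "zs \<in> lists erw_dirs" "length zs = N l" for zs
    proof -
      have "erw_ex (N (Suc l) - N l) (\<lambda>ys. of_bool (B K (Suc l) ys)) zs
         \<le> erw_ex (N (Suc l) - N l) (\<lambda>ys. of_bool (B K l zs \<and> G l zs) * (1 - of_bool (A l ys))) zs"
      proof (rule erw_ex_mono[OF zs(1)])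
        fix ys :: "(real^'d) list" assume "length ys = length zs + (N (Suc l) - N l)" and tk: "take (length zs) ys = zs"
        then have ly: "length ys = N (Suc l)" using zs Nle[of l "Suc l"] by simp
        have tk': "take (N k) ys = take (N k) zs" if "k \<le> l" for k
          using tk zs(2) Nle[OF that] by (metis min.absorb1 take_take)
        have "G l zs \<and> B K l zs \<and> \<not> A l ys" if b: "B K (Suc l) ys"
        proof -
          have "B K l zs"
            unfolding B_def
          proof
            fix k assume k: "k \<in> {K..<l}"
            then have "G k (take (N k) ys) \<and> \<not> A k (take (N (Suc k)) ys)" using b by (simp add: B_def)
            then show "G k (take (N k) zs) \<and> \<not> A k (take (N (Suc k)) zs)"
              using k tk'[of k] tk'[of "Suc k"] by simp
          qed
          moreover have "G l (take (N l) ys) \<and> \<not> A l (take (N (Suc l)) ys)"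
            using b step(1) by (simp add: B_def)
          ultimately show ?thesis using ly tk zs(2) by simp
        qed
        then show "of_bool (B K (Suc l) ys) \<le> of_bool (B K l zs \<and> G l zs) * (1 - of_bool (A l ys) :: real)"
          by auto
      qed
      also have "\<dots> = of_bool (B K l zs \<and> G l zs) * (1 - erw_ex (N (Suc l) - N l) (\<lambda>ys. of_bool (A l ys)) zs)"
        by (simp only: erw_ex_cmult erw_ex_diff erw_ex_const)
      also have "\<dots> \<le> (1 - p l) * of_bool (B K l zs)"
      proof (cases "B K l zs \<and> G l zs")
        case True
        then show ?thesis using cond[of l zs] zs that \<open>K \<ge> K0\<close> step(1) by simp
      next
        case False
        then show ?thesis using p(2)[of l] by auto
      qed
      finally show ?thesis .
    qed
    have "erw_ex (N (Suc l)) (\<lambda>ys. of_bool (B K (Suc l) ys)) []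
        = erw_ex (N l) (erw_ex (N (Suc l) - N l) (\<lambda>ys. of_bool (B K (Suc l) ys))) []"
      using Nle[of l "Suc l"] by (simp add: erw_ex_compose[symmetric])
    also have "\<dots> \<le> erw_ex (N l) (\<lambda>zs. (1 - p l) * of_bool (B K l zs)) []"
      using * by (intro erw_ex_mono) auto
    also have "\<dots> = (1 - p l) * erw_ex (N l) (\<lambda>zs. of_bool (B K l zs)) []"
      by (rule erw_ex_cmult)
    also have "\<dots> \<le> (1 - p l) * (\<Prod>k\<in>{K..<l}. 1 - p k)"
      using step p(2)[of l] by (intro mult_left_mono) auto
    finally show ?case using step(1) by (simp add: mult.commute)
  qed (simp add: B_def)
  have null: "AE \<omega> in M. \<not> (\<forall>k\<ge>K. G k (path (N k) \<omega>) \<and> \<not> A k (path (N (Suc k)) \<omega>))"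
    if "K \<ge> K0" for K
  proof -
    let ?E = "\<lambda>l. {\<omega> \<in> space M. B K l (path (N l) \<omega>)}"
    have Bpath: "B K l (path (N l) \<omega>) \<longleftrightarrow> (\<forall>k\<in>{K..<l}. G k (path (N k) \<omega>) \<and> \<not> A k (path (N (Suc k)) \<omega>))"
      for l \<omega>
      unfolding B_def using Nle by (intro ball_cong refl) (auto simp: take_path)
    have div: "filterlim (\<lambda>l. \<Sum>k\<in>{K..<l}. p k) at_top sequentially"
    proof -
      have "filterlim (\<lambda>l. \<Sum>k<l. p k) at_top sequentially"
      proof (rule filterlim_at_top_mono[OF _ always_eventually])
        show "filterlim (\<lambda>l. \<Sum>k<l. p k) at_top sequentially"
        proof (rule ccontr)
          assume "\<not> filterlim (\<lambda>l. \<Sum>k<l. p k) at_top sequentially"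
          then obtain C where C: "frequently (\<lambda>l. (\<Sum>k<l. p k) < C) sequentially"
            unfolding filterlim_at_top frequently_def by (auto simp: not_less)
          have "(\<Sum>k<l. p k) \<le> C" for l
          proof -
            obtain l' where "l' \<ge> l" "(\<Sum>k<l'. p k) < C"
              using C by (auto simp: frequently_sequentially)
            moreover have "(\<Sum>k<l. p k) \<le> (\<Sum>k<l'. p k)"
              using \<open>l' \<ge> l\<close> p(1) by (intro sum_mono2) auto
            ultimately show ?thesis by simp
          qed
          then have "summable p" using p(1) by (intro bounded_imp_summable[of _ C]) (simp_all only: lessThan_Suc_atMost[symmetric])
          with p(3) show False by simp
        qed
      qed simp
      then have "filterlim (\<lambda>l. - (\<Sum>k<K. p k) + (\<Sum>k<l. p k)) at_top sequentially"
        by (intro filterlim_tendsto_add_at_top[OF tendsto_const])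
      moreover have "eventually (\<lambda>l. - (\<Sum>k<K. p k) + (\<Sum>k<l. p k) = (\<Sum>k\<in>{K..<l}. p k)) sequentially"
        using eventually_ge_at_top[of K]
      proof eventually_elim
        case (elim l)
        have "{..<l} = {..<K} \<union> {K..<l}" using elim by auto
        then have "(\<Sum>k<l. p k) = (\<Sum>k<K. p k) + (\<Sum>k\<in>{K..<l}. p k)"
          by (simp add: sum.union_disjoint ivl_disj_int)
        then show ?case by simp
      qed
      ultimately show ?thesis by (rule filterlim_cong[THEN iffD1, OF refl refl, rotated])
    qed
    have le: "prob (?E l) \<le> exp (- (\<Sum>k\<in>{K..<l}. p k))" if "l \<ge> K" for l
    proof -
      have "prob (?E l) \<le> (\<Prod>k\<in>{K..<l}. 1 - p k)"
        unfolding prob_path using bound[OF \<open>K \<ge> K0\<close> that] .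
      also have "\<dots> \<le> (\<Prod>k\<in>{K..<l}. exp (- p k))"
        using p(2) exp_ge_add_one_self[of "- p _"] by (intro prod_mono) auto
      finally show ?thesis by (simp add: exp_sum[symmetric] sum_negf)
    qed
    have lim: "(\<lambda>l. exp (- (\<Sum>k\<in>{K..<l}. p k))) \<longlonglongrightarrow> 0"
      using div by (intro filterlim_compose[OF exp_at_bot]) (simp add: filterlim_uminus_at_top)
    let ?F = "\<Inter>l\<in>{K..}. ?E l"
    have Fs: "?F \<in> sets M"
      by (intro sets.countable_INT' path_sets) (auto intro: path_sets)
    have "prob ?F \<le> exp (- (\<Sum>k\<in>{K..<l}. p k))" if "l \<ge> K" for l
      using le[OF that] finite_measure_mono[of ?F "?E l"] path_sets that by fastforce
    then have "prob ?F \<le> 0"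
      by (intro tendsto_lowerbound[OF lim]) (auto simp: eventually_sequentially)
    then have "?F \<in> null_sets M"
      using Fs measure_nonneg[of M ?F] by (intro null_setsI) (simp_all add: emeasure_eq_measure)
    then have "AE \<omega> in M. \<omega> \<notin> ?F" by (rule AE_not_in)
    moreover have "AE \<omega> in M. \<omega> \<in> space M" by simp
    ultimately show ?thesis
      by eventually_elim (auto simp: Bpath)
  qed
  then have "AE \<omega> in M. \<forall>K\<ge>K0. \<not> (\<forall>k\<ge>K. G k (path (N k) \<omega>) \<and> \<not> A k (path (N (Suc k)) \<omega>))"
    by (simp add: AE_all_countable)
  then show ?thesis using G
  proof eventually_elim
    case (elim \<omega>)
    show ?case
    proof (rule ccontr)
      assume "\<not> frequently (\<lambda>k. A k (path (N (Suc k)) \<omega>)) sequentially"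
      then have "eventually (\<lambda>k. \<not> A k (path (N (Suc k)) \<omega>)) sequentially"
        by (simp add: frequently_def)
      with elim(2) have "eventually (\<lambda>k. G k (path (N k) \<omega>) \<and> \<not> A k (path (N (Suc k)) \<omega>)) sequentially"
        by (rule eventually_conj)
      then obtain K1 where "\<And>k. k \<ge> K1 \<Longrightarrow> G k (path (N k) \<omega>) \<and> \<not> A k (path (N (Suc k)) \<omega>)"
        by (auto simp: eventually_sequentially)
      then have "\<forall>k\<ge>max K0 K1. G k (path (N k) \<omega>) \<and> \<not> A k (path (N (Suc k)) \<omega>)" by simp
      with elim(1) show False by (meson max.cobounded1)
    qed
  qed
qed

end

section \<open>Additive functionals and exponential moments\<close>

text \<open>Mean zero refers to a fresh uniform direction, so the drift of \<open>hsum\<close> comes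
  from memory alone. Positivity of \<open>b\<close> keeps choices such as
  \<open>\<theta> = 1 / (2 * b)\<close> meaningful.\<close>

definition centered :: "(real^'d \<Rightarrow> real) \<Rightarrow> real \<Rightarrow> bool" where
  "centered h b \<longleftrightarrow> erw_avg h = 0 \<and> 0 < b \<and> (\<forall>x\<in>erw_dirs. \<bar>h x\<bar> \<le> b)"

abbreviation hsum :: "(real^'d \<Rightarrow> real) \<Rightarrow> (real^'d) list \<Rightarrow> real" where
  "hsum h xs \<equiv> sum_list (map h xs)"

text \<open>The martingale difference of the additive functional; for the empty path the drift term
  is \<open>0 / 0 = 0\<close>.\<close>

definition mdiff :: "(real^'d \<Rightarrow> real) \<Rightarrow> (real^'d) list \<Rightarrow> real^'d \<Rightarrow> real" where
  "mdiff h xs x = h x - hsum h xs / (2 * real (length xs))"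

definition cvar :: "(real^'d \<Rightarrow> real) \<Rightarrow> (real^'d) list \<Rightarrow> real" where
  "cvar h xs = erw_next xs (\<lambda>x. (mdiff h xs x)\<^sup>2)"

text \<open>Increments may depend on the entire past. The weighted martingale \<open>wsum\<close>
  and the quadratic martingale with increments \<open>qz\<close> are both instances.\<close>

definition msum :: "((real^'d) list \<Rightarrow> real^'d \<Rightarrow> real) \<Rightarrow> (real^'d) list \<Rightarrow> real" where
  "msum D xs = (\<Sum>k<length xs. D (take k xs) (xs ! k))"

definition wsum :: "(real^'d \<Rightarrow> real) \<Rightarrow> (nat \<Rightarrow> real) \<Rightarrow> (real^'d) list \<Rightarrow> real" where
  "wsum h c = msum (\<lambda>xs x. c (length xs) * mdiff h xs x)"

lemma msum_Nil [simp]: "msum D [] = 0"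
  by (simp add: msum_def)

lemma msum_snoc [simp]: "msum D (xs @ [x]) = msum D xs + D xs x"
  by (simp add: msum_def nth_append)

lemma wsum_Nil [simp]: "wsum h c [] = 0"
  by (simp add: wsum_def)

lemma wsum_snoc [simp]: "wsum h c (xs @ [x]) = wsum h c xs + c (length xs) * mdiff h xs x"
  by (simp add: wsum_def)

lemma msum_uminus: "msum (\<lambda>xs x. - D xs x) ys = - msum D ys"
  by (simp add: msum_def sum_negf)

lemma hsum_uminus: "hsum (\<lambda>x. - h x) xs = - hsum h xs"
  by (induction xs) simp_all

lemma mdiff_uminus: "mdiff (\<lambda>x. - h x) xs x = - mdiff h xs x"
  by (simp add: mdiff_def hsum_uminus)

lemma wsum_uminus: "wsum (\<lambda>x. - h x) c xs = - wsum h c xs"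
  by (simp add: wsum_def mdiff_uminus msum_uminus)

lemma centered_uminus: "centered h b \<Longrightarrow> centered (\<lambda>x. - h x) b"
  using erw_avg_cmult[of "-1" h] by (auto simp: centered_def)

lemma centered_pos: "centered h b \<Longrightarrow> b > 0"
  by (simp add: centered_def)

lemma hsum_bound:
  assumes "centered h b" "xs \<in> lists erw_dirs"
  shows "\<bar>hsum h xs\<bar> \<le> b * real (length xs)"
  using assms(2)
proof (induction xs)
  case (Cons x xs)
  then have "\<bar>h x\<bar> \<le> b" "\<bar>hsum h xs\<bar> \<le> b * real (length xs)" using assms(1) by (auto simp: centered_def)
  then show ?case by (simp add: algebra_simps abs_le_iff)
qed simp

lemma mdiff_bound:
  assumes "centered h b" "xs \<in> lists erw_dirs" "x \<in> erw_dirs"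
  shows "\<bar>mdiff h xs x\<bar> \<le> 2 * b"
proof -
  have b: "b > 0" and hx: "\<bar>h x\<bar> \<le> b" using assms by (auto simp: centered_def)
  have "\<bar>hsum h xs / (2 * real (length xs))\<bar> \<le> b"
  proof (cases "xs = []")
    case False
    then have "real (length xs) > 0" by simp
    moreover have "\<bar>hsum h xs\<bar> \<le> b * (2 * real (length xs))"
      using hsum_bound[OF assms(1,2)] b by (smt (verit) \<open>real (length xs) > 0\<close> mult_le_cancel_left_pos)
    ultimately show ?thesis by (simp add: abs_divide divide_le_eq)
  qed (use b in simp)
  with hx show ?thesis unfolding mdiff_def by linarith
qed

text \<open>The memory half of the step contributes half the empirical mean of \<open>h\<close>,
  which is exactly the subtracted drift; the fresh half contributes zero.\<close>

lemma erw_next_mdiff: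
  assumes "centered h b"
  shows "erw_next xs (mdiff h xs) = 0"
proof -
  have "erw_next xs (mdiff h xs) = erw_next xs h - hsum h xs / (2 * real (length xs))"
    unfolding mdiff_def by (simp only: erw_next_diff erw_next_const)
  then show ?thesis using assms by (auto simp: erw_next_def centered_def)
qed

lemma cvar_nonneg: "xs \<in> lists erw_dirs \<Longrightarrow> cvar h xs \<ge> 0"
  using erw_next_mono[of xs "\<lambda>_. 0" "\<lambda>x. (mdiff h xs x)\<^sup>2"] by (simp add: cvar_def)

lemma cvar_le:
  assumes "centered h b" "xs \<in> lists erw_dirs"
  shows "cvar h xs \<le> 4 * b\<^sup>2"
proof -
  have "(mdiff h xs x)\<^sup>2 \<le> 4 * b\<^sup>2" if "x \<in> erw_dirs" for x
    using power_mono[OF mdiff_bound[OF assms that], of 2] by (simp add: power_mult_distrib)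
  then show ?thesis
    using erw_next_mono[OF assms(2), of "\<lambda>x. (mdiff h xs x)\<^sup>2" "\<lambda>_. 4 * b\<^sup>2"] by (simp add: cvar_def)
qed

text \<open>Second moment minus squared drift. The only random quantities are the empirical means of
  \<open>h\<close> and of its square, so concentration of \<open>cvar\<close> reduces to laws of
  large numbers for two additive functionals.\<close>

lemma cvar_eq:
  assumes "centered h b" "xs \<noteq> []"
  shows "cvar h xs = (hsum (\<lambda>x. (h x)\<^sup>2) xs / real (length xs) + erw_avg (\<lambda>x. (h x)\<^sup>2)) / 2
     - (hsum h xs / (2 * real (length xs)))\<^sup>2"
proof -
  define c where "c = hsum h xs / (2 * real (length xs))"
  have "cvar h xs = erw_next xs (\<lambda>x. ((h x)\<^sup>2 - (2 * c) * h x) + c\<^sup>2)"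
    unfolding cvar_def mdiff_def c_def[symmetric] by (simp add: power2_diff algebra_simps)
  also have "\<dots> = erw_next xs (\<lambda>x. (h x)\<^sup>2) - 2 * c * erw_next xs h + c\<^sup>2"
    by (simp only: erw_next_add erw_next_diff erw_next_cmult erw_next_const)
  also have "erw_next xs h = c"
    using assms by (simp add: erw_next_def centered_def c_def)
  finally show ?thesis using assms(2) by (simp add: erw_next_def c_def power2_eq_square)
qed

section \<open>Exponential moments, maximal and tail inequalities\<close>

lemma exp_taylor2:
  fixes y :: real
  assumes "\<bar>y\<bar> \<le> \<eta>" "\<eta> \<le> 1"
  shows "\<bar>exp y - 1 - y - y\<^sup>2 / 2\<bar> \<le> \<eta> * y\<^sup>2"
proof -
  obtain t where t: "\<bar>t\<bar> \<le> \<bar>y\<bar>" "exp y = (\<Sum>m<3. y ^ m / fact m) + exp t / fact 3 * y ^ 3"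
    using Maclaurin_exp_le[of y 3] by blast
  have "exp y = 1 + y + y\<^sup>2 / 2 + exp t / 6 * y ^ 3"
    using t(2) by (simp add: eval_nat_numeral)
  then have "\<bar>exp y - 1 - y - y\<^sup>2 / 2\<bar> = exp t / 6 * \<bar>y\<bar> ^ 3"
    by (simp add: abs_mult power_abs)
  \<comment> \<open>The cubic remainder has coefficient \<open>exp t / 6\<close>, at most
    \<open>1/2\<close> because \<open>\<bar>t\<bar> \<le> 1\<close>. One factor
    \<open>\<bar>y\<bar>\<close> is then traded for \<open>\<eta>\<close>.\<close>
  also have "\<dots> \<le> 1 * \<bar>y\<bar> ^ 3"
  proof (rule mult_right_mono)
    have "exp t \<le> exp 1" using t(1) assms by simp
    also have "\<dots> \<le> 3" by (rule exp_le)
    finally show "exp t / 6 \<le> 1" by simp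
  qed simp
  also have "\<dots> = \<bar>y\<bar> * y\<^sup>2" by (simp add: power3_eq_cube power2_eq_square)
  also have "\<dots> \<le> \<eta> * y\<^sup>2" using assms by (intro mult_right_mono) auto
  finally show ?thesis .
qed

text \<open>In the second-order expansion the linear term averages to zero and the quadratic term to
  \<open>cvar\<close>. The lower bound loses a second \<open>\<eta>\<close>, the price of passing
  from \<open>1 + z\<close> to an exponential.\<close>

lemma erw_next_exp_bounds:
  assumes "centered h b" "xs \<in> lists erw_dirs" "\<bar>c\<bar> * (2 * b) \<le> \<eta>" "\<eta> \<le> 1"
  shows "erw_next xs (\<lambda>x. exp (c * mdiff h xs x)) \<le> exp ((1/2 + \<eta>) * c\<^sup>2 * cvar h xs)"
    and "\<eta> \<le> 1/4 \<Longrightarrow> exp ((1/2 - 2 * \<eta>) * c\<^sup>2 * cvar h xs) \<le> erw_next xs (\<lambda>x. exp (c * mdiff h xs x))"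
proof -
  let ?y = "\<lambda>x. c * mdiff h xs x"
  have y: "\<bar>?y x\<bar> \<le> \<eta>" if "x \<in> erw_dirs" for x
  proof -
    have "\<bar>?y x\<bar> \<le> \<bar>c\<bar> * (2 * b)"
      using mdiff_bound[OF assms(1,2) that] by (simp add: abs_mult mult_left_mono)
    then show ?thesis using assms(3) by linarith
  qed
  have b: "b > 0" using assms(1) by (rule centered_pos)
  then have \<eta>: "\<eta> \<ge> 0" using assms(3) by (smt (verit) abs_ge_zero mult_nonneg_nonneg)
  have quad: "erw_next xs (\<lambda>x. 1 + ?y x + k * (?y x)\<^sup>2) = 1 + k * c\<^sup>2 * cvar h xs" for k
  proof -
    have "erw_next xs (\<lambda>x. 1 + ?y x + k * (?y x)\<^sup>2)
      = erw_next xs (\<lambda>x. (1 + c * mdiff h xs x) + (k * c\<^sup>2) * (mdiff h xs x)\<^sup>2)"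
      by (simp add: power_mult_distrib mult.assoc)
    also have "\<dots> = 1 + c * erw_next xs (mdiff h xs) + k * c\<^sup>2 * cvar h xs"
      by (simp only: erw_next_add erw_next_cmult erw_next_const cvar_def)
    finally show ?thesis by (simp add: erw_next_mdiff[OF assms(1)])
  qed
  have "erw_next xs (\<lambda>x. exp (?y x)) \<le> erw_next xs (\<lambda>x. 1 + ?y x + (1/2 + \<eta>) * (?y x)\<^sup>2)"
  proof (rule erw_next_mono[OF assms(2)])
    fix x :: "real^'a" assume "x \<in> erw_dirs"
    from exp_taylor2[OF y[OF this] assms(4)]
    show "exp (?y x) \<le> 1 + ?y x + (1/2 + \<eta>) * (?y x)\<^sup>2" by (simp add: abs_le_iff algebra_simps)
  qed
  also have "\<dots> = 1 + (1/2 + \<eta>) * c\<^sup>2 * cvar h xs" by (rule quad)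
  also have "\<dots> \<le> exp ((1/2 + \<eta>) * c\<^sup>2 * cvar h xs)" by (rule exp_ge_add_one_self)
  finally show "erw_next xs (\<lambda>x. exp (?y x)) \<le> exp ((1/2 + \<eta>) * c\<^sup>2 * cvar h xs)" .
  assume \<eta>4: "\<eta> \<le> 1/4"
  define s where "s = c\<^sup>2 * cvar h xs"
  have s0: "s \<ge> 0" using cvar_nonneg[OF assms(2)] by (simp add: s_def)
  have s1: "s \<le> \<eta>"
  proof -
    have "s \<le> (\<bar>c\<bar> * (2 * b))\<^sup>2"
      using cvar_le[OF assms(1,2)] by (simp add: s_def power_mult_distrib mult_left_mono)
    also have "\<dots> \<le> \<eta>\<^sup>2" using assms(3) b by (intro power_mono) auto
    also have "\<dots> \<le> \<eta>" using \<eta> assms(4) by (simp add: power2_eq_square mult_left_le)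
    finally show ?thesis .
  qed
  \<comment> \<open>The bound \<open>ln (1 + z) \<ge> z - z^2\<close> together with
    \<open>z \<le> \<eta>\<close> leaves \<open>z * (1 - \<eta>)\<close>, which still dominates
    \<open>(1/2 - 2 * \<eta>) * s\<close>.\<close>
  define z where "z = (1/2 - \<eta>) * s"
  have z0: "0 \<le> z" using s0 \<eta>4 by (simp add: z_def)
  have "z \<le> 1 * s" unfolding z_def using \<eta> s0 by (intro mult_right_mono) auto
  then have zle: "z \<le> \<eta>" using s1 by simp
  have "(1/2 - 2 * \<eta>) * s \<le> z * (1 - \<eta>)"
  proof -
    have "z * (1 - \<eta>) - (1/2 - 2 * \<eta>) * s = s * (\<eta> / 2 + \<eta>\<^sup>2)"
      by (simp add: z_def power2_eq_square field_simps)
    also have "\<dots> \<ge> 0" using s0 \<eta> by simp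
    finally show ?thesis by simp
  qed
  also have "\<dots> \<le> z * (1 - z)" using z0 zle by (intro mult_left_mono) auto
  also have "\<dots> = z - z\<^sup>2" by (simp add: power2_eq_square algebra_simps)
  also have "\<dots> \<le> ln (1 + z)" using z0 zle \<eta>4 by (intro ln_one_plus_pos_lower_bound) auto
  finally have "exp ((1/2 - 2 * \<eta>) * s) \<le> exp (ln (1 + z))" by simp
  also have "\<dots> = 1 + z" using z0 by simp
  also have "\<dots> = erw_next xs (\<lambda>x. 1 + ?y x + (1/2 - \<eta>) * (?y x)\<^sup>2)"
    unfolding quad by (simp add: z_def s_def mult.assoc)
  also have "\<dots> \<le> erw_next xs (\<lambda>x. exp (?y x))"
  proof (rule erw_next_mono[OF assms(2)])
    fix x :: "real^'a" assume "x \<in> erw_dirs"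
    from exp_taylor2[OF y[OF this] assms(4)]
    show "1 + ?y x + (1/2 - \<eta>) * (?y x)\<^sup>2 \<le> exp (?y x)" by (simp add: abs_le_iff algebra_simps)
  qed
  finally show "exp ((1/2 - 2 * \<eta>) * c\<^sup>2 * cvar h xs) \<le> erw_next xs (\<lambda>x. exp (c * mdiff h xs x))"
    by (simp add: s_def mult.assoc)
qed

text \<open>Jensen's inequality. It stands in for the quantitative lower bound at paths where the
  conditional variance is not controlled.\<close>

lemma erw_next_exp_ge_1:
  assumes "centered h b" "xs \<in> lists erw_dirs"
  shows "1 \<le> erw_next xs (\<lambda>x. exp (c * mdiff h xs x))"
proof -
  have "erw_next xs (\<lambda>x. 1 + c * mdiff h xs x) \<le> erw_next xs (\<lambda>x. exp (c * mdiff h xs x))"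
    by (intro erw_next_mono[OF assms(2)] exp_ge_add_one_self)
  then show ?thesis
    by (simp add: erw_next_add erw_next_cmult erw_next_mdiff[OF assms(1)])
qed

text \<open>A maximal inequality of Doob type, obtained by backward induction instead of a stopping
  time: the right-hand side is the exponential process plus the variance budget of the steps still
  to come. The moment bound is needed only while the path is good, since the event demands goodness
  at every index before the crossing.\<close>

lemma erw_maximal:
  assumes "xs \<in> lists erw_dirs" "\<And>k. \<kappa> k \<ge> 0"
    and "\<And>zs. zs \<in> lists erw_dirs \<Longrightarrow> length xs \<le> length zs \<Longrightarrow> length zs < length xs + j \<Longrightarrow> good zs \<Longrightarrow>
        erw_next zs (\<lambda>x. exp (\<theta> * D zs x)) \<le> exp (\<kappa> (length zs))"
  shows "erw_ex j (\<lambda>ys. of_bool (\<exists>n\<in>{length xs..length ys}.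
        (\<forall>k\<in>{length xs..<n}. good (take k ys)) \<and> y \<le> \<theta> * msum D (take n ys))) xs
    \<le> exp (\<theta> * msum D xs - y + (\<Sum>k\<in>{length xs..<length xs + j}. \<kappa> k))"
  using assms(1,3)
proof (induction j arbitrary: xs)
  case 0
  show ?case
  proof (cases "y \<le> \<theta> * msum D xs")
    case True
    then show ?thesis by simp
  qed simp
next
  case (Suc j)
  let ?P = "\<lambda>xs ys. \<exists>n\<in>{length xs..length ys}.
        (\<forall>k\<in>{length xs..<n}. good (take k ys)) \<and> y \<le> \<theta> * msum D (take n ys)"
  let ?S = "\<Sum>k\<in>{length xs..<length xs + Suc j}. \<kappa> k"
  have S0: "?S \<ge> 0" using assms(2) by (intro sum_nonneg) auto
  \<comment> \<open>The level is reached already; or it can no longer be reached, because every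
    later index would require \<open>xs\<close> to be good; or one more step is taken.\<close>
  consider "y \<le> \<theta> * msum D xs" | "\<not> y \<le> \<theta> * msum D xs" "\<not> good xs" | "\<not> y \<le> \<theta> * msum D xs" "good xs"
    by blast
  then show ?case
  proof cases
    case 1
    have "erw_ex (Suc j) (\<lambda>ys. of_bool (?P xs ys)) xs \<le> erw_ex (Suc j) (\<lambda>ys. 1) xs"
      using Suc.prems(1) by (intro erw_ex_mono) auto
    also have "\<dots> = 1" by (rule erw_ex_const)
    also have "\<dots> \<le> exp (\<theta> * msum D xs - y + ?S)"
      using 1 S0 by (subst one_le_exp_iff) linarith
    finally show ?thesis .
  next
    case 2
    have "erw_ex (Suc j) (\<lambda>ys. of_bool (?P xs ys)) xs \<le> erw_ex (Suc j) (\<lambda>ys. 0) xs"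
    proof (intro erw_ex_mono Suc.prems(1))
      fix ys :: "(real^'a) list" assume "take (length xs) ys = xs"
      have "\<not> ?P xs ys"
      proof
        assume "?P xs ys"
        then obtain n where n: "n \<ge> length xs" "\<forall>k\<in>{length xs..<n}. good (take k ys)" "y \<le> \<theta> * msum D (take n ys)"
          by auto
        show False
        proof (cases "n = length xs")
          case True
          then show ?thesis using n 2 \<open>take (length xs) ys = xs\<close> by simp
        next
          case False
          then have "good (take (length xs) ys)" using n by auto
          then show ?thesis using 2 \<open>take (length xs) ys = xs\<close> by simp
        qed
      qed
      then show "of_bool (?P xs ys) \<le> (0::real)" by simp
    qed
    also have "\<dots> \<le> exp (\<theta> * msum D xs - y + ?S)" by (simp only: erw_ex_const) simp
    finally show ?thesis .
  next
    case 3
    let ?S' = "\<Sum>k\<in>{Suc (length xs)..<Suc (length xs) + j}. \<kappa> k"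
    have "erw_ex (Suc j) (\<lambda>ys. of_bool (?P xs ys)) xs
        \<le> erw_next xs (\<lambda>x. exp (\<theta> * msum D xs - y + ?S') * exp (\<theta> * D xs x))"
      unfolding erw_ex.simps
    proof (rule erw_next_mono[OF Suc.prems(1)])
      fix x :: "real^'a" assume x: "x \<in> erw_dirs"
      then have xx: "xs @ [x] \<in> lists erw_dirs" using Suc.prems(1) by simp
      have "erw_ex j (\<lambda>ys. of_bool (?P xs ys)) (xs @ [x]) \<le> erw_ex j (\<lambda>ys. of_bool (?P (xs @ [x]) ys)) (xs @ [x])"
      proof (rule erw_ex_mono[OF xx])
        fix ys :: "(real^'a) list" assume ys: "take (length (xs @ [x])) ys = xs @ [x]"
        then have tk: "take (length xs) ys = xs" by (intro take_length_snocD[of xs _ x]) simp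
        have "?P (xs @ [x]) ys" if "?P xs ys"
        proof -
          from that obtain n where n: "n \<ge> length xs" "n \<le> length ys" "\<forall>k\<in>{length xs..<n}. good (take k ys)"
            "y \<le> \<theta> * msum D (take n ys)" by auto
          have "n \<noteq> length xs" using n(4) 3(1) tk by auto
          then have "n \<in> {length (xs @ [x])..length ys}" using n by auto
          moreover have "\<forall>k\<in>{length (xs @ [x])..<n}. good (take k ys)" using n by auto
          ultimately show ?thesis using n(4) by blast
        qed
        then show "of_bool (?P xs ys) \<le> (of_bool (?P (xs @ [x]) ys) :: real)" by simp
      qed
      also have "\<dots> \<le> exp (\<theta> * msum D (xs @ [x]) - y + (\<Sum>k\<in>{length (xs @ [x])..<length (xs @ [x]) + j}. \<kappa> k))"
        using Suc.prems(2) by (intro Suc.IH[OF xx]) auto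
      also have "\<dots> = exp (\<theta> * msum D xs - y + ?S') * exp (\<theta> * D xs x)"
        by (simp add: exp_add[symmetric] algebra_simps)
      finally show "erw_ex j (\<lambda>ys. of_bool (?P xs ys)) (xs @ [x])
          \<le> exp (\<theta> * msum D xs - y + ?S') * exp (\<theta> * D xs x)" .
    qed
    also have "\<dots> = exp (\<theta> * msum D xs - y + ?S') * erw_next xs (\<lambda>x. exp (\<theta> * D xs x))"
      by (rule erw_next_cmult)
    also have "\<dots> \<le> exp (\<theta> * msum D xs - y + ?S') * exp (\<kappa> (length xs))"
      using Suc.prems 3(2) by (intro mult_left_mono) auto
    also have "\<dots> = exp (\<theta> * msum D xs - y + ?S)"
    proof -
      have "?S = \<kappa> (length xs) + ?S'" by (subst sum.atLeast_Suc_lessThan) auto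
      then show ?thesis by (simp add: exp_add[symmetric] algebra_simps)
    qed
    finally show ?thesis .
  qed
qed

text \<open>Orthogonality of martingale increments: the cross term with the past vanishes at each
  step.\<close>

lemma erw_ex_msum_square:
  fixes D :: "(real^'d) list \<Rightarrow> real^'d \<Rightarrow> real"
  assumes "\<And>xs. xs \<in> lists erw_dirs \<Longrightarrow> erw_next xs (D xs) = 0"
  shows "erw_ex n (\<lambda>ys. (msum D ys)\<^sup>2) [] = (\<Sum>k<n. erw_ex k (\<lambda>xs. erw_next xs (\<lambda>x. (D xs x)\<^sup>2)) [])"
proof (induction n)
  case (Suc n)
  have *: "erw_next ys (\<lambda>x. (msum D (ys @ [x]))\<^sup>2) = (msum D ys)\<^sup>2 + erw_next ys (\<lambda>x. (D ys x)\<^sup>2)"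
    if "ys \<in> lists erw_dirs" for ys
  proof -
    have "erw_next ys (\<lambda>x. (msum D (ys @ [x]))\<^sup>2)
        = erw_next ys (\<lambda>x. ((msum D ys)\<^sup>2 + (2 * msum D ys) * D ys x) + (D ys x)\<^sup>2)"
      by (simp add: power2_sum algebra_simps)
    also have "\<dots> = (msum D ys)\<^sup>2 + (2 * msum D ys) * erw_next ys (D ys) + erw_next ys (\<lambda>x. (D ys x)\<^sup>2)"
      by (simp only: erw_next_add erw_next_cmult erw_next_const)
    finally show ?thesis using assms[OF that] by simp
  qed
  have "erw_ex (Suc n) (\<lambda>ys. (msum D ys)\<^sup>2) []
     = erw_ex n (\<lambda>ys. (msum D ys)\<^sup>2 + erw_next ys (\<lambda>x. (D ys x)\<^sup>2)) []"
    unfolding erw_ex_Suc_right using * by (intro erw_ex_cong) auto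
  then show ?case using Suc by (simp add: erw_ex_add)
qed simp

text \<open>A crude bound valid on all paths: \<open>\<eta> = 1\<close> and \<open>cvar_le\<close>
  give the exponent \<open>(1/2 + 1) * 4 * b^2 = 6 * b^2\<close>. It serves where only the order of
  the variance matters, in tail bounds and in the second moment of the lower bound.\<close>

lemma erw_ex_exp_wsum:
  assumes "centered h b" "xs \<in> lists erw_dirs"
    and "\<And>k. length xs \<le> k \<Longrightarrow> k < length xs + j \<Longrightarrow> \<bar>\<theta> * c k\<bar> * (2 * b) \<le> 1"
  shows "erw_ex j (\<lambda>ys. exp (\<theta> * (wsum h c ys - wsum h c xs))) xs
    \<le> exp (6 * b\<^sup>2 * \<theta>\<^sup>2 * (\<Sum>k\<in>{length xs..<length xs + j}. (c k)\<^sup>2))"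
proof -
  let ?C = "6 * b\<^sup>2 * \<theta>\<^sup>2"
  let ?m = "length xs"
  let ?f = "\<lambda>ys. exp (\<theta> * (wsum h c ys - wsum h c xs) - ?C * (\<Sum>k\<in>{?m..<length ys}. (c k)\<^sup>2))"
  have "erw_ex j ?f xs \<le> ?f xs"
  proof (rule erw_ex_supermartingale[OF assms(2)])
    fix ys :: "(real^'a) list" assume ys: "ys \<in> lists erw_dirs" "?m \<le> length ys" "length ys < ?m + j"
    let ?n = "length ys"
    have eq: "?f (ys @ [x]) = (?f ys * exp (- ?C * (c ?n)\<^sup>2)) * exp ((\<theta> * c ?n) * mdiff h ys x)" for x
      using ys(2) by (simp add: exp_add[symmetric] algebra_simps)
    have "erw_next ys (\<lambda>x. ?f (ys @ [x]))
        = ?f ys * exp (- ?C * (c ?n)\<^sup>2) * erw_next ys (\<lambda>x. exp ((\<theta> * c ?n) * mdiff h ys x))"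
      unfolding eq by (rule erw_next_cmult)
    also have "\<dots> \<le> ?f ys * exp (- ?C * (c ?n)\<^sup>2) * exp (?C * (c ?n)\<^sup>2)"
    proof (rule mult_left_mono)
      have "erw_next ys (\<lambda>x. exp ((\<theta> * c ?n) * mdiff h ys x)) \<le> exp ((1/2 + 1) * (\<theta> * c ?n)\<^sup>2 * cvar h ys)"
        using assms(3)[of ?n] ys by (intro erw_next_exp_bounds(1)[OF assms(1)]) auto
      also have "\<dots> \<le> exp ((1/2 + 1) * (\<theta> * c ?n)\<^sup>2 * (4 * b\<^sup>2))"
        using cvar_le[OF assms(1) ys(1)] by (subst exp_le_cancel_iff, intro mult_left_mono) auto
      also have "\<dots> = exp (?C * (c ?n)\<^sup>2)" by (simp add: power_mult_distrib)
      finally show "erw_next ys (\<lambda>x. exp ((\<theta> * c ?n) * mdiff h ys x)) \<le> exp (?C * (c ?n)\<^sup>2)" .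
    qed simp
    also have "\<dots> = ?f ys" by (simp add: mult.assoc exp_minus_inverse exp_add[symmetric])
    finally show "erw_next ys (\<lambda>x. ?f (ys @ [x])) \<le> ?f ys" .
  qed
  then have 1: "erw_ex j ?f xs \<le> 1" by simp
  let ?S = "\<Sum>k\<in>{?m..<?m + j}. (c k)\<^sup>2"
  have "erw_ex j (\<lambda>ys. exp (\<theta> * (wsum h c ys - wsum h c xs))) xs = erw_ex j (\<lambda>ys. exp (?C * ?S) * ?f ys) xs"
    by (intro erw_ex_cong[OF assms(2)]) (simp add: exp_add[symmetric])
  also have "\<dots> = exp (?C * ?S) * erw_ex j ?f xs" by (rule erw_ex_cmult)
  also have "\<dots> \<le> exp (?C * ?S) * 1" using 1 by (intro mult_left_mono) auto
  finally show ?thesis by simp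
qed

text \<open>Markov's inequality for the exponentials of both signs. The parameter
  \<open>\<theta>\<close> stays free because the applications use different scales.\<close>

lemma erw_wsum_tail:
  assumes "centered h b" "0 \<le> \<theta>" "\<And>k. k < n \<Longrightarrow> \<bar>\<theta> * c k\<bar> * (2 * b) \<le> 1"
  shows "erw_ex n (\<lambda>ys. of_bool (y \<le> \<bar>wsum h c ys\<bar>)) []
    \<le> 2 * exp (6 * b\<^sup>2 * \<theta>\<^sup>2 * (\<Sum>k<n. (c k)\<^sup>2) - \<theta> * y)"
proof -
  have "erw_ex n (\<lambda>ys. of_bool (y \<le> \<bar>wsum h c ys\<bar>)) []
     \<le> erw_ex n (\<lambda>ys. exp (- \<theta> * y) * exp (\<theta> * (wsum h c ys - wsum h c []))
          + exp (- \<theta> * y) * exp ((-\<theta>) * (wsum h c ys - wsum h c []))) []"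
  proof (rule erw_ex_mono)
    fix ys :: "(real^'a) list"
    let ?w = "wsum h c ys"
    have "1 \<le> exp (\<theta> * \<bar>?w\<bar> - \<theta> * y)" if "y \<le> \<bar>?w\<bar>"
      using that assms(2) by (simp add: mult_left_mono)
    also have "exp (\<theta> * \<bar>?w\<bar> - \<theta> * y) \<le> exp (\<theta> * ?w - \<theta> * y) + exp (- \<theta> * ?w - \<theta> * y)"
      by (cases "?w \<ge> 0") (auto simp: abs_if)
    also have "\<dots> = exp (- \<theta> * y) * exp (\<theta> * (?w - wsum h c []))
          + exp (- \<theta> * y) * exp ((-\<theta>) * (?w - wsum h c []))" by (simp add: mult_exp_exp)
    finally show "of_bool (y \<le> \<bar>?w\<bar>) \<le> exp (- \<theta> * y) * exp (\<theta> * (?w - wsum h c []))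
          + exp (- \<theta> * y) * exp ((-\<theta>) * (?w - wsum h c []))"
      by (cases "y \<le> \<bar>?w\<bar>") (simp_all add: add_nonneg_nonneg)
  qed simp
  also have "\<dots> = exp (- \<theta> * y) * erw_ex n (\<lambda>ys. exp (\<theta> * (wsum h c ys - wsum h c []))) []
      + exp (- \<theta> * y) * erw_ex n (\<lambda>ys. exp ((-\<theta>) * (wsum h c ys - wsum h c []))) []"
    by (simp only: erw_ex_add erw_ex_cmult)
  also have "\<dots> \<le> exp (- \<theta> * y) * exp (6 * b\<^sup>2 * \<theta>\<^sup>2 * (\<Sum>k<n. (c k)\<^sup>2))
     + exp (- \<theta> * y) * exp (6 * b\<^sup>2 * (-\<theta>)\<^sup>2 * (\<Sum>k<n. (c k)\<^sup>2))"
  proof (intro add_mono mult_left_mono)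
    show "erw_ex n (\<lambda>ys. exp (\<theta> * (wsum h c ys - wsum h c []))) [] \<le> exp (6 * b\<^sup>2 * \<theta>\<^sup>2 * (\<Sum>k<n. (c k)\<^sup>2))"
      using erw_ex_exp_wsum[OF assms(1), of "[]" n \<theta> c] assms(3) by (simp add: atLeast0LessThan)
    show "erw_ex n (\<lambda>ys. exp ((-\<theta>) * (wsum h c ys - wsum h c []))) [] \<le> exp (6 * b\<^sup>2 * (-\<theta>)\<^sup>2 * (\<Sum>k<n. (c k)\<^sup>2))"
      using erw_ex_exp_wsum[OF assms(1), of "[]" n "-\<theta>" c] assms(3) by (simp add: atLeast0LessThan)
  qed simp_all
  also have "\<dots> = 2 * exp (6 * b\<^sup>2 * \<theta>\<^sup>2 * (\<Sum>k<n. (c k)\<^sup>2) - \<theta> * y)"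
    by (simp add: mult_exp_exp)
  finally show ?thesis .
qed

section \<open>Normalizing weights and concentration of the conditional variance\<close>

text \<open>Inverse product of the growth factors \<open>1 + 1 / (2 * i)\<close>. It is a quotient
  of Gamma values of order \<open>1 / sqrt k\<close>; by Wallis' formula the constant
  \<open>alpha_lim\<close> equals pi / 4.\<close>

definition alpha :: "nat \<Rightarrow> real" where
  "alpha k = (\<Prod>i\<in>{1..k}. 2 * real i / (2 * real i + 1))"

definition alpha_lim :: real where
  "alpha_lim = lim (\<lambda>k. (real k + 1) * (alpha k)\<^sup>2)"

lemma alpha_0 [simp]: "alpha 0 = 1"
  by (simp add: alpha_def)

lemma alpha_Suc: "alpha (Suc k) = alpha k * ((2 * real k + 2) / (2 * real k + 3))"
  by (simp add: alpha_def algebra_simps)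

lemma alpha_pos: "alpha k > 0"
  by (induction k) (simp_all add: alpha_Suc)

text \<open>With shift \<open>1\<close> the normalized squares decrease, with shift
  \<open>3/4\<close> they increase. The common limit is thus enclosed for every \<open>k\<close>,
  which yields explicit two-sided bounds and not merely asymptotics.\<close>

lemma alpha_upper_decseq: "decseq (\<lambda>k. (real k + 1) * (alpha k)\<^sup>2)"
proof (rule decseq_SucI)
  fix k
  let ?k = "real k"
  have "(real (Suc k) + 1) * (alpha (Suc k))\<^sup>2 = ((?k + 2) * (2 * ?k + 2)\<^sup>2 / (2 * ?k + 3)\<^sup>2) * (alpha k)\<^sup>2"
    by (simp add: alpha_Suc power_mult_distrib power_divide)
  also have "\<dots> \<le> (?k + 1) * (alpha k)\<^sup>2"
  proof (rule mult_right_mono)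
    have "(?k + 2) * (2 * ?k + 2)\<^sup>2 \<le> (?k + 1) * (2 * ?k + 3)\<^sup>2"
      by (simp add: power2_eq_square algebra_simps)
    then show "(?k + 2) * (2 * ?k + 2)\<^sup>2 / (2 * ?k + 3)\<^sup>2 \<le> ?k + 1"
      by (subst pos_divide_le_eq) auto
  qed simp
  finally show "(real (Suc k) + 1) * (alpha (Suc k))\<^sup>2 \<le> (?k + 1) * (alpha k)\<^sup>2" .
qed

lemma alpha_lower_incseq: "incseq (\<lambda>k. (real k + 3/4) * (alpha k)\<^sup>2)"
proof (rule incseq_SucI)
  fix k
  let ?k = "real k"
  have "(?k + 3/4) * (alpha k)\<^sup>2 \<le> ((?k + 7/4) * (2 * ?k + 2)\<^sup>2 / (2 * ?k + 3)\<^sup>2) * (alpha k)\<^sup>2"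
  proof (rule mult_right_mono)
    \<comment> \<open>The shift \<open>3/4\<close> makes all non-constant coefficients of the two
      cubics agree; the sides differ by the constant \<open>1/4\<close>.\<close>
    have "(?k + 3/4) * (2 * ?k + 3)\<^sup>2 \<le> (?k + 7/4) * (2 * ?k + 2)\<^sup>2"
      by (simp add: power2_eq_square algebra_simps)
    then show "?k + 3/4 \<le> (?k + 7/4) * (2 * ?k + 2)\<^sup>2 / (2 * ?k + 3)\<^sup>2"
      by (subst pos_le_divide_eq) auto
  qed simp
  also have "\<dots> = (real (Suc k) + 3/4) * (alpha (Suc k))\<^sup>2"
    by (simp add: alpha_Suc power_mult_distrib power_divide)
  finally show "(?k + 3/4) * (alpha k)\<^sup>2 \<le> (real (Suc k) + 3/4) * (alpha (Suc k))\<^sup>2" .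
qed

lemma alpha_lim: "(\<lambda>k. (real k + 1) * (alpha k)\<^sup>2) \<longlonglongrightarrow> alpha_lim"
  and alpha_lim_le: "alpha_lim \<le> (real k + 1) * (alpha k)\<^sup>2"
  and alpha_lim_ge: "(real k + 3/4) * (alpha k)\<^sup>2 \<le> alpha_lim"
proof -
  let ?f = "\<lambda>k. (real k + 1) * (alpha k)\<^sup>2" and ?g = "\<lambda>k. (real k + 3/4) * (alpha k)\<^sup>2"
  obtain l where "?f \<longlonglongrightarrow> l"
    using decseq_convergent[OF alpha_upper_decseq, of 0] by auto
  then show lim: "?f \<longlonglongrightarrow> alpha_lim" by (simp add: limI alpha_lim_def)
  show "alpha_lim \<le> ?f k" by (rule decseq_ge[OF alpha_upper_decseq lim])
  have le: "?g n \<le> ?f n" for n by (intro mult_right_mono) auto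
  have "?g k \<le> ?f n" if "n \<ge> k" for n
    using incseqD[OF alpha_lower_incseq that] le[of n] by linarith
  then show "?g k \<le> alpha_lim"
    by (intro LIMSEQ_le_const[OF lim]) auto
qed

lemma alpha_lim_bounds: "3/4 \<le> alpha_lim" "alpha_lim \<le> 1"
  using alpha_lim_ge[of 0] alpha_lim_le[of 0] by simp_all

lemma alpha_lim_pos [simp]: "alpha_lim > 0"
  using alpha_lim_bounds by simp

lemma alpha_sq_le: "(alpha k)\<^sup>2 \<le> alpha_lim / (real k + 3/4)"
  using alpha_lim_ge[of k] by (simp add: pos_le_divide_eq mult.commute add_pos_nonneg)

lemma alpha_sq_ge: "alpha_lim / (real k + 1) \<le> (alpha k)\<^sup>2"
  using alpha_lim_le[of k] by (simp add: pos_divide_le_eq mult.commute)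

lemma alpha_le_1: "alpha k \<le> 1"
proof (induction k)
  case (Suc k)
  have "alpha k * ((2 * real k + 2) / (2 * real k + 3)) \<le> 1 * 1"
    using Suc alpha_pos[of k] by (intro mult_mono) auto
  then show ?case by (simp add: alpha_Suc)
qed simp

lemma harm_le_ln: "n \<ge> 1 \<Longrightarrow> (harm n :: real) \<le> ln (real n) + 1"
proof -
  assume "n \<ge> 1"
  then obtain m where m: "n = Suc m" by (cases n) auto
  have "harm (Suc m) - ln (real (Suc m)) \<le> harm (Suc 0) - ln (real (Suc 0))"
    using decseq_harm_diff_ln by (rule decseqD) simp
  then show ?thesis by (simp add: m harm_def)
qed

lemma alpha_sum_le:
  assumes "n \<ge> 1"
  shows "(\<Sum>k<n. (alpha k)\<^sup>2) \<le> alpha_lim * (ln (real n) + 2)"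
proof -
  \<comment> \<open>The excess of \<open>1 / (k + 3/4)\<close> over \<open>1 / (k + 1)\<close> is at
    most \<open>1 / (k + 1) - 1 / (k + 2)\<close>, which telescopes.\<close>
  have "(\<Sum>k<n. 1 / (real k + 3/4)) \<le> harm n + 1 - 1 / (real n + 1)"
  proof (induction n)
    case (Suc n)
    have "1 / (real n + 3/4) \<le> 1 / (real n + 1) + 1 / (real n + 1) - 1 / (real n + 2)"
      by (simp add: divide_simps) (simp add: algebra_simps)
    then show ?case using Suc by (simp add: harm_Suc inverse_eq_divide algebra_simps)
  qed (simp add: harm_def)
  then have *: "(\<Sum>k<n. 1 / (real k + 3/4)) \<le> ln (real n) + 2"
    using harm_le_ln[OF assms] by (smt (verit) divide_nonneg_nonneg of_nat_0_le_iff)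
  have "(\<Sum>k<n. (alpha k)\<^sup>2) \<le> (\<Sum>k<n. alpha_lim * (1 / (real k + 3/4)))"
    using alpha_sq_le by (intro sum_mono) simp
  also have "\<dots> = alpha_lim * (\<Sum>k<n. 1 / (real k + 3/4))" by (simp only: sum_distrib_left)
  also have "\<dots> \<le> alpha_lim * (ln (real n) + 2)" using * by (intro mult_left_mono) (auto simp: less_imp_le)
  finally show ?thesis .
qed

lemma alpha_sum_ge:
  assumes "n \<ge> 1"
  shows "alpha_lim * ln (real n) \<le> (\<Sum>k<n. (alpha k)\<^sup>2)"
proof -
  have "ln (real n) \<le> ln (real n + 1)" using assms by simp
  also have "\<dots> \<le> harm n" by (rule ln_le_harm)
  finally have "alpha_lim * ln (real n) \<le> alpha_lim * harm n" by (intro mult_left_mono) (auto simp: less_imp_le)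
  also have "\<dots> = (\<Sum>k<n. alpha_lim * (1 / (real k + 1)))"
    by (simp add: harm_altdef sum_distrib_left inverse_eq_divide add.commute)
  also have "\<dots> \<le> (\<Sum>k<n. (alpha k)\<^sup>2)" using alpha_sq_ge by (intro sum_mono) simp
  finally show ?thesis .
qed

text \<open>The identity \<open>alpha m = alpha (Suc m) * (1 + 1 / (2 * Suc m))\<close> makes the
  drift telescope. The index is \<open>length xs - 1\<close> because \<open>alpha k\<close>
  multiplies the increment that leaves a path of length \<open>k\<close>.\<close>

lemma wsum_alpha:
  "xs \<noteq> [] \<Longrightarrow> wsum h alpha xs = alpha (length xs - 1) * hsum h xs"
proof (induction xs rule: rev_induct)
  case (snoc x xs)
  show ?case
  proof (cases "xs = []")
    case True
    then show ?thesis using wsum_snoc[of h alpha "[]" x] by (simp add: mdiff_def)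
  next
    case False
    then obtain m where m: "length xs = Suc m" by (cases xs) auto
    have "wsum h alpha (xs @ [x]) = alpha m * hsum h xs + alpha (Suc m) * (h x - hsum h xs / (2 * real (Suc m)))"
      using snoc.IH[OF False] by (simp add: m mdiff_def)
    also have "alpha m = alpha (Suc m) * (1 + 1 / (2 * real (Suc m)))"
    proof -
      have "(2 * real m + 2) / (2 * real m + 3) * (1 + 1 / (2 * real (Suc m))) = 1"
        by (simp add: divide_simps) (simp add: algebra_simps)
      then show ?thesis by (simp only: alpha_Suc mult.assoc mult_1_right)
    qed
    finally show ?thesis by (simp add: m algebra_simps)
  qed
qed simp

section \<open>Concentration of the conditional variance\<close>

lemma erw_ex_take:
  assumes "n \<le> N"
  shows "erw_ex N (\<lambda>ys. f (take n ys)) [] = erw_ex n f []"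
proof -
  have "erw_ex N (\<lambda>ys. f (take n ys)) [] = erw_ex n (erw_ex (N - n) (\<lambda>ys. f (take n ys))) []"
    by (subst erw_ex_compose[symmetric]) (simp add: assms)
  also have "\<dots> = erw_ex n f []"
  proof (rule erw_ex_cong)
    fix zs :: "(real^'a) list" assume zs: "zs \<in> lists erw_dirs" "length zs = length ([] :: (real^'a) list) + n"
    have "erw_ex (N - n) (\<lambda>ys. f (take n ys)) zs = erw_ex (N - n) (\<lambda>ys. f zs) zs"
      using zs by (intro erw_ex_cong) auto
    then show "erw_ex (N - n) (\<lambda>ys. f (take n ys)) zs = f zs" by simp
  qed simp
  finally show ?thesis .
qed

text \<open>The deviation \<open>\<delta> * n\<close> becomes one of order \<open>sqrt n\<close> for
  \<open>wsum h alpha\<close>, whose bracket is only logarithmic. The fixed choice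
  \<open>\<theta> = 1 / (2 * b)\<close> therefore gives decay faster than any power, of which the
  summable \<open>1 / n^2\<close> is kept.\<close>

lemma hsum_tail:
  assumes h: "centered h b" and "\<delta> > 0"
  shows "eventually (\<lambda>n. erw_ex n (\<lambda>ys. of_bool (\<delta> * real n \<le> \<bar>hsum h ys\<bar>)) [] \<le> 1 / (real n)\<^sup>2) sequentially"
proof -
  have b: "b > 0" using h by (rule centered_pos)
  define \<kappa> where "\<kappa> = \<delta> / (4 * b)"
  have \<kappa>: "\<kappa> > 0" using assms b by (simp add: \<kappa>_def)
  have "eventually (\<lambda>n. 2 * exp (3/2 * (ln (real n) + 2) - \<kappa> * sqrt (real n)) \<le> 1 / (real n)\<^sup>2) sequentially"
    using \<kappa> by real_asymp
  then show ?thesis using eventually_ge_at_top[of 1]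
  proof eventually_elim
    case (elim n)
    have "erw_ex n (\<lambda>ys. of_bool (\<delta> * real n \<le> \<bar>hsum h ys\<bar>)) []
       \<le> erw_ex n (\<lambda>ys. of_bool (\<delta> * sqrt (real n) / 2 \<le> \<bar>wsum h alpha ys\<bar>)) []"
    proof (rule erw_ex_mono)
      fix ys :: "(real^'a) list" assume ys: "length ys = length ([] :: (real^'a) list) + n"
      have ne: "ys \<noteq> []" using ys elim(2) by auto
      have "sqrt (real n) / 2 \<le> alpha (n - 1) * real n"
      proof (rule power2_le_imp_le)
        have "(sqrt (real n) / 2)\<^sup>2 = real n / 4" by (simp add: power_divide)
        also have "\<dots> \<le> alpha_lim * real n" using mult_right_mono[OF alpha_lim_bounds(1), of "real n"] by simp
        also have "\<dots> \<le> (real (n - 1) + 1) * (alpha (n - 1))\<^sup>2 * real n"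
          by (intro mult_right_mono alpha_lim_le) auto
        also have "real (n - 1) + 1 = real n" using elim(2) by simp
        finally show "(sqrt (real n) / 2)\<^sup>2 \<le> (alpha (n - 1) * real n)\<^sup>2"
          by (simp add: power2_eq_square algebra_simps)
      qed (use alpha_pos[of "n - 1"] in simp)
      then have "\<delta> * (sqrt (real n) / 2) \<le> \<delta> * (alpha (n - 1) * real n)"
        using assms(2) by (intro mult_left_mono) auto
      moreover have "alpha (n - 1) * (\<delta> * real n) \<le> alpha (n - 1) * \<bar>hsum h ys\<bar>" if "\<delta> * real n \<le> \<bar>hsum h ys\<bar>"
        using that alpha_pos[of "n - 1"] by (intro mult_left_mono) auto
      moreover have "\<bar>wsum h alpha ys\<bar> = alpha (n - 1) * \<bar>hsum h ys\<bar>"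
        using wsum_alpha[OF ne, of h] ys alpha_pos[of "n - 1"] by (simp add: abs_mult)
      ultimately show "of_bool (\<delta> * real n \<le> \<bar>hsum h ys\<bar>)
          \<le> (of_bool (\<delta> * sqrt (real n) / 2 \<le> \<bar>wsum h alpha ys\<bar>) :: real)"
        by (auto simp: algebra_simps)
    qed simp
    also have "\<dots> \<le> 2 * exp (6 * b\<^sup>2 * (1 / (2 * b))\<^sup>2 * (\<Sum>k<n. (alpha k)\<^sup>2) - (1 / (2 * b)) * (\<delta> * sqrt (real n) / 2))"
    proof (rule erw_wsum_tail[OF h])
      fix k show "\<bar>1 / (2 * b) * alpha k\<bar> * (2 * b) \<le> 1"
        using b alpha_pos[of k] alpha_le_1[of k] by (simp add: abs_mult)
    qed (use b in simp)
    also have "\<dots> \<le> 2 * exp (3/2 * (ln (real n) + 2) - \<kappa> * sqrt (real n))"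
    proof -
      have e: "6 * b\<^sup>2 * (1 / (2 * b))\<^sup>2 = 3/2" using b by (simp add: power_divide power_mult_distrib)
      have "(\<Sum>k<n. (alpha k)\<^sup>2) \<le> 1 * (ln (real n) + 2)"
        using alpha_sum_le[OF elim(2)] mult_right_mono[OF alpha_lim_bounds(2), of "ln (real n) + 2"] elim(2)
        by (simp add: ln_ge_zero add_nonneg_nonneg)
      moreover have "(1 / (2 * b)) * (\<delta> * sqrt (real n) / 2) = \<kappa> * sqrt (real n)"
        by (simp add: \<kappa>_def)
      ultimately show ?thesis unfolding e by simp
    qed
    finally show ?case using elim(1) by linarith
  qed
qed

text \<open>Lets the empirical second moment in \<open>cvar_eq\<close> be treated as a further
  centered additive functional.\<close>

lemma centered_square:
  assumes "centered h b"
  shows "centered (\<lambda>x. (h x)\<^sup>2 - erw_avg (\<lambda>x. (h x)\<^sup>2)) (b\<^sup>2)"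
proof -
  have b: "b > 0" using assms by (rule centered_pos)
  have hx: "(h x)\<^sup>2 \<le> b\<^sup>2" if "x \<in> erw_dirs" for x
    using assms that b by (auto simp: centered_def power2_le_iff_abs_le)
  have "erw_avg (\<lambda>x. (h x)\<^sup>2) \<le> b\<^sup>2"
    using erw_avg_mono[of "\<lambda>x. (h x)\<^sup>2" "\<lambda>_. b\<^sup>2"] hx by (simp add: erw_avg_const)
  moreover have "0 \<le> erw_avg (\<lambda>x. (h x)\<^sup>2)"
    using erw_avg_mono[of "\<lambda>_. 0" "\<lambda>x. (h x)\<^sup>2"] by (simp add: erw_avg_const)
  moreover have "erw_avg (\<lambda>x. (h x)\<^sup>2 - erw_avg (\<lambda>x. (h x)\<^sup>2)) = 0"
    using erw_next_diff[of "[]" "\<lambda>x. (h x)\<^sup>2" "\<lambda>_. erw_avg (\<lambda>x. (h x)\<^sup>2)"]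
    by (simp add: erw_next_def erw_avg_const)
  ultimately show ?thesis
    using b hx by (auto simp: centered_def abs_le_iff algebra_simps intro: add_increasing order_trans)
qed

definition good :: "(real^'d \<Rightarrow> real) \<Rightarrow> real \<Rightarrow> (real^'d) list \<Rightarrow> bool" where
  "good h \<delta> xs \<longleftrightarrow> \<bar>cvar h xs - erw_avg (\<lambda>x. (h x)\<^sup>2)\<bar> \<le> \<delta>"

lemma hsum_diff_const: "hsum (\<lambda>x. f x - c) xs = hsum f xs - c * real (length xs)"
  by (induction xs) (simp_all add: algebra_simps)

lemma bad_tail:
  assumes h: "centered h b" and "\<delta> > 0"
  shows "eventually (\<lambda>n. erw_ex n (\<lambda>ys. of_bool (\<not> good h \<delta> ys)) [] \<le> 2 / (real n)\<^sup>2) sequentially"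
proof -
  define s where "s = erw_avg (\<lambda>x. (h x)\<^sup>2)"
  \<comment> \<open>The mean of \<open>h\<close> enters the variance squared, and
    \<open>\<epsilon>^2 \<le> \<epsilon> \<le> \<delta>\<close> by this choice.\<close>
  define \<epsilon> where "\<epsilon> = min 1 \<delta>"
  have \<epsilon>: "\<epsilon> > 0" "\<epsilon> \<le> 1" "\<epsilon> \<le> \<delta>" using assms(2) by (auto simp: \<epsilon>_def)
  let ?h2 = "\<lambda>x. (h x)\<^sup>2 - s"
  have c2: "centered ?h2 (b\<^sup>2)" using centered_square[OF h] by (simp add: s_def)
  have key: "good h \<delta> ys" if "length ys = n" "n \<ge> 1" "\<bar>hsum h ys\<bar> < \<epsilon> * real n" "\<bar>hsum ?h2 ys\<bar> < \<delta> * real n"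
    for ys n
  proof -
    have ne: "ys \<noteq> []" using that by auto
    have n: "real n > 0" using that by simp
    have "cvar h ys - s = hsum ?h2 ys / real n / 2 - (hsum h ys / real n)\<^sup>2 / 4"
      unfolding cvar_eq[OF h ne] hsum_diff_const s_def[symmetric] using that n
      by (simp add: field_simps power2_eq_square)
    moreover have "\<bar>hsum ?h2 ys / real n\<bar> \<le> \<delta>" using that n by (simp add: abs_divide divide_le_eq)
    moreover have "(hsum h ys / real n)\<^sup>2 \<le> \<delta>"
    proof -
      have "\<bar>hsum h ys / real n\<bar> \<le> \<epsilon>" using that n by (simp add: abs_divide divide_le_eq)
      then have "\<bar>hsum h ys / real n\<bar>\<^sup>2 \<le> \<epsilon>\<^sup>2" by (intro power_mono) auto
      also have "\<dots> \<le> \<epsilon>" using \<epsilon> by (simp add: power2_eq_square mult_left_le)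
      finally show ?thesis using \<epsilon> by (simp only: power2_abs)
    qed
    moreover have "(hsum h ys / real n)\<^sup>2 \<ge> 0" by simp
    ultimately show ?thesis unfolding good_def s_def[symmetric] by (intro abs_leI; simp only: abs_le_iff) argo+
  qed
  show ?thesis
    using hsum_tail[OF h \<epsilon>(1)] hsum_tail[OF c2 assms(2)] eventually_ge_at_top[of 1]
  proof eventually_elim
    case (elim n)
    have "erw_ex n (\<lambda>ys. of_bool (\<not> good h \<delta> ys)) []
       \<le> erw_ex n (\<lambda>ys. of_bool (\<epsilon> * real n \<le> \<bar>hsum h ys\<bar>) + of_bool (\<delta> * real n \<le> \<bar>hsum ?h2 ys\<bar>)) []"
    proof (rule erw_ex_mono)
      fix ys :: "(real^'a) list" assume "length ys = length ([] :: (real^'a) list) + n"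
      then show "of_bool (\<not> good h \<delta> ys)
         \<le> (of_bool (\<epsilon> * real n \<le> \<bar>hsum h ys\<bar>) + of_bool (\<delta> * real n \<le> \<bar>hsum ?h2 ys\<bar>) :: real)"
        using key[of ys n] elim(3) by (auto simp: not_le)
    qed simp
    then show ?case using elim(1,2) by (simp add: erw_ex_add)
  qed
qed

text \<open>A union bound over the tail of a convergent series. Uniformity in \<open>N\<close> lets
  a single threshold for \<open>m\<close> serve all blocks, whatever their right end.\<close>

lemma bad_block:
  assumes h: "centered h b" and "\<delta> > 0"
  shows "eventually (\<lambda>m. \<forall>N. erw_ex N (\<lambda>ys. of_bool (\<exists>n\<in>{m..<N}. \<not> good h \<delta> (take n ys))) [] \<le> 4 / real m) sequentially"
proof -
  obtain m0 where m0: "\<And>n. n \<ge> m0 \<Longrightarrow> erw_ex n (\<lambda>ys. of_bool (\<not> good h \<delta> ys)) [] \<le> 2 / (real n)\<^sup>2"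
    using bad_tail[OF assms] by (auto simp: eventually_sequentially)
  have tele: "(\<Sum>n\<in>{m..<N}. 2 / (real n)\<^sup>2) \<le> 2 / (real m - 1) - 2 / (real N - 1)" if "m \<ge> 2" "N \<ge> m" for m N :: nat
    using that(2)
  proof (induction N rule: dec_induct)
    case (step N)
    have N: "real N \<ge> 2" using step that by simp
    have "1 / (real N)\<^sup>2 \<le> 1 / ((real N - 1) * real N)"
      using N by (intro divide_left_mono) (auto simp: power2_eq_square)
    also have "\<dots> = 1 / (real N - 1) - 1 / real N" using N by (simp add: field_simps)
    finally show ?case using step by simp
  qed simp
  show ?thesis
  proof (rule eventually_sequentiallyI, rule allI)
    fix m N assume m: "max m0 2 \<le> m"
    have "erw_ex N (\<lambda>ys. of_bool (\<exists>n\<in>{m..<N}. \<not> good h \<delta> (take n ys))) []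
       \<le> erw_ex N (\<lambda>ys. \<Sum>n\<in>{m..<N}. of_bool (\<not> good h \<delta> (take n ys))) []"
    proof (rule erw_ex_mono)
      fix ys :: "(real^'a) list"
      show "of_bool (\<exists>n\<in>{m..<N}. \<not> good h \<delta> (take n ys)) \<le> (\<Sum>n\<in>{m..<N}. of_bool (\<not> good h \<delta> (take n ys)) :: real)"
      proof (cases "\<exists>n\<in>{m..<N}. \<not> good h \<delta> (take n ys)")
        case True
        then obtain n where "n \<in> {m..<N}" "\<not> good h \<delta> (take n ys)" by blast
        then have "1 \<le> (\<Sum>n\<in>{m..<N}. of_bool (\<not> good h \<delta> (take n ys)) :: real)"
          using member_le_sum[of n "{m..<N}" "\<lambda>n. of_bool (\<not> good h \<delta> (take n ys)) :: real"] by auto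
        then show ?thesis by simp
      qed (simp add: sum_nonneg)
    qed simp
    also have "\<dots> = (\<Sum>n\<in>{m..<N}. erw_ex n (\<lambda>ys. of_bool (\<not> good h \<delta> ys)) [])"
      unfolding erw_ex_sum by (intro sum.cong refl erw_ex_take) auto
    also have "\<dots> \<le> (\<Sum>n\<in>{m..<N}. 2 / (real n)\<^sup>2)" using m by (intro sum_mono m0) auto
    also have "\<dots> \<le> 4 / real m"
    proof (cases "m \<le> N")
      case True
      then have "(\<Sum>n\<in>{m..<N}. 2 / (real n)\<^sup>2) \<le> 2 / (real m - 1) - 2 / (real N - 1)" using m by (intro tele) auto
      also have "\<dots> \<le> 2 / (real m - 1)" using m True by simp
      also have "\<dots> \<le> 4 / real m" using m by (simp add: field_simps)
      finally show ?thesis .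
    qed simp
    finally show "erw_ex N (\<lambda>ys. of_bool (\<exists>n\<in>{m..<N}. \<not> good h \<delta> (take n ys))) [] \<le> 4 / real m" .
  qed
qed

lemma (in erw) AE_good:
  assumes "centered h b" "\<delta> > 0"
  shows "AE \<omega> in M. eventually (\<lambda>n. good h \<delta> (path n \<omega>)) sequentially"
proof -
  have "summable (\<lambda>n. 2 / (real n)\<^sup>2)"
    using summable_mult[OF inverse_power_summable[of 2, where 'a=real], of 2] by (simp add: divide_inverse)
  from path_borel_cantelli[OF this bad_tail[OF assms]] show ?thesis by simp
qed

section \<open>Law of the iterated logarithm: upper bound\<close>

text \<open>The least admissible \<open>j\<close> with \<open>n < N (Suc j)\<close> works: if
  \<open>N j\<close> exceeded \<open>n\<close>, its predecessor would already qualify.\<close>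

lemma block_index:
  fixes N :: "nat \<Rightarrow> nat"
  assumes "filterlim N at_top sequentially" "N K \<le> n"
  shows "\<exists>k\<ge>K. N k \<le> n \<and> n < N (Suc k)"
proof -
  let ?P = "\<lambda>j. j \<ge> K \<and> n < N (Suc j)"
  have "eventually (\<lambda>j. n < N j) sequentially" using assms(1) unfolding filterlim_at_top by (metis (mono_tags, lifting) Suc_le_eq eventually_mono)
  then obtain j0 where "\<And>j. j \<ge> j0 \<Longrightarrow> n < N j" by (auto simp: eventually_sequentially)
  then have ex: "?P (max K j0)" by simp
  define k where "k = (LEAST j. ?P j)"
  have k: "?P k" unfolding k_def using ex by (rule LeastI)
  have "N k \<le> n"
  proof (cases "k = K")
    case False
    then obtain k' where k': "k = Suc k'" "k' \<ge> K" using k by (cases k) auto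
    then have "\<not> ?P k'" unfolding k_def by (metis k_def lessI not_less_Least)
    then show ?thesis using k' by auto
  qed (use assms(2) in simp)
  then show ?thesis using k by auto
qed

text \<open>Block ends are geometric on the logarithmic scale, the scale of the bracket. Up to
  additive constants \<open>ln (blk \<rho> k)\<close> is \<open>\<rho> ^ k\<close>, so the triple
  logarithm of the block end behaves like \<open>ln k\<close>.\<close>

definition blk :: "real \<Rightarrow> nat \<Rightarrow> nat" where
  "blk \<rho> k = nat \<lceil>exp (\<rho> ^ k)\<rceil>"

lemma blk_ge: "exp (\<rho> ^ k) \<le> real (blk \<rho> k)"
  by (simp add: blk_def)

lemma blk_pos: "blk \<rho> k \<ge> 1"
  using blk_ge[of \<rho> k] exp_gt_zero[of "\<rho> ^ k"] by (cases "blk \<rho> k") auto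

lemma ln_blk_ge: "\<rho> ^ k \<le> ln (real (blk \<rho> k))"
  using blk_ge[of \<rho> k] blk_pos[of \<rho> k] by (subst ln_ge_iff) auto

lemma ln_blk_le:
  assumes "\<rho> > 1"
  shows "ln (real (blk \<rho> k)) \<le> \<rho> ^ k + 1"
proof -
  have "real (blk \<rho> k) \<le> exp (\<rho> ^ k) + 1"
    unfolding blk_def by (simp add: of_nat_nat)
  also have "\<dots> \<le> exp (\<rho> ^ k) * exp 1"
  proof -
    have "exp (\<rho> ^ k) \<ge> (1::real)" using assms by simp
    moreover have "exp 1 \<ge> (2::real)" using exp_ge_add_one_self[of "1::real"] by simp
    ultimately have "exp (\<rho> ^ k) * 2 \<le> exp (\<rho> ^ k) * exp (1::real)" by (intro mult_left_mono) auto
    with \<open>exp (\<rho> ^ k) \<ge> 1\<close> show ?thesis by linarith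
  qed
  also have "\<dots> = exp (\<rho> ^ k + 1)" by (simp add: exp_add)
  finally have "ln (real (blk \<rho> k)) \<le> ln (exp (\<rho> ^ k + 1))"
    using blk_pos[of \<rho> k] by (subst ln_le_cancel_iff) auto
  then show ?thesis by simp
qed

lemma blk_mono: "\<rho> > 1 \<Longrightarrow> mono (blk \<rho>)"
  unfolding blk_def by (intro monoI nat_mono ceiling_mono) (simp add: power_increasing)

lemma blk_at_top:
  assumes "\<rho> > 1"
  shows "filterlim (blk \<rho>) at_top sequentially"
proof -
  have "filterlim (\<lambda>k. exp (\<rho> ^ k)) at_top sequentially" using assms by real_asymp
  then have "filterlim (\<lambda>k. real (blk \<rho> k)) at_top sequentially"
    by (rule filterlim_at_top_mono) (simp add: blk_ge)
  then show ?thesis unfolding filterlim_at_top by (metis (mono_tags, lifting) eventually_mono of_nat_le_iff)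
qed

text \<open>\<open>L k\<close> is \<open>ln (ln (\<rho> ^ k))\<close>, the triple logarithm near the
  left end of the block, and \<open>\<theta> k\<close> is the optimal Gaussian exponent for variance
  \<open>\<rho> ^ k * s * alpha_lim\<close>. The bracket uses up
  \<open>(1 + \<epsilon>) * L k\<close> of the level \<open>2 * (1 + \<epsilon>) * L k\<close>,
  which leaves a summable power of \<open>k\<close>. Goodness is demanded only from
  \<open>N0\<close> on; the earlier steps cost the factor \<open>exp (real N0)\<close>.\<close>

lemma lil_block_tail:
  fixes h :: "real^'d \<Rightarrow> real" and N0 :: nat
  assumes h: "centered h b" and s: "s = erw_avg (\<lambda>x. (h x)\<^sup>2)" "s > 0" and \<epsilon>: "0 < \<epsilon>" "\<epsilon> \<le> 1"
    and \<rho>: "\<rho> = 1 + \<epsilon> / 4" and \<delta>: "\<delta> = s * \<epsilon> / 16"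
  defines "L \<equiv> \<lambda>k. ln (real k * ln \<rho>)"
  defines "\<theta> \<equiv> \<lambda>k. sqrt (2 * L k / (\<rho> ^ k * (s * alpha_lim)))"
  shows "eventually (\<lambda>k. erw_ex (blk \<rho> (Suc k)) (\<lambda>ys. of_bool (\<exists>n\<in>{N0..length ys}.
           (\<forall>k\<in>{N0..<n}. good h \<delta> (take k ys)) \<and> 2 * (1 + \<epsilon>) * L k \<le> \<theta> k * wsum h alpha (take n ys))) []
         \<le> exp (real N0) * (real k * ln \<rho>) powr (- (1 + \<epsilon>))) sequentially"
proof -
  have \<rho>1: "\<rho> > 1" using \<rho> \<epsilon> by simp
  have b: "b > 0" using h by (rule centered_pos)
  define q where "q = s * alpha_lim"
  have q: "q > 0" using s by (simp add: q_def)
  \<comment> \<open>Then \<open>1/2 + \<eta>\<close> is half of \<open>1 + \<epsilon> / 16\<close>,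
    the same relative error that \<open>\<delta>\<close> allows for \<open>cvar\<close>; the product
    of the two factors stays below \<open>1 + \<epsilon> / 4\<close>.\<close>
  define \<eta> where "\<eta> = \<epsilon> / 32"
  have \<eta>: "\<eta> > 0" "\<eta> \<le> 1" using \<epsilon> by (auto simp: \<eta>_def)
  have ev1: "eventually (\<lambda>k. real k * ln \<rho> > 1) sequentially" using \<rho>1 by real_asymp
  have ev2: "eventually (\<lambda>k. 3 / \<rho> ^ k \<le> \<epsilon> / 4) sequentially" using \<rho>1 \<epsilon> by real_asymp
  have "(\<lambda>k. 2 * L k / (\<rho> ^ k * q)) \<longlonglongrightarrow> 0" unfolding L_def using \<rho>1 q by real_asymp
  then have "(\<lambda>k. sqrt (2 * L k / (\<rho> ^ k * q)) * (2 * b)) \<longlonglongrightarrow> sqrt 0 * (2 * b)"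
    by (intro tendsto_intros)
  then have ev3: "eventually (\<lambda>k. \<theta> k * (2 * b) \<le> \<eta>) sequentially"
    using \<eta> by (auto simp: \<theta>_def q_def[symmetric] dest!: order_tendstoD(2)[of _ _ _ \<eta>] elim: eventually_mono)
  have ev4: "eventually (\<lambda>k. N0 \<le> blk \<rho> (Suc k)) sequentially"
    using blk_at_top[OF \<rho>1] by (simp add: filterlim_at_top eventually_sequentially_Suc[of "\<lambda>k. N0 \<le> blk \<rho> k"])
  show ?thesis using ev1 ev2 ev3 ev4
  proof eventually_elim
    case (elim k)
    let ?N = "blk \<rho> (Suc k)"
    have L0: "L k > 0" using elim(1) by (simp add: L_def)
    have \<rho>k: "\<rho> ^ k > 0" using \<rho>1 by simp
    have \<theta>0: "\<theta> k \<ge> 0" using L0 \<rho>k q by (simp add: \<theta>_def q_def[symmetric])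
    have \<theta>2: "(\<theta> k)\<^sup>2 = 2 * L k / (\<rho> ^ k * q)" using L0 \<rho>k q by (simp add: \<theta>_def q_def[symmetric])
    define \<kappa> where "\<kappa> i = s / 2 * (1 + \<epsilon> / 4) * (\<theta> k)\<^sup>2 * (alpha i)\<^sup>2" for i
    let ?D = "\<lambda>xs x. alpha (length xs) * mdiff h xs x"
    let ?P = "\<lambda>ys. \<exists>n\<in>{N0..length ys}.
           (\<forall>k\<in>{N0..<n}. good h \<delta> (take k ys)) \<and> 2 * (1 + \<epsilon>) * L k \<le> \<theta> k * wsum h alpha (take n ys)"
    \<comment> \<open>The losses are \<open>1 + \<epsilon> / 4\<close> from the exponential moment
      and \<open>\<rho> + 3 / \<rho> ^ k \<le> 1 + \<epsilon> / 2\<close> from running to the right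
      end of the block. The \<open>3\<close> is \<open>1\<close> from rounding the block end plus
      \<open>2\<close> from \<open>alpha_sum_le\<close>.\<close>
    have sumk: "(\<Sum>i<?N. \<kappa> i) \<le> (1 + \<epsilon>) * L k"
    proof -
      have "(\<Sum>i<?N. \<kappa> i) = s / 2 * (1 + \<epsilon> / 4) * (\<theta> k)\<^sup>2 * (\<Sum>i<?N. (alpha i)\<^sup>2)"
        by (simp add: \<kappa>_def sum_distrib_left)
      also have "\<dots> \<le> s / 2 * (1 + \<epsilon> / 4) * (\<theta> k)\<^sup>2 * (alpha_lim * (ln (real ?N) + 2))"
        using s \<epsilon> by (intro mult_left_mono alpha_sum_le blk_pos) auto
      also have "\<dots> = (1 + \<epsilon> / 4) * L k * ((ln (real ?N) + 2) / \<rho> ^ k)"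
      proof -
        have "s / 2 * (1 + \<epsilon> / 4) * (\<theta> k)\<^sup>2 * (alpha_lim * (ln (real ?N) + 2))
            = ((1 + \<epsilon> / 4) * L k * ((ln (real ?N) + 2) / \<rho> ^ k)) * (s * alpha_lim / q)"
          unfolding \<theta>2 by simp
        also have "s * alpha_lim / q = 1" using q unfolding q_def by (metis divide_self less_irrefl)
        finally show ?thesis by simp
      qed
      also have "\<dots> \<le> (1 + \<epsilon> / 4) * L k * (1 + \<epsilon> / 2)"
      proof (rule mult_left_mono)
        have "(ln (real ?N) + 2) / \<rho> ^ k \<le> (\<rho> ^ Suc k + 1 + 2) / \<rho> ^ k"
          using ln_blk_le[OF \<rho>1, of "Suc k"] \<rho>k by (intro divide_right_mono) auto
        also have "\<dots> = \<rho> + 3 / \<rho> ^ k" using \<rho>k by (simp add: add_divide_distrib)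
        also have "\<dots> \<le> 1 + \<epsilon> / 2" using elim(2) \<rho> by simp
        finally show "(ln (real ?N) + 2) / \<rho> ^ k \<le> 1 + \<epsilon> / 2" .
      qed (use L0 \<epsilon> in simp)
      also have "\<dots> = ((1 + \<epsilon> / 4) * (1 + \<epsilon> / 2)) * L k" by simp
      also have "\<dots> \<le> (1 + \<epsilon>) * L k"
      proof (rule mult_right_mono)
        have "\<epsilon> * \<epsilon> \<le> \<epsilon>" using \<epsilon> by (simp add: mult_left_le)
        moreover have "(1 + \<epsilon> / 4) * (1 + \<epsilon> / 2) = 1 + 3 * \<epsilon> / 4 + \<epsilon> * \<epsilon> / 8" by (simp add: algebra_simps)
        ultimately show "(1 + \<epsilon> / 4) * (1 + \<epsilon> / 2) \<le> 1 + \<epsilon>" using \<epsilon> by linarith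
      qed (use L0 in simp)
      finally show ?thesis .
    qed
    have step: "erw_next zs (\<lambda>x. exp (\<theta> k * ?D zs x)) \<le> exp (\<kappa> (length zs))"
      if zs: "zs \<in> lists erw_dirs" "good h \<delta> zs" for zs
    proof -
      let ?a = "alpha (length zs)"
      have a: "?a > 0" "?a \<le> 1" using alpha_pos alpha_le_1 by auto
      have "erw_next zs (\<lambda>x. exp (\<theta> k * ?D zs x)) = erw_next zs (\<lambda>x. exp ((\<theta> k * ?a) * mdiff h zs x))"
        by (simp add: mult.assoc)
      also have "\<dots> \<le> exp ((1/2 + \<eta>) * (\<theta> k * ?a)\<^sup>2 * cvar h zs)"
      proof (rule erw_next_exp_bounds(1)[OF h zs(1) _ \<eta>(2)])
        have "\<bar>\<theta> k * ?a\<bar> * (2 * b) \<le> \<theta> k * 1 * (2 * b)"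
          using a \<theta>0 b by (intro mult_right_mono) (auto simp: abs_mult intro: mult_left_le)
        then show "\<bar>\<theta> k * ?a\<bar> * (2 * b) \<le> \<eta>" using elim(3) by simp
      qed
      also have "\<dots> \<le> exp (\<kappa> (length zs))"
      proof (subst exp_le_cancel_iff)
        have cv: "cvar h zs \<le> s * (1 + \<epsilon> / 16)" 
        proof -
          have "cvar h zs - s \<le> s * \<epsilon> / 16"
            using zs(2) unfolding good_def s(1)[symmetric] \<delta> by (rule abs_le_D1)
          then show ?thesis by (simp add: distrib_left)
        qed
        have "(1/2 + \<eta>) * cvar h zs \<le> (1/2 + \<eta>) * (s * (1 + \<epsilon> / 16))"
          using cv \<eta> by (intro mult_left_mono) auto
        also have "\<dots> = s / 2 * ((1 + \<epsilon> / 16) * (1 + \<epsilon> / 16))" by (simp add: \<eta>_def algebra_simps)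
        also have "\<dots> \<le> s / 2 * (1 + \<epsilon> / 4)"
        proof (rule mult_left_mono)
          have "\<epsilon> * \<epsilon> \<le> \<epsilon>" using \<epsilon> by (simp add: mult_left_le)
          moreover have "(1 + \<epsilon> / 16) * (1 + \<epsilon> / 16) = 1 + \<epsilon> / 8 + \<epsilon> * \<epsilon> / 256" by (simp add: algebra_simps)
          ultimately show "(1 + \<epsilon> / 16) * (1 + \<epsilon> / 16) \<le> 1 + \<epsilon> / 4" using \<epsilon> by linarith
        qed (use s in simp)
        finally have "(1/2 + \<eta>) * cvar h zs * (\<theta> k * ?a)\<^sup>2 \<le> s / 2 * (1 + \<epsilon> / 4) * (\<theta> k * ?a)\<^sup>2"
          by (rule mult_right_mono) simp
        then show "(1/2 + \<eta>) * (\<theta> k * ?a)\<^sup>2 * cvar h zs \<le> \<kappa> (length zs)"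
          by (simp add: \<kappa>_def power_mult_distrib mult.commute mult.left_commute)
      qed
      finally show ?thesis .
    qed
    have \<kappa>0: "\<kappa> i \<ge> 0" for i using s \<epsilon> by (simp add: \<kappa>_def)
    have "erw_ex ?N (\<lambda>ys. of_bool (?P ys)) [] = erw_ex N0 (erw_ex (?N - N0) (\<lambda>ys. of_bool (?P ys))) []"
      by (subst erw_ex_compose[symmetric]) (simp add: elim(4))
    also have "\<dots> \<le> erw_ex N0 (\<lambda>_ :: (real^'d) list. exp (real N0 - (1 + \<epsilon>) * L k)) []"
    proof (rule erw_ex_mono)
      fix zs :: "(real^'d) list" assume zs: "zs \<in> lists erw_dirs" "length zs = length ([]::(real^'d) list) + N0"
      then have lz: "length zs = N0" by simp
      have "erw_ex (?N - N0) (\<lambda>ys. of_bool (?P ys)) zs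
         \<le> exp (\<theta> k * msum ?D zs - 2 * (1 + \<epsilon>) * L k + (\<Sum>i\<in>{N0..<N0 + (?N - N0)}. \<kappa> i))"
        unfolding wsum_def lz[symmetric] by (rule erw_maximal[OF zs(1) \<kappa>0]) (rule step)
      also have "\<dots> \<le> exp (real N0 - (1 + \<epsilon>) * L k)"
      proof (subst exp_le_cancel_iff)
        have "(\<Sum>i\<in>{N0..<N0 + (?N - N0)}. \<kappa> i) \<le> (\<Sum>i<?N. \<kappa> i)"
          using elim(4) \<kappa>0 by (intro sum_mono2) auto
        then have 1: "(\<Sum>i\<in>{N0..<N0 + (?N - N0)}. \<kappa> i) \<le> (1 + \<epsilon>) * L k" using sumk by linarith
        \<comment> \<open>The uncontrolled initial segment: each increment is at most
          \<open>2 * b\<close>, and \<open>\<theta> k * (2 * b) \<le> 1\<close>, so its exponent is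
          at most \<open>N0\<close>.\<close>
        have "\<bar>msum ?D zs\<bar> \<le> (\<Sum>i<length zs. 2 * b)"
          unfolding msum_def
        proof (rule order.trans[OF sum_abs], rule sum_mono)
          fix i assume i: "i \<in> {..<length zs}"
          have "\<bar>mdiff h (take i zs) (zs ! i)\<bar> \<le> 2 * b"
            using zs(1) i by (intro mdiff_bound[OF h]) (auto dest: in_set_takeD simp: in_lists_conv_set)
          moreover have "\<bar>alpha (length (take i zs))\<bar> \<le> 1" using alpha_pos alpha_le_1 by (simp add: less_imp_le)
          ultimately show "\<bar>?D (take i zs) (zs ! i)\<bar> \<le> 2 * b"
            using mult_mono[of "\<bar>alpha (length (take i zs))\<bar>" 1 "\<bar>mdiff h (take i zs) (zs ! i)\<bar>" "2 * b"] b
            by (simp only: abs_mult) simp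
        qed
        then have "msum ?D zs \<le> real N0 * (2 * b)" by (simp add: lz)
        then have "\<theta> k * msum ?D zs \<le> \<theta> k * (real N0 * (2 * b))" using \<theta>0 by (rule mult_left_mono)
        also have "\<dots> = real N0 * (\<theta> k * (2 * b))" by simp
        also have "\<dots> \<le> real N0 * 1" using elim(3) \<eta>(2) by (intro mult_left_mono) auto
        finally show "\<theta> k * msum ?D zs - 2 * (1 + \<epsilon>) * L k + (\<Sum>i\<in>{N0..<N0 + (?N - N0)}. \<kappa> i)
            \<le> real N0 - (1 + \<epsilon>) * L k"
          using 1 by (simp add: algebra_simps)
      qed
      finally show "erw_ex (?N - N0) (\<lambda>ys. of_bool (?P ys)) zs \<le> exp (real N0 - (1 + \<epsilon>) * L k)" .
    qed simp
    also have "\<dots> = exp (real N0 - (1 + \<epsilon>) * L k)" by (rule erw_ex_const)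
    also have "\<dots> = exp (real N0) * exp (- (1 + \<epsilon>) * L k)" by (simp only: exp_add[symmetric]) (simp add: algebra_simps)
    also have "exp (- (1 + \<epsilon>) * L k) = (real k * ln \<rho>) powr (- (1 + \<epsilon>))"
      using elim(1) \<rho>1 by (cases "k = 0") (simp_all add: powr_def L_def)
    finally show ?case .
  qed
qed

text \<open>The time after which every prefix is good is random. The block bound is therefore taken
  for all \<open>N0\<close> simultaneously, and \<open>N0\<close> is picked once
  \<open>\<omega>\<close> is fixed.\<close>

lemma (in erw) lil_upper_aux:
  fixes h :: "real^'d \<Rightarrow> real"
  assumes h: "centered h b" and s: "s = erw_avg (\<lambda>x. (h x)\<^sup>2)" "s > 0" and \<epsilon>: "0 < \<epsilon>" "\<epsilon> \<le> 1"
  shows "AE \<omega> in M. eventually (\<lambda>n. wsum h alpha (path n \<omega>)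
     \<le> (1 + \<epsilon>) * sqrt (2 * (s * alpha_lim) * ln (real n) * ln (ln (ln (real n))))) sequentially"
proof -
  define \<rho> where "\<rho> = 1 + \<epsilon> / 4"
  define \<delta> where "\<delta> = s * \<epsilon> / 16"
  define L where "L k = ln (real k * ln \<rho>)" for k
  define q where "q = s * alpha_lim"
  define \<theta> where "\<theta> k = sqrt (2 * L k / (\<rho> ^ k * q))" for k
  have \<rho>1: "\<rho> > 1" and \<delta>0: "\<delta> > 0" using \<epsilon> s(2) by (auto simp: \<rho>_def \<delta>_def)
  have q: "q > 0" using s by (simp add: q_def)
  let ?P = "\<lambda>N0 k ys. \<exists>n\<in>{N0..length ys}.
           (\<forall>k\<in>{N0..<n}. good h \<delta> (take k ys)) \<and> 2 * (1 + \<epsilon>) * L k \<le> \<theta> k * wsum h alpha (take n ys)"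
  have summ: "summable (\<lambda>k. exp (real N0) * (real k * ln \<rho>) powr (- (1 + \<epsilon>)))" for N0
  proof -
    have "summable (\<lambda>k. real k powr (- (1 + \<epsilon>)))" using \<epsilon> by (subst summable_real_powr_iff) simp
    then have "summable (\<lambda>k. (exp (real N0) * (ln \<rho>) powr (- (1 + \<epsilon>))) * real k powr (- (1 + \<epsilon>)))"
      by (rule summable_mult)
    then show ?thesis using \<rho>1 by (simp add: powr_mult mult_ac)
  qed
  have "AE \<omega> in M. eventually (\<lambda>k. \<not> ?P N0 k (path (blk \<rho> (Suc k)) \<omega>)) sequentially" for N0
    using lil_block_tail[OF h s \<epsilon> \<rho>_def \<delta>_def, of N0]
    unfolding L_def[symmetric] q_def[symmetric] \<theta>_def[symmetric]
    by (rule path_borel_cantelli[OF summ])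
  then have "AE \<omega> in M. \<forall>N0. eventually (\<lambda>k. \<not> ?P N0 k (path (blk \<rho> (Suc k)) \<omega>)) sequentially"
    by (subst AE_all_countable) blast
  with AE_good[OF h \<delta>0] show ?thesis
  proof eventually_elim
    case (elim \<omega>)
    obtain N0 where N0: "\<And>n. n \<ge> N0 \<Longrightarrow> good h \<delta> (path n \<omega>)"
      using elim(1) by (auto simp: eventually_sequentially)
    have "eventually (\<lambda>k. real k * ln \<rho> > 1) sequentially" using \<rho>1 by real_asymp
    moreover have "eventually (\<lambda>k. \<not> ?P N0 k (path (blk \<rho> (Suc k)) \<omega>)) sequentially" using elim(2) by blast
    moreover have "eventually (\<lambda>k. N0 \<le> blk \<rho> k) sequentially"
      using blk_at_top[OF \<rho>1] by (simp add: filterlim_at_top)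
    ultimately have "eventually (\<lambda>k. real k * ln \<rho> > 1 \<and> \<not> ?P N0 k (path (blk \<rho> (Suc k)) \<omega>) \<and> N0 \<le> blk \<rho> k) sequentially"
      by eventually_elim auto
    then obtain K where K: "\<And>k. k \<ge> K \<Longrightarrow> real k * ln \<rho> > 1"
      "\<And>k. k \<ge> K \<Longrightarrow> \<not> ?P N0 k (path (blk \<rho> (Suc k)) \<omega>)" "\<And>k. k \<ge> K \<Longrightarrow> N0 \<le> blk \<rho> k"
      by (auto simp: eventually_sequentially)
    show ?case
    proof (rule eventually_sequentiallyI[of "blk \<rho> K"])
      fix n assume n: "blk \<rho> K \<le> n"
      obtain k where k: "k \<ge> K" "blk \<rho> k \<le> n" "n < blk \<rho> (Suc k)"
        using block_index[OF blk_at_top[OF \<rho>1] n] by blast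
      let ?N = "blk \<rho> (Suc k)"
      have kl: "real k * ln \<rho> > 1" using K(1) k by simp
      have L0: "L k > 0" using kl by (simp add: L_def)
      have \<rho>k: "\<rho> ^ k > 0" using \<rho>1 by simp
      have \<theta>0: "\<theta> k > 0" using L0 \<rho>k q by (simp add: \<theta>_def)
      have "n \<in> {N0..length (path ?N \<omega>)}" using K(3)[OF k(1)] k by simp
      moreover have "\<forall>i\<in>{N0..<n}. good h \<delta> (take i (path ?N \<omega>))"
        using k(3) by (auto simp: take_path intro: N0)
      ultimately have "\<not> 2 * (1 + \<epsilon>) * L k \<le> \<theta> k * wsum h alpha (take n (path ?N \<omega>))"
        using K(2)[OF k(1)] by blast
      then have "\<theta> k * wsum h alpha (path n \<omega>) < 2 * (1 + \<epsilon>) * L k" using k(3) by (simp add: take_path not_le)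
      also have "\<dots> = \<theta> k * ((1 + \<epsilon>) * sqrt (2 * q * \<rho> ^ k * L k))"
      proof -
        have "\<theta> k * sqrt (2 * q * \<rho> ^ k * L k) = sqrt ((2 * L k / (\<rho> ^ k * q)) * (2 * q * \<rho> ^ k * L k))"
          by (simp add: \<theta>_def real_sqrt_mult[symmetric])
        also have "(2 * L k / (\<rho> ^ k * q)) * (2 * q * \<rho> ^ k * L k) = (2 * L k)\<^sup>2"
          using q \<rho>1 by (simp add: power2_eq_square)
        also have "sqrt ((2 * L k)\<^sup>2) = 2 * L k" using L0 by (simp only: real_sqrt_abs)
        finally have e: "\<theta> k * sqrt (2 * q * \<rho> ^ k * L k) = 2 * L k" .
        show ?thesis unfolding mult.left_commute[of "\<theta> k"] e by simp
      qed
      finally have "wsum h alpha (path n \<omega>) < (1 + \<epsilon>) * sqrt (2 * q * \<rho> ^ k * L k)"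
        using \<theta>0 by simp
      also have "\<dots> \<le> (1 + \<epsilon>) * sqrt (2 * q * ln (real n) * ln (ln (ln (real n))))"
      proof -
        have "ln (real (blk \<rho> k)) \<le> ln (real n)" using k(2) blk_pos[of \<rho> k] by (subst ln_le_cancel_iff) auto
        then have 1: "\<rho> ^ k \<le> ln (real n)" using ln_blk_ge[of \<rho> k] by linarith
        have 2: "ln (\<rho> ^ k) = real k * ln \<rho>" using \<rho>1 by (simp add: ln_realpow)
        have 3: "real k * ln \<rho> \<le> ln (ln (real n))"
          unfolding 2[symmetric] using 1 \<rho>k by (subst ln_le_cancel_iff) auto
        then have "L k \<le> ln (ln (ln (real n)))" unfolding L_def using kl by (subst ln_le_cancel_iff) auto
        then have "2 * q * \<rho> ^ k * L k \<le> 2 * q * ln (real n) * ln (ln (ln (real n)))"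
          using 1 q \<rho>k L0 by (intro mult_mono) auto
        then show ?thesis using \<epsilon> by simp
      qed
      finally show "wsum h alpha (path n \<omega>) \<le> (1 + \<epsilon>) * sqrt (2 * (s * alpha_lim) * ln (real n) * ln (ln (ln (real n))))"
        by (simp add: q_def)
    qed
  qed
qed

lemma (in erw) lil_upper:
  fixes h :: "real^'d \<Rightarrow> real"
  assumes h: "centered h b" and s: "s = erw_avg (\<lambda>x. (h x)\<^sup>2)" "s > 0" and \<epsilon>: "0 < \<epsilon>"
  shows "AE \<omega> in M. eventually (\<lambda>n. wsum h alpha (path n \<omega>)
     \<le> (1 + \<epsilon>) * sqrt (2 * (s * alpha_lim) * ln (real n) * ln (ln (ln (real n))))) sequentially"
proof -
  have "AE \<omega> in M. eventually (\<lambda>n. wsum h alpha (path n \<omega>)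
     \<le> (1 + min \<epsilon> 1) * sqrt (2 * (s * alpha_lim) * ln (real n) * ln (ln (ln (real n))))) sequentially"
    using \<epsilon> by (intro lil_upper_aux[OF h s]) auto
  then show ?thesis
  proof eventually_elim
    case (elim \<omega>)
    have "eventually (\<lambda>n::nat. ln (real n) * ln (ln (ln (real n))) \<ge> 0) sequentially" by real_asymp
    with elim show ?case
    proof eventually_elim
      case (elim n)
      have "(1 + min \<epsilon> 1) * sqrt (2 * (s * alpha_lim) * ln (real n) * ln (ln (ln (real n))))
         \<le> (1 + \<epsilon>) * sqrt (2 * (s * alpha_lim) * ln (real n) * ln (ln (ln (real n))))"
      proof (rule mult_right_mono)
        have "0 \<le> 2 * (s * alpha_lim) * (ln (real n) * ln (ln (ln (real n))))"
          using s(2) by (intro mult_nonneg_nonneg[OF _ elim(2)]) (simp add: less_imp_le)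
        then show "0 \<le> sqrt (2 * (s * alpha_lim) * ln (real n) * ln (ln (ln (real n))))"
          by (simp only: mult.assoc real_sqrt_ge_0_iff)
      qed simp
      with elim(1) show ?case by linarith
    qed
  qed
qed

section \<open>Law of the iterated logarithm: lower bound\<close>

text \<open>Mass is killed at the first bad prefix. On surviving paths
  \<open>cvar \<le> s + \<delta>\<close>, so a deterministic normalization turns the exponential
  into a supermartingale.\<close>

lemma killed_mgf_upper:
  fixes h :: "real^'d \<Rightarrow> real"
  assumes h: "centered h b" and s: "s = erw_avg (\<lambda>x. (h x)\<^sup>2)" and zs: "zs \<in> lists erw_dirs"
    and \<eta>: "\<And>k. length zs \<le> k \<Longrightarrow> k < length zs + j \<Longrightarrow> \<bar>\<theta> * alpha k\<bar> * (2 * b) \<le> \<eta>" "\<eta> \<le> 1" "0 \<le> \<eta>"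
  shows "erw_ex j (\<lambda>ys. of_bool (\<forall>k\<in>{length zs..<length zs + j}. good h \<delta> (take k ys))
            * exp (\<theta> * (wsum h alpha ys - wsum h alpha zs))) zs
     \<le> exp ((1/2 + \<eta>) * \<theta>\<^sup>2 * (s + \<delta>) * (\<Sum>k\<in>{length zs..<length zs + j}. (alpha k)\<^sup>2))"
proof -
  let ?m = "length zs"
  let ?C = "(1/2 + \<eta>) * \<theta>\<^sup>2 * (s + \<delta>)"
  let ?V = "\<lambda>n. \<Sum>k\<in>{?m..<n}. (alpha k)\<^sup>2"
  let ?g = "\<lambda>ys. \<forall>k\<in>{?m..<length ys}. good h \<delta> (take k ys)"
  let ?f = "\<lambda>ys. of_bool (?g ys) * exp (\<theta> * (wsum h alpha ys - wsum h alpha zs) - ?C * ?V (length ys))"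
  have "erw_ex j ?f zs \<le> ?f zs"
  proof (rule erw_ex_supermartingale[OF zs])
    fix ys :: "(real^'d) list" assume ys: "ys \<in> lists erw_dirs" "?m \<le> length ys" "length ys < ?m + j"
    let ?n = "length ys"
    have g: "?g (ys @ [x]) \<longleftrightarrow> ?g ys \<and> good h \<delta> ys" for x
      using ys(2) by (auto simp: atLeastLessThanSuc)
    have eq: "?f (ys @ [x]) = (?f ys * of_bool (good h \<delta> ys) * exp (- ?C * (alpha ?n)\<^sup>2)) * exp ((\<theta> * alpha ?n) * mdiff h ys x)" for x
      unfolding g using ys(2) by (simp add: mult_exp_exp algebra_simps)
    have "erw_next ys (\<lambda>x. ?f (ys @ [x]))
        = ?f ys * of_bool (good h \<delta> ys) * exp (- ?C * (alpha ?n)\<^sup>2) * erw_next ys (\<lambda>x. exp ((\<theta> * alpha ?n) * mdiff h ys x))"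
      unfolding eq by (rule erw_next_cmult)
    also have "\<dots> \<le> ?f ys"
    proof (cases "good h \<delta> ys")
      case True
      have "erw_next ys (\<lambda>x. exp ((\<theta> * alpha ?n) * mdiff h ys x)) \<le> exp ((1/2 + \<eta>) * (\<theta> * alpha ?n)\<^sup>2 * cvar h ys)"
        using \<eta> ys by (intro erw_next_exp_bounds(1)[OF h]) auto
      also have "\<dots> \<le> exp ((1/2 + \<eta>) * (\<theta> * alpha ?n)\<^sup>2 * (s + \<delta>))"
      proof (subst exp_le_cancel_iff, rule mult_left_mono)
        show "cvar h ys \<le> s + \<delta>" using True unfolding good_def s[symmetric] by (auto dest: abs_le_D1)
      qed (use \<eta> in simp)
      also have "(1/2 + \<eta>) * (\<theta> * alpha ?n)\<^sup>2 * (s + \<delta>) = ?C * (alpha ?n)\<^sup>2" by (simp add: power_mult_distrib)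
      finally have "?f ys * exp (- ?C * (alpha ?n)\<^sup>2) * erw_next ys (\<lambda>x. exp ((\<theta> * alpha ?n) * mdiff h ys x))
         \<le> ?f ys * exp (- ?C * (alpha ?n)\<^sup>2) * exp (?C * (alpha ?n)\<^sup>2)"
        by (rule mult_left_mono) simp
      also have "\<dots> = ?f ys" by (simp only: mult.assoc mult_exp_exp) simp
      finally show ?thesis using True by simp
    qed simp
    finally show "erw_next ys (\<lambda>x. ?f (ys @ [x])) \<le> ?f ys" .
  qed
  then have 1: "erw_ex j ?f zs \<le> 1" by simp
  have "erw_ex j (\<lambda>ys. of_bool (\<forall>k\<in>{?m..<?m + j}. good h \<delta> (take k ys)) * exp (\<theta> * (wsum h alpha ys - wsum h alpha zs))) zs
      = erw_ex j (\<lambda>ys. exp (?C * ?V (?m + j)) * ?f ys) zs"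
    by (intro erw_ex_cong[OF zs]) (simp add: mult_exp_exp)
  also have "\<dots> = exp (?C * ?V (?m + j)) * erw_ex j ?f zs" by (rule erw_ex_cmult)
  also have "\<dots> \<le> exp (?C * ?V (?m + j)) * 1" using 1 by (intro mult_left_mono) auto
  finally show ?thesis by simp
qed

text \<open>Killing loses mass, so a submartingale is run on all paths and the bad ones are
  subtracted afterwards. Their weight splits into a second moment at \<open>2 * \<theta>\<close>,
  where the crude bound gives \<open>6 * b^2 * 4 = 24 * b^2\<close>, and the probability
  \<open>\<beta>\<close>; the condition \<open>t(2)\<close> keeps the total loss below one
  half.\<close>

lemma killed_mgf_lower:
  fixes h :: "real^'d \<Rightarrow> real"
  assumes h: "centered h b" and s: "s = erw_avg (\<lambda>x. (h x)\<^sup>2)" and zs: "zs \<in> lists erw_dirs"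
    and \<eta>: "\<And>k. length zs \<le> k \<Longrightarrow> k < length zs + j \<Longrightarrow> \<bar>\<theta> * alpha k\<bar> * (2 * b) \<le> \<eta>" "\<eta> \<le> 1/4" "0 \<le> \<eta>"
    and \<delta>: "\<delta> \<le> s"
    and t: "t > 0" "t / 2 * exp (24 * b\<^sup>2 * \<theta>\<^sup>2 * (\<Sum>k\<in>{length zs..<length zs + j}. (alpha k)\<^sup>2)) + \<beta> / (2 * t) \<le> 1/2"
    and \<beta>: "erw_ex j (\<lambda>ys. of_bool (\<exists>k\<in>{length zs..<length zs + j}. \<not> good h \<delta> (take k ys))) zs \<le> \<beta>"
  shows "1/2 * exp ((1/2 - 2 * \<eta>) * \<theta>\<^sup>2 * (s - \<delta>) * (\<Sum>k\<in>{length zs..<length zs + j}. (alpha k)\<^sup>2))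
     \<le> erw_ex j (\<lambda>ys. of_bool (\<forall>k\<in>{length zs..<length zs + j}. good h \<delta> (take k ys))
            * exp (\<theta> * (wsum h alpha ys - wsum h alpha zs))) zs"
proof -
  let ?m = "length zs"
  let ?C = "(1/2 - 2 * \<eta>) * \<theta>\<^sup>2 * (s - \<delta>)"
  let ?d = "\<lambda>ys. wsum h alpha ys - wsum h alpha zs"
  \<comment> \<open>Only good steps are credited with variance. At a bad step the exponential factor
    has mean at least one, so the submartingale property survives.\<close>
  let ?v = "\<lambda>ys k. of_bool (good h \<delta> (take k ys)) * (alpha k)\<^sup>2"
  let ?V = "\<lambda>ys. \<Sum>k\<in>{?m..<length ys}. ?v ys k"
  let ?f = "\<lambda>ys. exp (\<theta> * ?d ys - ?C * ?V ys)"
  let ?A = "\<Sum>k\<in>{?m..<?m + j}. (alpha k)\<^sup>2"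
  let ?B = "\<lambda>ys. \<forall>k\<in>{?m..<?m + j}. good h \<delta> (take k ys)"
  have C0: "?C \<ge> 0" using \<eta> \<delta> by simp
  have "?f zs \<le> erw_ex j ?f zs"
  proof (rule erw_ex_submartingale[OF zs])
    fix ys :: "(real^'d) list" assume ys: "ys \<in> lists erw_dirs" "?m \<le> length ys" "length ys < ?m + j"
    let ?n = "length ys"
    have V: "?V (ys @ [x]) = ?V ys + of_bool (good h \<delta> ys) * (alpha ?n)\<^sup>2" for x
    proof -
      have "(\<Sum>k\<in>{?m..<?n}. ?v (ys @ [x]) k) = ?V ys" by (intro sum.cong) auto
      moreover have "?V (ys @ [x]) = (\<Sum>k\<in>{?m..<?n}. ?v (ys @ [x]) k) + ?v (ys @ [x]) ?n"
        using ys(2) by (simp only: length_append_singleton) (rule sum.atLeastLessThan_Suc)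
      ultimately show ?thesis by simp
    qed
    have eq: "?f (ys @ [x]) = (?f ys * exp (- ?C * (of_bool (good h \<delta> ys) * (alpha ?n)\<^sup>2))) * exp ((\<theta> * alpha ?n) * mdiff h ys x)" for x
      unfolding V by (simp add: mult_exp_exp algebra_simps)
    have "exp (?C * (of_bool (good h \<delta> ys) * (alpha ?n)\<^sup>2)) \<le> erw_next ys (\<lambda>x. exp ((\<theta> * alpha ?n) * mdiff h ys x))"
    proof (cases "good h \<delta> ys")
      case True
      have "?C * (of_bool (good h \<delta> ys) * (alpha ?n)\<^sup>2) = (1/2 - 2 * \<eta>) * (\<theta> * alpha ?n)\<^sup>2 * (s - \<delta>)"
        using True by (simp add: power_mult_distrib)
      also have "\<dots> \<le> (1/2 - 2 * \<eta>) * (\<theta> * alpha ?n)\<^sup>2 * cvar h ys"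
      proof (rule mult_left_mono)
        show "s - \<delta> \<le> cvar h ys" using True unfolding good_def s[symmetric] by (auto dest: abs_le_D2)
      qed (use \<eta> in simp)
      finally have "exp (?C * (of_bool (good h \<delta> ys) * (alpha ?n)\<^sup>2)) \<le> exp ((1/2 - 2 * \<eta>) * (\<theta> * alpha ?n)\<^sup>2 * cvar h ys)"
        by simp
      also have "\<dots> \<le> erw_next ys (\<lambda>x. exp ((\<theta> * alpha ?n) * mdiff h ys x))"
        using \<eta> ys by (intro erw_next_exp_bounds(2)[OF h]) auto
      finally show ?thesis .
    next
      case False
      then show ?thesis using erw_next_exp_ge_1[OF h ys(1)] by simp
    qed
    then have "?f ys * exp (- ?C * (of_bool (good h \<delta> ys) * (alpha ?n)\<^sup>2)) * exp (?C * (of_bool (good h \<delta> ys) * (alpha ?n)\<^sup>2))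
       \<le> ?f ys * exp (- ?C * (of_bool (good h \<delta> ys) * (alpha ?n)\<^sup>2)) * erw_next ys (\<lambda>x. exp ((\<theta> * alpha ?n) * mdiff h ys x))"
      by (rule mult_left_mono) simp
    also have "\<dots> = erw_next ys (\<lambda>x. ?f (ys @ [x]))"
      unfolding eq by (rule erw_next_cmult[symmetric])
    finally show "?f ys \<le> erw_next ys (\<lambda>x. ?f (ys @ [x]))" by (simp only: mult.assoc mult_exp_exp) simp
  qed
  then have "1 \<le> erw_ex j ?f zs" by simp
  also have "\<dots> \<le> erw_ex j (\<lambda>ys. exp (- ?C * ?A) * (of_bool (?B ys) * exp (\<theta> * ?d ys))
      + ((t / 2) * exp ((2 * \<theta>) * ?d ys) + (1 / (2 * t)) * of_bool (\<exists>k\<in>{?m..<?m + j}. \<not> good h \<delta> (take k ys)))) zs"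
  proof (rule erw_ex_mono[OF zs])
    fix ys :: "(real^'d) list" assume ly: "length ys = ?m + j"
    let ?e = "exp (\<theta> * ?d ys)"
    have e2: "exp ((2 * \<theta>) * ?d ys) = ?e * ?e" by (simp add: mult_exp_exp)
    show "?f ys \<le> exp (- ?C * ?A) * (of_bool (?B ys) * exp (\<theta> * ?d ys))
      + ((t / 2) * exp ((2 * \<theta>) * ?d ys) + (1 / (2 * t)) * of_bool (\<exists>k\<in>{?m..<?m + j}. \<not> good h \<delta> (take k ys)))"
    proof (cases "?B ys")
      case True
      then have "?V ys = ?A" using ly by (intro sum.cong) auto
      then have "?f ys = exp (- ?C * ?A) * ?e" by (simp add: mult_exp_exp)
      moreover have "0 \<le> (t / 2) * (?e * ?e)" using t(1) by simp
      ultimately show ?thesis using True unfolding e2 by auto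
    next
      case False
      have "?V ys \<ge> 0" by (intro sum_nonneg) auto
      then have "?f ys \<le> ?e" using C0 by simp
      \<comment> \<open>AM-GM, a pointwise form of Cauchy-Schwarz: on bad paths the weight is split
        between its square and a constant, and \<open>t\<close> balances the two parts.\<close>
      also have "?e \<le> (t / 2) * (?e * ?e) + 1 / (2 * t)"
      proof -
        have "0 \<le> (t * ?e - 1)\<^sup>2 / (2 * t)" using t(1) by simp
        also have "\<dots> = (t / 2) * (?e * ?e) + 1 / (2 * t) - ?e"
          using t(1) by (simp add: power2_eq_square field_simps)
        finally show ?thesis by simp
      qed
      finally show ?thesis using False unfolding e2 by auto
    qed
  qed
  also have "\<dots> = exp (- ?C * ?A) * erw_ex j (\<lambda>ys. of_bool (?B ys) * exp (\<theta> * ?d ys)) zs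
     + ((t / 2) * erw_ex j (\<lambda>ys. exp ((2 * \<theta>) * ?d ys)) zs
        + (1 / (2 * t)) * erw_ex j (\<lambda>ys. of_bool (\<exists>k\<in>{?m..<?m + j}. \<not> good h \<delta> (take k ys))) zs)"
    by (simp only: erw_ex_add erw_ex_cmult)
  also have "(t / 2) * erw_ex j (\<lambda>ys. exp ((2 * \<theta>) * ?d ys)) zs
        + (1 / (2 * t)) * erw_ex j (\<lambda>ys. of_bool (\<exists>k\<in>{?m..<?m + j}. \<not> good h \<delta> (take k ys))) zs \<le> 1/2"
  proof -
    have "erw_ex j (\<lambda>ys. exp ((2 * \<theta>) * ?d ys)) zs \<le> exp (6 * b\<^sup>2 * (2 * \<theta>)\<^sup>2 * ?A)"
    proof (rule erw_ex_exp_wsum[OF h zs])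
      fix k assume "?m \<le> k" "k < ?m + j"
      from \<eta>(1)[OF this] show "\<bar>2 * \<theta> * alpha k\<bar> * (2 * b) \<le> 1" using \<eta>(2) by (simp add: abs_mult)
    qed
    also have "6 * b\<^sup>2 * (2 * \<theta>)\<^sup>2 * ?A = 24 * b\<^sup>2 * \<theta>\<^sup>2 * ?A" by (simp add: power_mult_distrib)
    finally have "(t / 2) * erw_ex j (\<lambda>ys. exp ((2 * \<theta>) * ?d ys)) zs \<le> (t / 2) * exp (24 * b\<^sup>2 * \<theta>\<^sup>2 * ?A)"
      using t(1) by (intro mult_left_mono) auto
    moreover have "(1 / (2 * t)) * erw_ex j (\<lambda>ys. of_bool (\<exists>k\<in>{?m..<?m + j}. \<not> good h \<delta> (take k ys))) zs \<le> (1 / (2 * t)) * \<beta>"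
      using t(1) \<beta> by (intro mult_left_mono) auto
    ultimately show ?thesis using t(2) by simp
  qed
  finally have "1/2 \<le> exp (- ?C * ?A) * erw_ex j (\<lambda>ys. of_bool (?B ys) * exp (\<theta> * ?d ys)) zs" by simp
  then have "exp (?C * ?A) * (1/2) \<le> exp (?C * ?A) * (exp (- ?C * ?A) * erw_ex j (\<lambda>ys. of_bool (?B ys) * exp (\<theta> * ?d ys)) zs)"
    by (rule mult_left_mono) simp
  also have "\<dots> = (exp (?C * ?A) * exp (- ?C * ?A)) * erw_ex j (\<lambda>ys. of_bool (?B ys) * exp (\<theta> * ?d ys)) zs"
    by (simp only: mult.assoc)
  also have "exp (?C * ?A) * exp (- ?C * ?A) = 1" by (simp only: mult_exp_exp) simp
  finally show ?thesis by simp
qed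

text \<open>Plays the role of a change of measure. Inside the window from \<open>x\<close> to
  \<open>x''\<close> the factor \<open>exp (lam * z)\<close> is at most
  \<open>exp (lam * x'')\<close>; outside it, one of the two subtracted exponentials outweighs the
  main term. All three terms are exponential moments with known bounds.\<close>

lemma tilted_indicator:
  fixes z :: real
  assumes "lam \<ge> 0" "\<mu> \<ge> 0"
  shows "exp (- lam * x'') * (exp (lam * z) - exp (\<mu> * x) * exp ((lam - \<mu>) * z) - exp (- \<mu> * x'') * exp ((lam + \<mu>) * z))
    \<le> of_bool (x \<le> z)"
proof -
  have 1: "exp (\<mu> * x) * exp ((lam - \<mu>) * z) = exp (lam * z) * exp (\<mu> * (x - z))"
    and 2: "exp (- \<mu> * x'') * exp ((lam + \<mu>) * z) = exp (lam * z) * exp (\<mu> * (z - x''))"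
    by (simp_all only: mult_exp_exp) (simp_all add: algebra_simps)
  consider "z < x" | "x \<le> z" "z > x''" | "x \<le> z" "z \<le> x''" by linarith
  then show ?thesis
  proof cases
    case 1
    then have "exp (\<mu> * (x - z)) \<ge> 1" using assms by simp
    then have "exp (lam * z) * exp (\<mu> * (x - z)) \<ge> exp (lam * z) * 1" by (intro mult_left_mono) auto
    then have "exp (lam * z) - exp (\<mu> * x) * exp ((lam - \<mu>) * z) - exp (- \<mu> * x'') * exp ((lam + \<mu>) * z) \<le> 0"
      unfolding \<open>exp (\<mu> * x) * exp ((lam - \<mu>) * z) = _\<close> by (smt (verit) exp_gt_zero mult_pos_pos)
    then have "exp (- lam * x'') * (exp (lam * z) - exp (\<mu> * x) * exp ((lam - \<mu>) * z) - exp (- \<mu> * x'') * exp ((lam + \<mu>) * z)) \<le> 0"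
      by (intro mult_nonneg_nonpos) auto
    then show ?thesis using of_bool_def by (smt (verit))
  next
    case 2
    then have "exp (\<mu> * (z - x'')) \<ge> 1" using assms by simp
    then have "exp (lam * z) * exp (\<mu> * (z - x'')) \<ge> exp (lam * z) * 1" by (intro mult_left_mono) auto
    then have "exp (lam * z) - exp (\<mu> * x) * exp ((lam - \<mu>) * z) - exp (- \<mu> * x'') * exp ((lam + \<mu>) * z) \<le> 0"
      unfolding \<open>exp (- \<mu> * x'') * exp ((lam + \<mu>) * z) = _\<close> by (smt (verit) exp_gt_zero mult_pos_pos)
    then have "exp (- lam * x'') * (exp (lam * z) - exp (\<mu> * x) * exp ((lam - \<mu>) * z) - exp (- \<mu> * x'') * exp ((lam + \<mu>) * z)) \<le> 0"
      by (intro mult_nonneg_nonpos) auto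
    then show ?thesis using of_bool_def by (smt (verit))
  next
    case 3
    have "exp (- lam * x'') * (exp (lam * z) - exp (\<mu> * x) * exp ((lam - \<mu>) * z) - exp (- \<mu> * x'') * exp ((lam + \<mu>) * z))
       \<le> exp (- lam * x'') * exp (lam * z)"
      by (intro mult_left_mono) (auto intro: add_nonneg_nonneg simp: diff_le_eq)
    also have "\<dots> = exp (lam * (z - x''))" by (simp add: mult_exp_exp algebra_simps)
    also have "\<dots> \<le> 1" using 3 assms by (simp add: mult_nonneg_nonpos)
    finally show ?thesis using 3 by simp
  qed
qed

text \<open>The expectation of \<open>tilted_indicator\<close> over surviving paths. In units of
  \<open>exp ((1 - D) * g * el)\<close> the main term is at least a half and each subtracted tail at
  most an eighth, leaving a quarter. The condition on \<open>2 * lam\<close> covers every exponent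
  that occurs, up to \<open>lam + \<mu>\<close>.\<close>

lemma lil_block_lower:
  fixes h :: "real^'d \<Rightarrow> real"
  assumes h: "centered h b" and s: "s = erw_avg (\<lambda>x. (h x)\<^sup>2)" "s > 0" and zs: "zs \<in> lists erw_dirs"
    and \<xi>: "0 < \<xi>" "\<xi> \<le> 1"
    and D: "D = \<xi>\<^sup>2 / 10" and \<delta>: "\<delta> = s * (D / 4)" and \<eta>: "\<eta> = D / 16" and g: "g = 1 / (1 + 3 * \<xi>)"
    and v: "v = (\<Sum>k\<in>{length zs..<length zs + j}. (alpha k)\<^sup>2)" "v > 0"
    and el: "el \<ge> 0" "exp (- \<xi>\<^sup>2 * g * el / 2) \<le> 1/8"
    and lam: "lam = sqrt (2 * g * el / (s * v))" "2 * lam * (2 * b) \<le> \<eta>"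
    and t: "t > 0" "t / 2 * exp (24 * b\<^sup>2 * lam\<^sup>2 * v) + \<beta> / (2 * t) \<le> 1/2"
    and \<beta>: "erw_ex j (\<lambda>ys. of_bool (\<exists>k\<in>{length zs..<length zs + j}. \<not> good h \<delta> (take k ys))) zs \<le> \<beta>"
  shows "exp (- el) / 4 \<le> erw_ex j (\<lambda>ys. of_bool ((1 - \<xi>) * sqrt (2 * g * el * (s * v))
      \<le> wsum h alpha ys - wsum h alpha zs)) zs"
proof -
  let ?m = "length zs"
  let ?d = "\<lambda>ys. wsum h alpha ys - wsum h alpha zs"
  let ?B = "\<lambda>ys. \<forall>k\<in>{?m..<?m + j}. good h \<delta> (take k ys)"
  let ?E = "\<lambda>\<theta>. erw_ex j (\<lambda>ys. of_bool (?B ys) * exp (\<theta> * ?d ys)) zs"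
  have b: "b > 0" using h by (rule centered_pos)
  have g0: "g > 0" using g \<xi> by simp
  have D0: "D > 0" "D \<le> 1/10" unfolding D using \<xi> by (auto simp: power_le_one)
  have \<eta>01: "\<eta> \<le> 1/4" "0 \<le> \<eta>" "\<eta> \<le> 1" unfolding \<eta> using D0 by auto
  define y where "y = g * el"
  have y0: "y \<ge> 0" using g0 el by (simp add: y_def)
  have sv: "s * v > 0" using s v by simp
  have lam0: "lam \<ge> 0" unfolding lam using sv g0 el by simp
  have lam2: "lam\<^sup>2 * (s * v) = 2 * y"
    unfolding lam(1) y_def using s(2) v(2) g0 el(1) by simp
  have lamw: "lam * (s * v) = sqrt (2 * g * el * (s * v))"
  proof (rule real_sqrt_unique[symmetric])
    show "(lam * (s * v))\<^sup>2 = 2 * g * el * (s * v)"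
      using lam2 by (simp add: power_mult_distrib y_def power2_eq_square)
  qed (use lam0 sv in simp)
  \<comment> \<open>Under the tilt \<open>lam\<close> the increment concentrates near
    \<open>lam * (s * v)\<close>; \<open>x\<close> and \<open>x''\<close> delimit a window of
    relative half-width \<open>\<xi>\<close>. The shift \<open>\<mu> = \<xi> * lam\<close> is the
    Gaussian optimum for both tails.\<close>
  define x where "x = (1 - \<xi>) * (lam * (s * v))"
  define x'' where "x'' = (1 + \<xi>) * (lam * (s * v))"
  define \<mu> where "\<mu> = \<xi> * lam"
  have \<mu>0: "\<mu> \<ge> 0" using \<xi> lam0 by (simp add: \<mu>_def)
  have small: "\<bar>\<theta> * alpha k\<bar> * (2 * b) \<le> \<eta>" if "\<bar>\<theta>\<bar> \<le> 2 * lam" for \<theta> k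
  proof -
    have "\<bar>\<theta> * alpha k\<bar> \<le> (2 * lam) * 1"
      unfolding abs_mult using that lam0 alpha_pos[of k] alpha_le_1[of k] by (intro mult_mono) auto
    then have "\<bar>\<theta> * alpha k\<bar> * (2 * b) \<le> (2 * lam) * 1 * (2 * b)" using b by (intro mult_right_mono) auto
    then show ?thesis using lam(2) by linarith
  qed
  have upper: "?E \<theta> \<le> exp ((1 + D) * (c * c) * y)" if c: "\<theta> = c * lam" "0 \<le> c" "c \<le> 2" for \<theta> c
  proof -
    have \<theta>le: "\<bar>\<theta>\<bar> \<le> 2 * lam" using c lam0 by (simp add: abs_mult mult_right_mono)
    have "?E \<theta> \<le> exp ((1/2 + \<eta>) * \<theta>\<^sup>2 * (s + \<delta>) * (\<Sum>k\<in>{?m..<?m + j}. (alpha k)\<^sup>2))"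
      by (rule killed_mgf_upper[OF h s(1) zs small[OF \<theta>le] \<eta>01(3,2)])
    also have "\<dots> = exp (((1 + D / 8) * (1 + D / 4)) * (c * c * y))"
    proof -
      have "(1/2 + \<eta>) * \<theta>\<^sup>2 * (s + \<delta>) * v = (1/2 + \<eta>) * (1 + D / 4) * (c * c) * (lam\<^sup>2 * (s * v))"
        unfolding c \<delta> by (simp add: power2_eq_square algebra_simps)
      also have "\<dots> = ((1 + D / 8) * (1 + D / 4)) * (c * c * y)"
        unfolding lam2 \<eta> by (simp add: field_simps)
      finally show ?thesis by (simp add: v(1))
    qed
    also have "\<dots> \<le> exp ((1 + D) * (c * c * y))"
    proof (subst exp_le_cancel_iff, rule mult_right_mono)
      have "D * D \<le> D * 1" using D0 by (intro mult_left_mono) auto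
      moreover have "(1 + D / 8) * (1 + D / 4) = 1 + 3 * D / 8 + D * D / 32" by (simp add: algebra_simps)
      ultimately show "(1 + D / 8) * (1 + D / 4) \<le> 1 + D" using D0 by linarith
    qed (use y0 in simp)
    finally show ?thesis by (simp add: mult.assoc)
  qed
  have lower: "exp ((1 - D) * y) / 2 \<le> ?E lam"
  proof -
    have "\<bar>lam\<bar> \<le> 2 * lam" using lam0 by simp
    note sm = small[OF this]
    have "1/2 * exp ((1/2 - 2 * \<eta>) * lam\<^sup>2 * (s - \<delta>) * (\<Sum>k\<in>{?m..<?m + j}. (alpha k)\<^sup>2)) \<le> ?E lam"
    proof (rule killed_mgf_lower[OF h s(1) zs sm \<eta>01(1,2) _ t(1) _ \<beta>])
      show "\<delta> \<le> s" unfolding \<delta> using D0 s(2) by (simp add: mult_left_le)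
    qed (rule t(2)[unfolded v(1)])
    moreover have "(1 - D) * y \<le> (1/2 - 2 * \<eta>) * lam\<^sup>2 * (s - \<delta>) * v"
    proof -
      have "(1/2 - 2 * \<eta>) * lam\<^sup>2 * (s - \<delta>) * v = (1/2 - 2 * \<eta>) * (1 - D / 4) * (lam\<^sup>2 * (s * v))"
        unfolding \<delta> by (simp add: algebra_simps)
      also have "\<dots> = ((1 - D / 4) * (1 - D / 4)) * y" unfolding lam2 \<eta> by (simp add: field_simps)
      also have "\<dots> \<ge> (1 - D) * y"
      proof (rule mult_right_mono)
        have "(1 - D / 4) * (1 - D / 4) = 1 - D / 2 + D * D / 16" by (simp add: algebra_simps)
        moreover have "D * D \<ge> 0" by simp
        ultimately show "1 - D \<le> (1 - D / 4) * (1 - D / 4)" using D0 by linarith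
      qed (rule y0)
      finally show ?thesis .
    qed
    then have "exp ((1 - D) * y) \<le> exp ((1/2 - 2 * \<eta>) * lam\<^sup>2 * (s - \<delta>) * v)" by simp
    ultimately show ?thesis unfolding v(1)[symmetric] by linarith
  qed
  have \<mu>x: "\<mu> * x = \<xi> * (1 - \<xi>) * (2 * y)" "\<mu> * x'' = \<xi> * (1 + \<xi>) * (2 * y)" "lam * x'' = (1 + \<xi>) * (2 * y)"
    unfolding \<mu>_def x_def x''_def lam2[symmetric] by (simp_all only: power2_eq_square mult_ac)
  have quarter: "D * (c * c) \<le> 4 * D" if "0 \<le> c" "c \<le> 2" for c :: real
    using mult_mono[OF that(2) that(2)] that D0 by (simp add: mult.commute)
  have b1: "exp (\<mu> * x) * ?E (lam - \<mu>) \<le> exp ((1 - D) * y) / 8"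
  proof -
    have "?E (lam - \<mu>) \<le> exp ((1 + D) * ((1 - \<xi>) * (1 - \<xi>)) * y)"
      by (rule upper) (use \<xi> in \<open>auto simp: \<mu>_def algebra_simps\<close>)
    then have "exp (\<mu> * x) * ?E (lam - \<mu>) \<le> exp (\<mu> * x) * exp ((1 + D) * ((1 - \<xi>) * (1 - \<xi>)) * y)"
      by (rule mult_left_mono) simp
    \<comment> \<open>The Gaussian tail gains \<open>\<xi>^2 * y\<close>. Variance errors cost
      \<open>4 * D\<close> here and \<open>D\<close> in the main term, so
      \<open>D = \<xi>^2 / 10\<close> leaves \<open>\<xi>^2 * y / 2\<close>, which
      \<open>el(2)\<close> converts into the factor \<open>1/8\<close>.\<close>
    also have "\<dots> = exp ((1 - \<xi>\<^sup>2 + D * ((1 - \<xi>) * (1 - \<xi>))) * y)"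
      unfolding \<mu>x mult_exp_exp by (rule arg_cong[of _ _ exp]) (simp add: power2_eq_square algebra_simps)
    also have "\<dots> \<le> exp ((1 - \<xi>\<^sup>2 + 4 * D) * y)"
      using quarter[of "1 - \<xi>"] \<xi> y0 by (simp add: mult_right_mono)
    also have "\<dots> = exp ((1 - D) * y) * exp (- \<xi>\<^sup>2 * g * el / 2)"
      unfolding mult_exp_exp by (rule arg_cong[of _ _ exp]) (simp add: D y_def field_simps)
    also have "\<dots> \<le> exp ((1 - D) * y) * (1/8)" using el(2) by (intro mult_left_mono) auto
    finally show ?thesis by simp
  qed
  have b2: "exp (- \<mu> * x'') * ?E (lam + \<mu>) \<le> exp ((1 - D) * y) / 8"
  proof -
    have "?E (lam + \<mu>) \<le> exp ((1 + D) * ((1 + \<xi>) * (1 + \<xi>)) * y)"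
      by (rule upper) (use \<xi> in \<open>auto simp: \<mu>_def algebra_simps\<close>)
    then have "exp (- \<mu> * x'') * ?E (lam + \<mu>) \<le> exp (- \<mu> * x'') * exp ((1 + D) * ((1 + \<xi>) * (1 + \<xi>)) * y)"
      by (rule mult_left_mono) simp
    also have "\<dots> = exp ((1 - \<xi>\<^sup>2 + D * ((1 + \<xi>) * (1 + \<xi>))) * y)"
      unfolding mult_minus_left \<mu>x mult_exp_exp by (rule arg_cong[of _ _ exp]) (simp add: power2_eq_square algebra_simps)
    also have "\<dots> \<le> exp ((1 - \<xi>\<^sup>2 + 4 * D) * y)"
      using quarter[of "1 + \<xi>"] \<xi> y0 by (simp add: mult_right_mono)
    also have "\<dots> = exp ((1 - D) * y) * exp (- \<xi>\<^sup>2 * g * el / 2)"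
      unfolding mult_exp_exp by (rule arg_cong[of _ _ exp]) (simp add: D y_def field_simps)
    also have "\<dots> \<le> exp ((1 - D) * y) * (1/8)" using el(2) by (intro mult_left_mono) auto
    finally show ?thesis by simp
  qed
  have "exp (- el) / 4 \<le> exp (- lam * x'') * (exp ((1 - D) * y) / 4)"
  proof -
    \<comment> \<open>The total cost is \<open>lam * x'' = 2 * (1 + \<xi>) * y\<close> minus the
      main exponent \<open>(1 - D) * y\<close>. The value of \<open>g\<close> is chosen to keep it
      below \<open>el\<close>.\<close>
    have "(1 + 2 * \<xi> + D) * y \<le> (1 + 3 * \<xi>) * y"
    proof (rule mult_right_mono)
      have "\<xi>\<^sup>2 \<le> \<xi> * 1" unfolding power2_eq_square using \<xi> by (intro mult_left_mono) auto
      then show "1 + 2 * \<xi> + D \<le> 1 + 3 * \<xi>" unfolding D using \<xi> by simp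
    qed (rule y0)
    also have "\<dots> = el" using \<xi> by (simp add: y_def g)
    finally have "exp (- el) \<le> exp (- ((1 + 2 * \<xi> + D) * y))" by simp
    also have "\<dots> = exp (- lam * x'') * exp ((1 - D) * y)"
      unfolding mult_minus_left \<mu>x mult_exp_exp by (rule arg_cong[of _ _ exp]) (simp add: algebra_simps)
    finally show ?thesis by simp
  qed
  also have "\<dots> \<le> exp (- lam * x'') * (?E lam - exp (\<mu> * x) * ?E (lam - \<mu>) - exp (- \<mu> * x'') * ?E (lam + \<mu>))"
    using lower b1 b2 by (intro mult_left_mono) auto
  also have "\<dots> = erw_ex j (\<lambda>ys. exp (- lam * x'') * (of_bool (?B ys) * exp (lam * ?d ys)
      - exp (\<mu> * x) * (of_bool (?B ys) * exp ((lam - \<mu>) * ?d ys))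
      - exp (- \<mu> * x'') * (of_bool (?B ys) * exp ((lam + \<mu>) * ?d ys)))) zs"
    by (simp only: erw_ex_diff erw_ex_cmult)
  also have "\<dots> \<le> erw_ex j (\<lambda>ys. of_bool (x \<le> ?d ys)) zs"
  proof (rule erw_ex_mono[OF zs])
    fix ys :: "(real^'d) list"
    show "exp (- lam * x'') * (of_bool (?B ys) * exp (lam * ?d ys)
      - exp (\<mu> * x) * (of_bool (?B ys) * exp ((lam - \<mu>) * ?d ys))
      - exp (- \<mu> * x'') * (of_bool (?B ys) * exp ((lam + \<mu>) * ?d ys))) \<le> of_bool (x \<le> ?d ys)"
    proof (cases "?B ys")
      case True
      then have e: "of_bool (?B ys) = (1 :: real)" by simp
      show ?thesis unfolding e mult_1_left by (rule tilted_indicator[OF lam0 \<mu>0])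
    next
      case False
      then have e: "of_bool (?B ys) = (0 :: real)" by simp
      show ?thesis unfolding e by simp
    qed
  qed
  finally show ?thesis unfolding x_def lamw .
qed

lemma frequently_of_compose:
  assumes "frequently (\<lambda>x. P (f x)) F" "filterlim f G F"
  shows "frequently P G"
  using assms eventually_compose_filterlim[of "\<lambda>y. \<not> P y" G f F] unfolding frequently_def by blast

text \<open>Difference of the two-sided bounds for the bracket. The \<open>3\<close> collects the
  \<open>1\<close> from \<open>ln_blk_le\<close> and the \<open>2\<close> from
  \<open>alpha_sum_le\<close>.\<close>

lemma block_variance_ge:
  assumes "\<rho> > 1"
  shows "alpha_lim * (\<rho> ^ Suc k - \<rho> ^ k - 3) \<le> (\<Sum>i\<in>{blk \<rho> k..<blk \<rho> (Suc k)}. (alpha i)\<^sup>2)"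
proof -
  let ?V = "\<lambda>n. \<Sum>i<n. (alpha i)\<^sup>2"
  have "{..<blk \<rho> (Suc k)} = {..<blk \<rho> k} \<union> {blk \<rho> k..<blk \<rho> (Suc k)}"
    using monoD[OF blk_mono[OF assms], of k "Suc k"] by auto
  then have "?V (blk \<rho> (Suc k)) = ?V (blk \<rho> k) + (\<Sum>i\<in>{blk \<rho> k..<blk \<rho> (Suc k)}. (alpha i)\<^sup>2)"
    by (simp add: sum.union_disjoint ivl_disj_int)
  moreover have "?V (blk \<rho> (Suc k)) \<ge> alpha_lim * ln (real (blk \<rho> (Suc k)))" by (rule alpha_sum_ge[OF blk_pos])
  moreover have "alpha_lim * ln (real (blk \<rho> (Suc k))) \<ge> alpha_lim * \<rho> ^ Suc k"
    by (intro mult_left_mono ln_blk_ge) (simp add: less_imp_le)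
  moreover have "?V (blk \<rho> k) \<le> alpha_lim * (ln (real (blk \<rho> k)) + 2)" by (rule alpha_sum_le[OF blk_pos])
  moreover have "alpha_lim * (ln (real (blk \<rho> k)) + 2) \<le> alpha_lim * (\<rho> ^ k + 3)"
    using ln_blk_le[OF assms, of k] by (intro mult_left_mono) (auto simp: less_imp_le)
  ultimately show ?thesis by (simp only: right_diff_distrib distrib_left)
qed

text \<open>The block estimate is used with \<open>el = ln k\<close>, so the conditional
  probabilities are at least \<open>1 / (4 * k)\<close>, a divergent series.\<close>

lemma (in erw) lil_lower_blocks:
  fixes h :: "real^'d \<Rightarrow> real"
  assumes h: "centered h b" and s: "s = erw_avg (\<lambda>x. (h x)\<^sup>2)" "s > 0"
    and \<xi>: "0 < \<xi>" "\<xi> \<le> 1" and \<rho>: "\<rho> > 1"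
  shows "AE \<omega> in M. frequently (\<lambda>k. (1 - \<xi>) * sqrt (2 * (1 / (1 + 3 * \<xi>)) * ln (real k)
        * (s * (\<Sum>i\<in>{blk \<rho> k..<blk \<rho> (Suc k)}. (alpha i)\<^sup>2)))
      \<le> wsum h alpha (path (blk \<rho> (Suc k)) \<omega>) - wsum h alpha (path (blk \<rho> k) \<omega>)) sequentially"
proof -
  define D where "D = \<xi>\<^sup>2 / 10"
  define \<delta> where "\<delta> = s * (D / 4)"
  define \<eta> where "\<eta> = D / 16"
  define g where "g = 1 / (1 + 3 * \<xi>)"
  define N where "N = blk \<rho>"
  define v where "v k = (\<Sum>i\<in>{N k..<N (Suc k)}. (alpha i)\<^sup>2)" for k
  define B where "B k ys \<longleftrightarrow> (\<exists>n\<in>{N k..<N (Suc k)}. \<not> good h \<delta> (take n ys))" for k ys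
  \<comment> \<open>Badness inside a block must be rare conditionally on the start of the block. Its
    unconditional probability is at most \<open>4 / N k\<close>, so by Markov's inequality the
    threshold \<open>1 / sqrt (N k)\<close> is exceeded with probability at most
    \<open>4 / sqrt (N k)\<close>.\<close>
  define G where "G k zs \<longleftrightarrow> erw_ex (N (Suc k) - N k) (\<lambda>ys. of_bool (B k ys)) zs \<le> 1 / sqrt (real (N k))" for k zs
  define A where "A k ys \<longleftrightarrow> (1 - \<xi>) * sqrt (2 * g * ln (real k) * (s * v k))
      \<le> wsum h alpha ys - wsum h alpha (take (N k) ys)" for k ys
  have b: "b > 0" using h by (rule centered_pos)
  have g0: "g > 0" using \<xi> by (simp add: g_def)
  have D0: "D > 0" using \<xi> by (simp add: D_def)
  have \<delta>0: "\<delta> > 0" using D0 s(2) by (simp add: \<delta>_def)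
  have \<eta>0: "\<eta> > 0" using D0 by (simp add: \<eta>_def)
  have N_mono: "mono N" unfolding N_def by (rule blk_mono[OF \<rho>])
  have NS: "N k \<le> N (Suc k)" for k using N_mono by (rule monoD) simp
  have N1: "N k \<ge> 1" for k unfolding N_def by (rule blk_pos)
  have Nge: "exp (\<rho> ^ k) \<le> real (N k)" for k unfolding N_def by (rule blk_ge)
  define u where "u k = alpha_lim * (\<rho> ^ Suc k - \<rho> ^ k - 3)" for k
  have vu: "u k \<le> v k" for k unfolding u_def v_def N_def by (rule block_variance_ge[OF \<rho>])

  have "eventually (\<lambda>k. \<rho> ^ k * (\<rho> - 1) \<ge> 3 + real k) sequentially"
  proof -
    have "\<rho> - 1 > 0" using \<rho> by simp
    then show ?thesis using \<rho> by real_asymp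
  qed
  then have ev_u: "eventually (\<lambda>k. u k \<ge> alpha_lim * real k) sequentially"
  proof eventually_elim
    case (elim k)
    have "\<rho> ^ Suc k - \<rho> ^ k - 3 \<ge> real k" using elim by (simp add: algebra_simps)
    then show ?case unfolding u_def by (intro mult_left_mono) (auto simp: less_imp_le)
  qed
  have ev1: "eventually (\<lambda>k. exp (- \<xi>\<^sup>2 * g * ln (real k) / 2) \<le> 1/8) sequentially"
  proof -
    have "\<xi>\<^sup>2 * g / 2 > 0" using \<xi> g0 by simp
    then have "eventually (\<lambda>k. exp (- ((\<xi>\<^sup>2 * g / 2) * ln (real k))) \<le> 1/8) sequentially" by real_asymp
    then show ?thesis by (simp add: mult_ac)
  qed
  have ev2: "eventually (\<lambda>k. 2 * sqrt (2 * g * ln (real k) / (s * v k)) * (2 * b) \<le> \<eta>) sequentially"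
  proof -
    have "(\<lambda>k. 2 * g * ln (real k) / (s * (alpha_lim * real k))) \<longlonglongrightarrow> 0"
    proof -
      have "(\<lambda>k. (2 * g / (s * alpha_lim)) * (ln (real k) / real k)) \<longlonglongrightarrow> (2 * g / (s * alpha_lim)) * 0"
        by (intro tendsto_mult tendsto_const) real_asymp
      then show ?thesis by (simp add: mult_ac)
    qed
    then have "(\<lambda>k. 2 * sqrt (2 * g * ln (real k) / (s * (alpha_lim * real k))) * (2 * b)) \<longlonglongrightarrow> 2 * sqrt 0 * (2 * b)"
      by (intro tendsto_intros)
    then have "eventually (\<lambda>k. 2 * sqrt (2 * g * ln (real k) / (s * (alpha_lim * real k))) * (2 * b) < \<eta>) sequentially"
      using \<eta>0 by (intro order_tendstoD(2)) auto
    then show ?thesis using ev_u eventually_ge_at_top[of 1]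
    proof eventually_elim
      case (elim k)
      have le: "s * (alpha_lim * real k) \<le> s * v k" using elim(2) vu[of k] s(2) by (intro mult_left_mono) auto
      have p: "0 < s * (alpha_lim * real k)" using s(2) elim(3) by simp
      with le have p': "0 < s * v k" by linarith
      have c: "0 \<le> 2 * g * ln (real k)" using g0 elim(3) by simp
      have "2 * g * ln (real k) / (s * v k) \<le> 2 * g * ln (real k) / (s * (alpha_lim * real k))"
        by (rule divide_left_mono[OF le c mult_pos_pos[OF p' p]])
      then have "2 * sqrt (2 * g * ln (real k) / (s * v k)) * (2 * b)
          \<le> 2 * sqrt (2 * g * ln (real k) / (s * (alpha_lim * real k))) * (2 * b)"
        using b by (intro mult_right_mono mult_left_mono) auto
      then show ?case using elim(1) by linarith
    qed
  qed
  \<comment> \<open>The crude second moment \<open>exp (24 * b^2 * lam^2 * v)\<close> equals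
    \<open>k\<close> to the power \<open>C\<close>, since
    \<open>lam^2 * v = 2 * g * ln k / s\<close>.\<close>
  define C where "C = 48 * b\<^sup>2 * g / s"
  have C0: "C > 0" using b g0 s(2) by (simp add: C_def)
  have ev3: "eventually (\<lambda>k. exp (- (\<rho> ^ k / 4)) / 2 * (exp (C * ln (real k)) + 1) \<le> 1/2) sequentially"
    using \<rho> C0 by real_asymp
  obtain K0 where K0: "\<And>k. k \<ge> K0 \<Longrightarrow> k \<ge> 1"
    "\<And>k. k \<ge> K0 \<Longrightarrow> u k \<ge> alpha_lim * real k"
    "\<And>k. k \<ge> K0 \<Longrightarrow> exp (- \<xi>\<^sup>2 * g * ln (real k) / 2) \<le> 1/8"
    "\<And>k. k \<ge> K0 \<Longrightarrow> 2 * sqrt (2 * g * ln (real k) / (s * v k)) * (2 * b) \<le> \<eta>"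
    "\<And>k. k \<ge> K0 \<Longrightarrow> exp (- (\<rho> ^ k / 4)) / 2 * (exp (C * ln (real k)) + 1) \<le> 1/2"
    using eventually_conj[OF eventually_ge_at_top[of 1] eventually_conj[OF ev_u
        eventually_conj[OF ev1 eventually_conj[OF ev2 ev3]]]]
    unfolding eventually_sequentially by blast

  have cond: "1 / (4 * real k) \<le> erw_ex (N (Suc k) - N k) (\<lambda>ys. of_bool (A k ys)) zs"
    if k: "k \<ge> K0" and zs: "zs \<in> lists erw_dirs" "length zs = N k" and Gz: "G k zs" for k zs
  proof -
    let ?j = "N (Suc k) - N k"
    have lj: "N k + ?j = N (Suc k)" using NS[of k] by simp
    have vpos: "v k > 0"
    proof -
      have "alpha_lim * real k > 0" using K0(1)[OF k] by simp
      then show ?thesis using K0(2)[OF k] vu[of k] by linarith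
    qed
    define lam where "lam = sqrt (2 * g * ln (real k) / (s * v k))"
    have lnk: "ln (real k) \<ge> 0" using K0(1)[OF k] by simp
    have lam2: "24 * b\<^sup>2 * lam\<^sup>2 * v k = C * ln (real k)"
      unfolding lam_def C_def using vpos s(2) g0 lnk by simp
    \<comment> \<open>The splitting parameter is \<open>t = 1 / r\<close> with \<open>r\<close> the
      fourth root of \<open>N k\<close>. Then \<open>\<beta> / (2 * t)\<close> with
      \<open>\<beta> = 1 / sqrt (N k)\<close> is also \<open>1 / (2 * r)\<close>, so both losses are
      \<open>1 / r\<close> times at most a power of \<open>k\<close>.\<close>
    define r where "r = sqrt (sqrt (real (N k)))"
    have r0: "r > 0" using N1[of k] by (simp add: r_def)
    have r2: "r * r = sqrt (real (N k))" by (simp add: r_def)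
    have rle: "1 / r \<le> exp (- (\<rho> ^ k / 4))"
    proof -
      have "exp (\<rho> ^ k / 4) ^ 4 \<le> r ^ 4"
      proof -
        have "r ^ 4 = (r * r) * (r * r)" by (simp add: eval_nat_numeral)
        also have "\<dots> = real (N k)" unfolding r2 by simp
        finally show ?thesis using Nge[of k] by (simp add: exp_of_nat_mult[symmetric])
      qed
      then have "exp (\<rho> ^ k / 4) \<le> r" using r0 by (subst (asm) power_mono_iff) auto
      then have "1 / r \<le> 1 / exp (\<rho> ^ k / 4)" using r0 by (intro divide_left_mono) auto
      then show ?thesis by (simp add: exp_minus field_simps)
    qed
    have tb: "(1 / r) / 2 * exp (24 * b\<^sup>2 * lam\<^sup>2 * v k) + (1 / sqrt (real (N k))) / (2 * (1 / r)) \<le> 1/2"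
    proof -
      have "(1 / sqrt (real (N k))) / (2 * (1 / r)) = (1 / r) / 2" unfolding r2[symmetric] using r0 by simp
      then have "(1 / r) / 2 * exp (24 * b\<^sup>2 * lam\<^sup>2 * v k) + (1 / sqrt (real (N k))) / (2 * (1 / r))
         = (1 / r) / 2 * (exp (C * ln (real k)) + 1)" unfolding lam2 by (simp add: algebra_simps)
      also have "\<dots> \<le> exp (- (\<rho> ^ k / 4)) / 2 * (exp (C * ln (real k)) + 1)"
        using rle by (intro mult_right_mono divide_right_mono) (auto intro: add_nonneg_nonneg)
      also have "\<dots> \<le> 1/2" using K0(5)[OF k] .
      finally show ?thesis .
    qed
    have vz: "v k = (\<Sum>i\<in>{length zs..<length zs + ?j}. (alpha i)\<^sup>2)" unfolding zs(2) lj v_def ..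
    have Bz: "erw_ex ?j (\<lambda>ys. of_bool (\<exists>i\<in>{length zs..<length zs + ?j}. \<not> good h \<delta> (take i ys))) zs
        \<le> 1 / sqrt (real (N k))"
      using Gz unfolding G_def B_def zs(2) lj .
    have "exp (- ln (real k)) / 4 \<le> erw_ex ?j (\<lambda>ys. of_bool ((1 - \<xi>) * sqrt (2 * g * ln (real k) * (s * v k))
        \<le> wsum h alpha ys - wsum h alpha zs)) zs"
      by (rule lil_block_lower[OF h s zs(1) \<xi> D_def \<delta>_def \<eta>_def g_def vz vpos lnk K0(3)[OF k] lam_def
            K0(4)[OF k, folded lam_def] _ tb Bz]) (use r0 in simp)
    also have "\<dots> = erw_ex ?j (\<lambda>ys. of_bool (A k ys)) zs"
      unfolding A_def using zs by (intro erw_ex_cong) auto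
    also have "exp (- ln (real k)) / 4 = 1 / (4 * real k)"
      using K0(1)[OF k] by (simp add: exp_minus field_simps)
    finally show ?thesis .
  qed

  have AE_G: "AE \<omega> in M. eventually (\<lambda>k. G k (path (N k) \<omega>)) sequentially"
  proof -
    have "summable (\<lambda>k. 1 / (real k)\<^sup>2)"
      using inverse_power_summable[of 2, where 'a=real] by (simp add: divide_inverse)
    moreover have "eventually (\<lambda>k. erw_ex (N k) (\<lambda>zs. of_bool (\<not> G k zs)) [] \<le> 1 / (real k)\<^sup>2) sequentially"
    proof -
      obtain m0 where m0: "\<And>m l. m \<ge> m0 \<Longrightarrow>
         erw_ex l (\<lambda>ys. of_bool (\<exists>n\<in>{m..<l}. \<not> good h \<delta> (take n ys))) [] \<le> 4 / real m"
        using bad_block[OF h \<delta>0] unfolding eventually_sequentially by blast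
      have "eventually (\<lambda>k. m0 \<le> N k) sequentially"
        unfolding N_def using blk_at_top[OF \<rho>] by (simp add: filterlim_at_top)
      moreover have "eventually (\<lambda>k. 4 * exp (- (\<rho> ^ k / 2)) \<le> 1 / (real k)\<^sup>2) sequentially"
        using \<rho> by real_asymp
      ultimately show ?thesis
      proof eventually_elim
        case (elim k)
        let ?j = "N (Suc k) - N k"
        let ?r = "sqrt (real (N k))"
        have r0: "?r > 0" using N1[of k] by simp
        \<comment> \<open>Markov's inequality for the conditional probability; the tower property
          then restores the unconditional one.\<close>
        have "erw_ex (N k) (\<lambda>zs. of_bool (\<not> G k zs)) []
           \<le> erw_ex (N k) (\<lambda>zs. ?r * erw_ex ?j (\<lambda>ys. of_bool (B k ys)) zs) []"
        proof (rule erw_ex_mono)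
          fix zs :: "(real^'d) list" assume zs: "zs \<in> lists erw_dirs"
          have "0 \<le> erw_ex ?j (\<lambda>ys. of_bool (B k ys)) zs"
            using erw_ex_mono[OF zs, of ?j "\<lambda>_. 0" "\<lambda>ys. of_bool (B k ys)"] by simp
          moreover have "1 \<le> ?r * erw_ex ?j (\<lambda>ys. of_bool (B k ys)) zs" if "\<not> G k zs"
            using that r0 unfolding G_def by (simp add: field_simps)
          ultimately show "of_bool (\<not> G k zs) \<le> ?r * erw_ex ?j (\<lambda>ys. of_bool (B k ys)) zs"
            using r0 by (cases "G k zs") auto
        qed simp
        also have "\<dots> = ?r * erw_ex (N (Suc k)) (\<lambda>ys. of_bool (B k ys)) []"
          unfolding erw_ex_cmult using NS[of k] by (simp add: erw_ex_compose[symmetric])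
        also have "\<dots> \<le> ?r * (4 / real (N k))"
          unfolding B_def using m0[OF elim(1)] r0 by (intro mult_left_mono) auto
        also have "\<dots> = 4 / ?r"
        proof -
          have "r * (4 / (r * r)) = 4 / r" if "r > 0" for r :: real using that by simp
          from this[OF r0] show ?thesis by simp
        qed
        also have "\<dots> \<le> 4 / exp (\<rho> ^ k / 2)"
        proof (rule divide_left_mono)
          have "exp (\<rho> ^ k / 2) = sqrt (exp (\<rho> ^ k))"
            by (rule real_sqrt_unique[symmetric]) (simp_all add: exp_of_nat_mult[symmetric])
          then show "exp (\<rho> ^ k / 2) \<le> ?r" using Nge[of k] by simp
        qed (use r0 in auto)
        also have "\<dots> = 4 * exp (- (\<rho> ^ k / 2))" by (simp add: exp_minus field_simps)
        finally show ?case using elim(2) by linarith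
      qed
    qed
    ultimately have "AE \<omega> in M. eventually (\<lambda>k. \<not> \<not> G k (path (N k) \<omega>)) sequentially"
      by (rule path_borel_cantelli)
    then show ?thesis by simp
  qed
  have ns: "\<not> summable (\<lambda>k. if k \<ge> 1 then 1 / (4 * real k) else (0::real))"
  proof
    assume "summable (\<lambda>k. if k \<ge> 1 then 1 / (4 * real k) else (0::real))"
    then have "summable (\<lambda>k. 4 * (if k \<ge> 1 then 1 / (4 * real k) else (0::real)))" by (rule summable_mult)
    moreover have "(\<lambda>k. 4 * (if k \<ge> 1 then 1 / (4 * real k) else (0::real))) = (\<lambda>k. inverse (real k))"
      by (rule ext) (simp add: inverse_eq_divide)
    ultimately have "summable (\<lambda>k. inverse (real k))" by (simp only:)
    then show False using not_summable_harmonic[where 'a=real] by simp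
  qed
  have "AE \<omega> in M. frequently (\<lambda>k. A k (path (N (Suc k)) \<omega>)) sequentially"
  proof (rule path_conditional_borel_cantelli[OF N_mono _ _ _ ns AE_G])
    show "(if k \<ge> 1 then 1 / (4 * real k) else 0) \<le> erw_ex (N (Suc k) - N k) (\<lambda>ys. of_bool (A k ys)) zs"
      if "K0 \<le> k" "zs \<in> lists erw_dirs" "length zs = N k" "G k zs" for k zs
      using cond[OF that] K0(1)[OF that(1)] by simp
  qed auto
  then show ?thesis
    by (simp only: A_def take_path[OF NS]) (simp only: N_def g_def v_def)
qed

text \<open>With a large block ratio the last block carries almost all of the variance. The value at
  the left end is controlled by the upper law for \<open>- h\<close>, for which the generous
  constant \<open>1 + 1\<close> suffices.\<close>

lemma (in erw) lil_lower:
  fixes h :: "real^'d \<Rightarrow> real"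
  assumes h: "centered h b" and s: "s = erw_avg (\<lambda>x. (h x)\<^sup>2)" "s > 0" and \<epsilon>: "0 < \<epsilon>" "\<epsilon> \<le> 1"
  shows "AE \<omega> in M. frequently (\<lambda>n. (1 - \<epsilon>) * sqrt (2 * (s * alpha_lim) * ln (real n) * ln (ln (ln (real n))))
     \<le> wsum h alpha (path n \<omega>)) sequentially"
proof -
  \<comment> \<open>The limiting ratio for slack \<open>\<xi>\<close>: the gain of the last block,
    minus \<open>2 * \<xi>\<close> for the left end when the block ratio is
    \<open>\<rho> = 1 / \<xi>^2\<close>.\<close>
  have "((\<lambda>\<xi>::real. (1 - \<xi>) * sqrt (1 / (1 + 3 * \<xi>) * (1 - \<xi>\<^sup>2)) - 2 * \<xi>) \<longlongrightarrow> 1) (at_right 0)"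
    by real_asymp
  then have "eventually (\<lambda>\<xi>::real. (1 - \<xi>) * sqrt (1 / (1 + 3 * \<xi>) * (1 - \<xi>\<^sup>2)) - 2 * \<xi> > 1 - \<epsilon>) (at_right 0)"
    using \<epsilon> by (intro order_tendstoD(1)) auto
  moreover have "eventually (\<lambda>\<xi>::real. 0 < \<xi> \<and> \<xi> < 1) (at_right 0)"
    by (auto simp: eventually_at_right_field intro: exI[of _ 1])
  ultimately have "eventually (\<lambda>\<xi>::real. (1 - \<xi>) * sqrt (1 / (1 + 3 * \<xi>) * (1 - \<xi>\<^sup>2)) - 2 * \<xi> > 1 - \<epsilon> \<and> 0 < \<xi> \<and> \<xi> < 1) (at_right 0)"
    by (rule eventually_conj)
  then obtain \<xi> :: real where \<xi>: "(1 - \<xi>) * sqrt (1 / (1 + 3 * \<xi>) * (1 - \<xi>\<^sup>2)) - 2 * \<xi> > 1 - \<epsilon>" "0 < \<xi>" "\<xi> < 1"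
    using eventually_happens'[OF trivial_limit_at_right_real] by blast
  define \<rho> where "\<rho> = 1 / \<xi>\<^sup>2"
  have \<rho>1: "\<rho> > 1" using \<xi> by (simp add: \<rho>_def power_less_one_iff)
  define g where "g = 1 / (1 + 3 * \<xi>)"
  have g0: "g > 0" using \<xi> by (simp add: g_def)
  define q where "q = s * alpha_lim"
  have q0: "q > 0" using s(2) by (simp add: q_def)
  define LL where "LL k = ln (ln (\<rho> ^ Suc k + 1))" for k
  \<comment> \<open>\<open>T k\<close> overestimates the normalization at the right end. Relative to
    its square, \<open>r1\<close> and \<open>r2\<close> measure the variance of the block and
    \<open>ln k\<close>, while \<open>r3\<close> and \<open>r4\<close> measure the normalization at
    the left end.\<close>
  define T where "T k = sqrt (2 * q * (\<rho> ^ Suc k + 1) * LL k)" for k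
  define r1 where "r1 k = (\<rho> ^ Suc k - \<rho> ^ k - 3) / (\<rho> ^ Suc k + 1)" for k
  define r2 where "r2 k = ln (real k) / LL k" for k
  define r3 where "r3 k = (\<rho> ^ k + 1) / (\<rho> ^ Suc k + 1)" for k
  define r4 where "r4 k = ln (ln (\<rho> ^ k + 1)) / LL k" for k
  have inv: "(\<lambda>k. 1 / \<rho> ^ k) \<longlonglongrightarrow> 0" using \<rho>1 by real_asymp
  have lim1: "r1 \<longlonglongrightarrow> 1 - \<xi>\<^sup>2"
  proof -
    have "(\<lambda>k. (\<rho> - 1 - 3 * (1 / \<rho> ^ k)) / (\<rho> + 1 / \<rho> ^ k)) \<longlonglongrightarrow> (\<rho> - 1 - 3 * 0) / (\<rho> + 0)"
      using \<rho>1 by (intro tendsto_intros inv) auto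
    moreover have "(\<rho> - 1 - 3 * (1 / \<rho> ^ k)) / (\<rho> + 1 / \<rho> ^ k) = r1 k" for k
    proof -
      have "\<rho> ^ k > 0" using \<rho>1 by simp
      then have "(\<rho> - 1 - 3 * (1 / \<rho> ^ k)) / (\<rho> + 1 / \<rho> ^ k)
         = (\<rho> ^ k * (\<rho> - 1 - 3 * (1 / \<rho> ^ k))) / (\<rho> ^ k * (\<rho> + 1 / \<rho> ^ k))" by simp
      then show ?thesis using \<rho>1 by (simp add: r1_def algebra_simps)
    qed
    moreover have "(\<rho> - 1 - 3 * 0) / (\<rho> + 0) = 1 - \<xi>\<^sup>2"
      using \<xi> by (simp add: \<rho>_def field_simps)
    ultimately show ?thesis by simp
  qed
  have lim3: "r3 \<longlonglongrightarrow> \<xi>\<^sup>2"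
  proof -
    have "(\<lambda>k. (1 + 1 / \<rho> ^ k) / (\<rho> + 1 / \<rho> ^ k)) \<longlonglongrightarrow> (1 + 0) / (\<rho> + 0)"
      using \<rho>1 by (intro tendsto_intros inv) auto
    moreover have "(1 + 1 / \<rho> ^ k) / (\<rho> + 1 / \<rho> ^ k) = r3 k" for k
    proof -
      have "\<rho> ^ k > 0" using \<rho>1 by simp
      then have "(1 + 1 / \<rho> ^ k) / (\<rho> + 1 / \<rho> ^ k)
         = (\<rho> ^ k * (1 + 1 / \<rho> ^ k)) / (\<rho> ^ k * (\<rho> + 1 / \<rho> ^ k))" by simp
      then show ?thesis using \<rho>1 by (simp add: r3_def algebra_simps)
    qed
    ultimately show ?thesis by (simp add: \<rho>_def)
  qed
  have lim2: "r2 \<longlonglongrightarrow> 1" unfolding r2_def LL_def using \<rho>1 by real_asymp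
  have lim4: "r4 \<longlonglongrightarrow> 1" unfolding r4_def LL_def using \<rho>1 by real_asymp
  have "(\<lambda>k. (1 - \<xi>) * sqrt (g * (r1 k * r2 k)) - 2 * sqrt (r3 k * r4 k))
      \<longlonglongrightarrow> (1 - \<xi>) * sqrt (g * ((1 - \<xi>\<^sup>2) * 1)) - 2 * sqrt (\<xi>\<^sup>2 * 1)"
    by (intro tendsto_intros lim1 lim2 lim3 lim4)
  moreover have "(1 - \<xi>) * sqrt (g * ((1 - \<xi>\<^sup>2) * 1)) - 2 * sqrt (\<xi>\<^sup>2 * 1) > 1 - \<epsilon>"
    using \<xi> by (simp add: g_def)
  ultimately have evr: "eventually (\<lambda>k. (1 - \<xi>) * sqrt (g * (r1 k * r2 k)) - 2 * sqrt (r3 k * r4 k) > 1 - \<epsilon>) sequentially"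
    by (rule order_tendstoD(1))
  have evL: "eventually (\<lambda>k. LL k > 0) sequentially" unfolding LL_def using \<rho>1 by real_asymp
  have evk: "eventually (\<lambda>k. ln (ln (\<rho> ^ k)) \<ge> 1) sequentially" using \<rho>1 by real_asymp
  have "AE \<omega> in M. eventually (\<lambda>n. wsum (\<lambda>x. - h x) alpha (path n \<omega>)
     \<le> (1 + 1) * sqrt (2 * (s * alpha_lim) * ln (real n) * ln (ln (ln (real n))))) sequentially"
    using s by (intro lil_upper[OF centered_uminus[OF h]]) auto
  with lil_lower_blocks[OF h s \<xi>(2) less_imp_le[OF \<xi>(3)] \<rho>1] show ?thesis
  proof eventually_elim
    case (elim \<omega>)
    have "eventually (\<lambda>k. - (2 * sqrt (2 * q * ln (real (blk \<rho> k)) * ln (ln (ln (real (blk \<rho> k))))))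
        \<le> wsum h alpha (path (blk \<rho> k) \<omega>)) sequentially"
      using eventually_compose_filterlim[OF elim(2) blk_at_top[OF \<rho>1]]
      by eventually_elim (simp add: wsum_uminus q_def)
    then have ev: "eventually (\<lambda>k. - (2 * sqrt (2 * q * ln (real (blk \<rho> k)) * ln (ln (ln (real (blk \<rho> k))))))
        \<le> wsum h alpha (path (blk \<rho> k) \<omega>) \<and> (1 - \<xi>) * sqrt (g * (r1 k * r2 k)) - 2 * sqrt (r3 k * r4 k) > 1 - \<epsilon>
        \<and> LL k > 0 \<and> ln (ln (\<rho> ^ k)) \<ge> 1) sequentially"
      using evr evL evk by eventually_elim auto
    have "frequently (\<lambda>k. (1 - \<epsilon>) * sqrt (2 * q * ln (real (blk \<rho> (Suc k))) * ln (ln (ln (real (blk \<rho> (Suc k))))))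
       \<le> wsum h alpha (path (blk \<rho> (Suc k)) \<omega>)) sequentially"
    proof (rule frequently_rev_mp[OF elim(1)], rule eventually_mono[OF ev], rule impI)
      fix k
      let ?N = "blk \<rho> k" and ?N' = "blk \<rho> (Suc k)"
      assume a: "- (2 * sqrt (2 * q * ln (real ?N) * ln (ln (ln (real ?N))))) \<le> wsum h alpha (path ?N \<omega>)
        \<and> (1 - \<xi>) * sqrt (g * (r1 k * r2 k)) - 2 * sqrt (r3 k * r4 k) > 1 - \<epsilon> \<and> LL k > 0 \<and> ln (ln (\<rho> ^ k)) \<ge> 1"
      assume "(1 - \<xi>) * sqrt (2 * (1 / (1 + 3 * \<xi>)) * ln (real k) * (s * (\<Sum>i\<in>{?N..<?N'}. (alpha i)\<^sup>2)))
        \<le> wsum h alpha (path ?N' \<omega>) - wsum h alpha (path ?N \<omega>)"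
      then have blkineq: "(1 - \<xi>) * sqrt (2 * g * ln (real k) * (s * (\<Sum>i\<in>{?N..<?N'}. (alpha i)\<^sup>2)))
        \<le> wsum h alpha (path ?N' \<omega>) - wsum h alpha (path ?N \<omega>)" by (simp add: g_def)
      have P0: "\<rho> ^ Suc k + 1 > 0" using \<rho>1 by (intro add_pos_pos) auto
      have lnk: "ln (real k) \<ge> 0" by (cases "k = 0") auto
      have LL0: "LL k > 0" using a by simp
      have "(1 - \<xi>) * (sqrt (g * (r1 k * r2 k)) * T k)
          \<le> (1 - \<xi>) * sqrt (2 * g * ln (real k) * (s * (\<Sum>i\<in>{?N..<?N'}. (alpha i)\<^sup>2)))"
      proof (rule mult_left_mono)
        have "sqrt (g * (r1 k * r2 k)) * T k = sqrt (g * (r1 k * r2 k) * (2 * q * (\<rho> ^ Suc k + 1) * LL k))"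
          by (simp only: T_def real_sqrt_mult)
        also have "g * (r1 k * r2 k) * (2 * q * (\<rho> ^ Suc k + 1) * LL k)
           = 2 * g * ln (real k) * (q * ((r1 k * (\<rho> ^ Suc k + 1)))) * (LL k / LL k)"
          by (simp add: r2_def)
        also have "\<dots> = 2 * g * ln (real k) * (s * (alpha_lim * (\<rho> ^ Suc k - \<rho> ^ k - 3)))"
        proof -
          have "r1 k * (\<rho> ^ Suc k + 1) = \<rho> ^ Suc k - \<rho> ^ k - 3" using P0 by (simp add: r1_def)
          then show ?thesis using LL0 by (simp add: q_def)
        qed
        also have "sqrt \<dots> \<le> sqrt (2 * g * ln (real k) * (s * (\<Sum>i\<in>{?N..<?N'}. (alpha i)\<^sup>2)))"
          using g0 lnk s(2) block_variance_ge[OF \<rho>1, of k]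
          by (intro real_sqrt_le_mono mult_left_mono) auto
        finally show "sqrt (g * (r1 k * r2 k)) * T k \<le> sqrt (2 * g * ln (real k) * (s * (\<Sum>i\<in>{?N..<?N'}. (alpha i)\<^sup>2)))" .
      qed (use \<xi> in simp)
      moreover have "sqrt (2 * q * ln (real ?N) * ln (ln (ln (real ?N)))) \<le> sqrt (r3 k * r4 k) * T k"
      proof -
        have l1: "ln (real ?N) \<le> \<rho> ^ k + 1" by (rule ln_blk_le[OF \<rho>1])
        have l2: "\<rho> ^ k \<le> ln (real ?N)" by (rule ln_blk_ge)
        have "1 \<le> ln (ln (\<rho> ^ k))" using a by simp
        have pk: "\<rho> ^ k \<ge> 1" using \<rho>1 by simp
        have lnpk: "ln (\<rho> ^ k) \<ge> 0" using pk by simp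
        have "ln (\<rho> ^ k) > 0" using \<open>1 \<le> ln (ln (\<rho> ^ k))\<close> lnpk by (cases "ln (\<rho> ^ k) = 0") auto
        have i1: "ln (ln (real ?N)) \<le> ln (\<rho> ^ k + 1)" "ln (\<rho> ^ k) \<le> ln (ln (real ?N))"
          using l1 l2 pk by (simp_all add: ln_le_cancel_iff)
        have i2: "ln (ln (ln (real ?N))) \<le> ln (ln (\<rho> ^ k + 1))" "ln (ln (\<rho> ^ k)) \<le> ln (ln (ln (real ?N)))"
          using i1 \<open>ln (\<rho> ^ k) > 0\<close> by (simp_all add: ln_le_cancel_iff)
        have "2 * q * ln (real ?N) * ln (ln (ln (real ?N))) \<le> 2 * q * (\<rho> ^ k + 1) * ln (ln (\<rho> ^ k + 1))"
          using l1 l2 pk i2 \<open>1 \<le> ln (ln (\<rho> ^ k))\<close> q0 by (intro mult_mono) auto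
        also have "\<dots> = (r3 k * r4 k) * (2 * q * (\<rho> ^ Suc k + 1) * LL k)"
        proof -
          have "r3 k * (\<rho> ^ Suc k + 1) = \<rho> ^ k + 1" using P0 by (simp add: r3_def)
          moreover have "r4 k * LL k = ln (ln (\<rho> ^ k + 1))" using LL0 by (simp add: r4_def)
          ultimately show ?thesis by (metis mult.assoc mult.commute)
        qed
        finally have "sqrt (2 * q * ln (real ?N) * ln (ln (ln (real ?N)))) \<le> sqrt ((r3 k * r4 k) * (2 * q * (\<rho> ^ Suc k + 1) * LL k))"
          by (rule real_sqrt_le_mono)
        then show ?thesis by (simp only: T_def real_sqrt_mult)
      qed
      moreover have "(1 - \<epsilon>) * sqrt (2 * q * ln (real ?N') * ln (ln (ln (real ?N')))) \<le> (1 - \<epsilon>) * T k"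
      proof (rule mult_left_mono)
        have l1: "ln (real ?N') \<le> \<rho> ^ Suc k + 1" by (rule ln_blk_le[OF \<rho>1])
        have l2: "\<rho> ^ Suc k \<le> ln (real ?N')" by (rule ln_blk_ge)
        have pk: "\<rho> ^ Suc k > 1" using \<rho>1 by (intro one_less_power) auto
        have i1: "ln (ln (real ?N')) \<le> ln (\<rho> ^ Suc k + 1)" using l1 l2 pk by (subst ln_le_cancel_iff) auto
        have i0: "ln (ln (real ?N')) > 0" using l2 pk by simp
        have i2: "ln (ln (ln (real ?N'))) \<le> LL k" unfolding LL_def using i1 i0 by (subst ln_le_cancel_iff) auto
        have "ln (real ?N') * ln (ln (ln (real ?N'))) \<le> ln (real ?N') * LL k"
          using i2 l2 pk by (intro mult_left_mono) auto
        also have "\<dots> \<le> (\<rho> ^ Suc k + 1) * LL k" using l1 LL0 by (intro mult_right_mono) auto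
        finally have "2 * q * (ln (real ?N') * ln (ln (ln (real ?N')))) \<le> 2 * q * ((\<rho> ^ Suc k + 1) * LL k)"
          using q0 by (intro mult_left_mono) auto
        then show "sqrt (2 * q * ln (real ?N') * ln (ln (ln (real ?N')))) \<le> T k"
          unfolding T_def by (intro real_sqrt_le_mono) (simp only: mult.assoc)
      qed (use \<epsilon> in simp)
      moreover have "(1 - \<epsilon>) * T k \<le> ((1 - \<xi>) * sqrt (g * (r1 k * r2 k)) - 2 * sqrt (r3 k * r4 k)) * T k"
      proof (rule mult_right_mono)
        show "0 \<le> T k" unfolding T_def using q0 P0 LL0 by simp
      qed (use a in simp)
      moreover have "((1 - \<xi>) * sqrt (g * (r1 k * r2 k)) - 2 * sqrt (r3 k * r4 k)) * T k
         = (1 - \<xi>) * (sqrt (g * (r1 k * r2 k)) * T k) - 2 * (sqrt (r3 k * r4 k) * T k)"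
        by (simp add: algebra_simps)
      ultimately show "(1 - \<epsilon>) * sqrt (2 * q * ln (real ?N') * ln (ln (ln (real ?N')))) \<le> wsum h alpha (path ?N' \<omega>)"
        using a blkineq by linarith
    qed
    moreover have "filterlim (\<lambda>k. blk \<rho> (Suc k)) at_top sequentially"
      using blk_at_top[OF \<rho>1] by (simp add: filterlim_sequentially_Suc)
    ultimately show ?case
      unfolding q_def by (rule frequently_of_compose)
  qed
qed

section \<open>The center of mass\<close>

definition gsum :: "(real^'d \<Rightarrow> real) \<Rightarrow> (real^'d) list \<Rightarrow> real" where
  "gsum h ys = (\<Sum>k\<in>{1..length ys}. hsum h (take k ys))"

lemma gsum_snoc: "gsum h (ys @ [x]) = gsum h ys + hsum h (ys @ [x])"
proof -
  have "gsum h (ys @ [x]) = (\<Sum>k\<in>{1..length ys}. hsum h (take k (ys @ [x]))) + hsum h (take (Suc (length ys)) (ys @ [x]))"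
    unfolding gsum_def by simp
  also have "(\<Sum>k\<in>{1..length ys}. hsum h (take k (ys @ [x]))) = gsum h ys"
    unfolding gsum_def by (intro sum.cong) auto
  finally show ?thesis by simp
qed

text \<open>The center of mass is two thirds of the position up to a martingale with linear weights,
  which is of smaller order.\<close>

lemma gsum_eq:
  "gsum h ys = 2/3 * (real (length ys) * hsum h ys) - 2/3 * wsum h real ys + hsum h ys / 3"
proof (induction ys rule: rev_induct)
  case (snoc x ys)
  define n where "n = real (length ys)"
  define H where "H = hsum h ys"
  have "n * (H / (2 * n)) = H / 2" if "n \<noteq> 0" using that by simp
  moreover have "H = 0" if "n = 0" using that by (simp add: n_def H_def)
  ultimately have e: "n * (H / (2 * n)) = H / 2" by (cases "n = 0") auto
  have "wsum h real (ys @ [x]) = wsum h real ys + (n * h x - n * (H / (2 * n)))"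
    by (simp add: mdiff_def n_def H_def right_diff_distrib)
  then have w: "wsum h real (ys @ [x]) = wsum h real ys + (n * h x - H / 2)" unfolding e .
  show ?case unfolding gsum_snoc w snoc.IH
    by (simp add: n_def[symmetric] H_def[symmetric] field_simps)
qed (simp add: gsum_def)

lemma sum_squares_le_cube: "(\<Sum>k<n. (real k)\<^sup>2) \<le> real n ^ 3"
proof -
  have "(\<Sum>k<n. (real k)\<^sup>2) \<le> (\<Sum>k<n. (real n)\<^sup>2)" by (intro sum_mono power_mono) auto
  then show ?thesis by (simp add: power3_eq_cube power2_eq_square)
qed

lemma gsum_diff_eq:
  assumes "ys \<noteq> []"
  shows "gsum h ys / real (length ys) - 2/3 * hsum h ys
    = (hsum h ys / 3 - 2/3 * wsum h real ys) / real (length ys)"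
  using assms unfolding gsum_eq by (simp add: field_simps)

text \<open>Weights \<open>k\<close> give a bracket of order \<open>n^3\<close>, so after division
  by \<open>n\<close> the martingale is of order \<open>sqrt n\<close>. The extra
  \<open>sqrt (ln n)\<close> makes the exceptions summable and is still negligible against the
  iterated-logarithm scale.\<close>

lemma (in erw) AE_gsum_diff:
  fixes h :: "real^'d \<Rightarrow> real"
  assumes h: "centered h b"
  shows "AE \<omega> in M. eventually (\<lambda>n. \<bar>gsum h (path n \<omega>) / real n - 2/3 * hsum h (path n \<omega>)\<bar>
     \<le> (6 * b\<^sup>2 + b + 2) * sqrt (real n * ln (real n))) sequentially"
proof -
  have b: "b > 0" using h by (rule centered_pos)
  \<comment> \<open>With \<open>\<theta> = sqrt (ln n / n^3)\<close> the exponent is at most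
    \<open>(6 * b^2 - C) * ln n\<close>, and this \<open>C\<close> leaves exactly
    \<open>2 / n^2\<close>.\<close>
  define C where "C = 6 * b\<^sup>2 + 2"
  have ev: "eventually (\<lambda>n. sqrt (ln (real n)) / sqrt (real n) * (2 * b) \<le> 1) sequentially"
    using b by real_asymp
  have "eventually (\<lambda>n. erw_ex n (\<lambda>ys. of_bool (C * real n * sqrt (real n * ln (real n)) \<le> \<bar>wsum h real ys\<bar>)) []
      \<le> 2 / (real n)\<^sup>2) sequentially"
    using ev eventually_ge_at_top[of 1]
  proof eventually_elim
    case (elim n)
    let ?n = "real n"
    have n: "?n > 0" and l: "ln ?n \<ge> 0" using elim(2) by auto
    define \<theta> where "\<theta> = sqrt (ln ?n) / (?n * sqrt ?n)"
    have \<theta>0: "\<theta> \<ge> 0" using n l by (simp add: \<theta>_def)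
    have "erw_ex n (\<lambda>ys. of_bool (C * ?n * sqrt (?n * ln ?n) \<le> \<bar>wsum h real ys\<bar>)) []
       \<le> 2 * exp (6 * b\<^sup>2 * \<theta>\<^sup>2 * (\<Sum>k<n. (real k)\<^sup>2) - \<theta> * (C * ?n * sqrt (?n * ln ?n)))"
    proof (rule erw_wsum_tail[OF h \<theta>0])
      fix k assume "k < n"
      then have "\<bar>\<theta> * real k\<bar> * (2 * b) \<le> (\<theta> * ?n) * (2 * b)"
        using \<theta>0 b by (intro mult_right_mono) (auto simp: abs_mult mult_left_mono)
      also have "\<theta> * ?n = sqrt (ln ?n) / sqrt ?n" using n by (simp add: \<theta>_def)
      also have "sqrt (ln ?n) / sqrt ?n * (2 * b) \<le> 1" by (rule elim(1))
      finally show "\<bar>\<theta> * real k\<bar> * (2 * b) \<le> 1" .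
    qed
    also have "\<dots> \<le> 2 * exp (6 * b\<^sup>2 * ln ?n - C * ln ?n)"
    proof -
      have "6 * b\<^sup>2 * \<theta>\<^sup>2 * (\<Sum>k<n. (real k)\<^sup>2) \<le> 6 * b\<^sup>2 * \<theta>\<^sup>2 * ?n ^ 3"
        by (intro mult_left_mono sum_squares_le_cube) auto
      also have "\<theta>\<^sup>2 * ?n ^ 3 = ln ?n"
        using n l by (simp add: \<theta>_def power_divide power_mult_distrib power3_eq_cube power2_eq_square)
      then have "6 * b\<^sup>2 * \<theta>\<^sup>2 * ?n ^ 3 = 6 * b\<^sup>2 * ln ?n" by (simp only: mult.assoc)
      finally have 1: "6 * b\<^sup>2 * \<theta>\<^sup>2 * (\<Sum>k<n. (real k)\<^sup>2) \<le> 6 * b\<^sup>2 * ln ?n" .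
      have "\<theta> * (C * ?n * sqrt (?n * ln ?n)) = C * (sqrt (ln ?n) * sqrt (ln ?n)) * ((?n * sqrt ?n) / (?n * sqrt ?n))"
        by (simp add: \<theta>_def real_sqrt_mult del: real_sqrt_mult_self)
      also have "\<dots> = C * ln ?n" using n l by simp
      finally have "6 * b\<^sup>2 * \<theta>\<^sup>2 * (\<Sum>k<n. (real k)\<^sup>2) - \<theta> * (C * ?n * sqrt (?n * ln ?n)) \<le> 6 * b\<^sup>2 * ln ?n - C * ln ?n"
        using 1 by linarith
      then have "exp (6 * b\<^sup>2 * \<theta>\<^sup>2 * (\<Sum>k<n. (real k)\<^sup>2) - \<theta> * (C * ?n * sqrt (?n * ln ?n))) \<le> exp (6 * b\<^sup>2 * ln ?n - C * ln ?n)"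
        by (simp only: exp_le_cancel_iff)
      then show ?thesis by (rule mult_left_mono) simp
    qed
    also have "\<dots> = 2 / (real n)\<^sup>2"
    proof -
      have "6 * b\<^sup>2 * ln ?n - C * ln ?n = - (2 * ln ?n)" by (simp add: C_def algebra_simps)
      moreover have "exp (2 * ln ?n) = ?n\<^sup>2" by (simp only: mult_2 exp_add power2_eq_square exp_ln[OF n])
      ultimately show ?thesis by (simp only: exp_minus divide_inverse)
    qed
    finally show ?case .
  qed
  moreover have "summable (\<lambda>n. 2 / (real n)\<^sup>2)"
    using summable_mult[OF inverse_power_summable[of 2, where 'a=real], of 2] by (simp add: divide_inverse)
  ultimately have "AE \<omega> in M. eventually (\<lambda>n. \<not> C * real n * sqrt (real n * ln (real n)) \<le> \<bar>wsum h real (path n \<omega>)\<bar>) sequentially"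
    by (intro path_borel_cantelli)
  then show ?thesis
  proof eventually_elim
    case (elim \<omega>)
    have "eventually (\<lambda>n::nat. real n * ln (real n) \<ge> 1) sequentially" by real_asymp
    with elim eventually_ge_at_top[of 1] show ?case
    proof eventually_elim
      case (elim n)
      let ?n = "real n" and ?ys = "path n \<omega>"
      have n: "?n > 0" and ne: "?ys \<noteq> []" using elim(2) length_path[of n \<omega>] by (auto simp del: length_path)
      have hb: "\<bar>hsum h ?ys\<bar> \<le> b * ?n" using hsum_bound[OF h path_in_lists, of n \<omega>] by simp
      have w: "\<bar>wsum h real ?ys\<bar> \<le> C * ?n * sqrt (?n * ln ?n)" using elim(1) by simp
      have "\<bar>gsum h ?ys / ?n - 2/3 * hsum h ?ys\<bar> = \<bar>hsum h ?ys / 3 - 2/3 * wsum h real ?ys\<bar> / ?n"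
        using gsum_diff_eq[OF ne, of h] by (simp add: abs_divide)
      also have "\<dots> \<le> (b * ?n * sqrt (?n * ln ?n) + C * ?n * sqrt (?n * ln ?n)) / ?n"
      proof (rule divide_right_mono)
        have "1 \<le> sqrt (?n * ln ?n)" using elim(3) by simp
        then have "b * ?n * 1 \<le> b * ?n * sqrt (?n * ln ?n)" using b n by (intro mult_left_mono) auto
        then show "\<bar>hsum h ?ys / 3 - 2/3 * wsum h real ?ys\<bar> \<le> b * ?n * sqrt (?n * ln ?n) + C * ?n * sqrt (?n * ln ?n)"
          using hb w by linarith
      qed (use n in simp)
      also have "\<dots> = (b + C) * sqrt (?n * ln ?n)" using n by (simp add: field_simps)
      finally show ?case by (simp add: C_def algebra_simps)
    qed
  qed
qed

text \<open>The pathwise bound is too weak for the quadratic law: a square of order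
  \<open>k * ln k\<close> would leave weights \<open>1 / (k * ln k)\<close>, whose sum is as large
  as the normalization. In the mean the square is of order \<open>k\<close>, which leaves the
  summable weights \<open>lw\<close>.\<close>

lemma gsum_diff_second_moment:
  fixes h :: "real^'d \<Rightarrow> real"
  assumes h: "centered h b"
  shows "erw_ex n (\<lambda>ys. (gsum h ys / real n - 2/3 * hsum h ys)\<^sup>2) [] \<le> 5 * b\<^sup>2 * real n"
proof (cases "n = 0")
  case False
  then have n: "real n \<ge> 1" by simp
  have W: "erw_ex n (\<lambda>ys. (wsum h real ys)\<^sup>2) [] \<le> 4 * b\<^sup>2 * real n ^ 3"
  proof -
    have "erw_ex n (\<lambda>ys. (wsum h real ys)\<^sup>2) []
       = (\<Sum>k<n. erw_ex k (\<lambda>xs. erw_next xs (\<lambda>x. (real (length xs) * mdiff h xs x)\<^sup>2)) [])"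
      unfolding wsum_def
      by (rule erw_ex_msum_square) (simp add: erw_next_cmult erw_next_mdiff[OF h])
    also have "\<dots> \<le> (\<Sum>k<n. 4 * b\<^sup>2 * (real k)\<^sup>2)"
    proof (rule sum_mono)
      fix k
      have "erw_ex k (\<lambda>xs. erw_next xs (\<lambda>x. (real (length xs) * mdiff h xs x)\<^sup>2)) [] \<le> erw_ex k (\<lambda>xs :: (real^'d) list. 4 * b\<^sup>2 * (real k)\<^sup>2) []"
      proof (rule erw_ex_mono)
        fix xs :: "(real^'d) list" assume xs: "xs \<in> lists erw_dirs" "length xs = length ([] :: (real^'d) list) + k"
        have "erw_next xs (\<lambda>x. (real (length xs) * mdiff h xs x)\<^sup>2) = (real k)\<^sup>2 * cvar h xs"
          using xs(2) by (simp add: power_mult_distrib erw_next_cmult cvar_def)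
        also have "\<dots> \<le> (real k)\<^sup>2 * (4 * b\<^sup>2)" using cvar_le[OF h xs(1)] by (intro mult_left_mono) auto
        finally show "erw_next xs (\<lambda>x. (real (length xs) * mdiff h xs x)\<^sup>2) \<le> 4 * b\<^sup>2 * (real k)\<^sup>2" by (simp only: mult_ac)
      qed simp
      then show "erw_ex k (\<lambda>xs. erw_next xs (\<lambda>x. (real (length xs) * mdiff h xs x)\<^sup>2)) [] \<le> 4 * b\<^sup>2 * (real k)\<^sup>2" by simp
    qed
    also have "\<dots> = 4 * b\<^sup>2 * (\<Sum>k<n. (real k)\<^sup>2)" by (simp add: sum_distrib_left)
    also have "\<dots> \<le> 4 * b\<^sup>2 * real n ^ 3" by (intro mult_left_mono sum_squares_le_cube) auto
    finally show ?thesis .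
  qed
  have "erw_ex n (\<lambda>ys. (gsum h ys / real n - 2/3 * hsum h ys)\<^sup>2) []
     \<le> erw_ex n (\<lambda>ys. b\<^sup>2 + (1 / (real n)\<^sup>2) * (wsum h real ys)\<^sup>2) []"
  proof (rule erw_ex_mono)
    fix ys :: "(real^'d) list" assume ys: "ys \<in> lists erw_dirs" "length ys = length ([] :: (real^'d) list) + n"
    then have ne: "ys \<noteq> []" and ly: "length ys = n" using False by auto
    let ?H = "hsum h ys" and ?W = "wsum h real ys"
    have H: "?H\<^sup>2 \<le> (b * real n)\<^sup>2"
      using power_mono[OF hsum_bound[OF h ys(1)], of 2] by (simp add: ly)
    have "(gsum h ys / real n - 2/3 * ?H)\<^sup>2 = (?H / 3 - 2/3 * ?W)\<^sup>2 / (real n)\<^sup>2"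
      using gsum_diff_eq[OF ne, of h] by (simp add: ly power_divide)
    also have "\<dots> \<le> ((b * real n)\<^sup>2 + ?W\<^sup>2) / (real n)\<^sup>2"
    proof (rule divide_right_mono)
      \<comment> \<open>Adding the square with the opposite sign removes the cross term.\<close>
      have "(?H / 3 - 2/3 * ?W)\<^sup>2 + (?H / 3 + 2/3 * ?W)\<^sup>2 = 2/9 * ?H\<^sup>2 + 8/9 * ?W\<^sup>2"
        by (simp add: power2_eq_square algebra_simps)
      moreover have "(?H / 3 + 2/3 * ?W)\<^sup>2 \<ge> 0" "?H\<^sup>2 \<ge> 0" "?W\<^sup>2 \<ge> 0" by auto
      ultimately show "(?H / 3 - 2/3 * ?W)\<^sup>2 \<le> (b * real n)\<^sup>2 + ?W\<^sup>2" using H by linarith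
    qed simp
    also have "\<dots> = b\<^sup>2 + (1 / (real n)\<^sup>2) * ?W\<^sup>2" using n by (simp add: field_simps power_mult_distrib)
    finally show "(gsum h ys / real n - 2/3 * ?H)\<^sup>2 \<le> b\<^sup>2 + (1 / (real n)\<^sup>2) * ?W\<^sup>2" .
  qed simp
  also have "\<dots> = b\<^sup>2 + (1 / (real n)\<^sup>2) * erw_ex n (\<lambda>ys. (wsum h real ys)\<^sup>2) []"
    by (simp only: erw_ex_add erw_ex_cmult erw_ex_const)
  also have "\<dots> \<le> b\<^sup>2 + (1 / (real n)\<^sup>2) * (4 * b\<^sup>2 * real n ^ 3)"
    using W by (intro add_left_mono mult_left_mono) auto
  also have "\<dots> = b\<^sup>2 + 4 * b\<^sup>2 * real n" using n by (simp add: power3_eq_cube power2_eq_square)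
  also have "\<dots> \<le> 5 * b\<^sup>2 * real n" using mult_left_mono[OF n, of "b\<^sup>2"] by (simp add: mult.commute)
  finally show ?thesis .
qed (simp add: gsum_def)

text \<open>This is \<open>k\<close> times the weight \<open>1 / (k * ln k)^2\<close> of the
  quadratic law, matching a squared position of order \<open>k\<close>. Division by zero makes
  \<open>lw 0\<close> and \<open>lw 1\<close> vanish, so sums may start below
  \<open>2\<close>.\<close>

definition lw :: "nat \<Rightarrow> real" where
  "lw k = 1 / (real k * (ln (real k))\<^sup>2)"

lemma lw_nonneg: "lw k \<ge> 0"
  by (simp add: lw_def)

lemma lw_0_1 [simp]: "lw 0 = 0" "lw (Suc 0) = 0"
  by (simp_all add: lw_def)

text \<open>Comparison with the increment of \<open>- 1 / ln\<close>. The \<open>4\<close> consists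
  of two factors \<open>2\<close>, from \<open>1 / (2 * k) \<le> ln (1 + 1 / k)\<close> and from
  \<open>ln (k + 1) \<le> 2 * ln k\<close>.\<close>

lemma lw_le:
  assumes "k \<ge> 2"
  shows "lw k \<le> 4 * (1 / ln (real k) - 1 / ln (real (Suc k)))"
proof -
  let ?k = "real k"
  have k: "?k \<ge> 2" using assms by simp
  have l: "ln ?k > 0" "ln (?k + 1) > 0" using k by auto
  have "1 / (2 * ?k) \<le> ln (1 + 1 / ?k)"
  proof -
    have "1 / ?k - (1 / ?k)\<^sup>2 \<le> ln (1 + 1 / ?k)" using k by (intro ln_one_plus_pos_lower_bound) auto
    moreover have "(1 / ?k)\<^sup>2 \<le> 1 / (2 * ?k)" using k by (simp add: power2_eq_square field_simps)
    moreover have "1 / ?k = 1 / (2 * ?k) + 1 / (2 * ?k)" by simp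
    ultimately show ?thesis by linarith
  qed
  also have "1 + 1 / ?k = (?k + 1) / ?k" using k by (simp add: field_simps)
  also have "ln ((?k + 1) / ?k) = ln (?k + 1) - ln ?k" using k by (simp add: ln_div)
  finally have d: "1 / (2 * ?k) \<le> ln (?k + 1) - ln ?k" .
  have dbl: "ln (?k + 1) \<le> 2 * ln ?k"
  proof -
    have "?k * 2 \<le> ?k * ?k" using k by (intro mult_left_mono) auto
    then have "?k + 1 \<le> ?k\<^sup>2" using k unfolding power2_eq_square by linarith
    then have "ln (?k + 1) \<le> ln (?k\<^sup>2)" using k by (subst ln_le_cancel_iff) auto
    then show ?thesis using k by (simp add: ln_realpow)
  qed
  have "lw k = 4 * ((1 / (2 * ?k)) / (ln ?k * (2 * ln ?k)))"
    by (simp add: lw_def power2_eq_square)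
  also have "\<dots> \<le> 4 * ((ln (?k + 1) - ln ?k) / (ln ?k * ln (?k + 1)))"
  proof (rule mult_left_mono)
    show "(1 / (2 * ?k)) / (ln ?k * (2 * ln ?k)) \<le> (ln (?k + 1) - ln ?k) / (ln ?k * ln (?k + 1))"
      using d dbl l k by (intro frac_le) (auto simp: mult_left_mono)
  qed simp
  also have "(ln (?k + 1) - ln ?k) / (ln ?k * ln (?k + 1)) = 1 / ln ?k - 1 / ln (?k + 1)"
    using l by (simp add: field_simps)
  finally show ?thesis by (simp add: add.commute)
qed

lemma lw_tail:
  assumes "m \<ge> 2"
  shows "(\<Sum>k\<in>{m..<n}. lw k) \<le> 4 / ln (real m)"
proof (cases "m \<le> n")
  case True
  have "(\<Sum>k\<in>{m..<n}. lw k) \<le> (\<Sum>k\<in>{m..<n}. 4 / ln (real k) - 4 / ln (real (Suc k)))"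
    using assms lw_le by (intro sum_mono) (auto simp: algebra_simps)
  also have "\<dots> = 4 / ln (real m) - 4 / ln (real n)"
    using sum_Suc_diff'[OF True, of "\<lambda>k. - (4 / ln (real k))"] by (simp add: algebra_simps)
  also have "\<dots> \<le> 4 / ln (real m)" using True assms by simp
  finally show ?thesis .
qed (use assms in simp)

lemma lw_sum_le: "(\<Sum>k\<in>{..<n}. lw k) \<le> 4 / ln 2"
proof -
  have "(\<Sum>k\<in>{..<n}. lw k) \<le> (\<Sum>k\<in>{0, 1} \<union> {2..<n}. lw k)"
    by (intro sum_mono2) (auto simp: lw_nonneg)
  also have "\<dots> = (\<Sum>k\<in>{2..<n}. lw k)" by (subst sum.union_disjoint) auto
  also have "\<dots> \<le> 4 / ln (real 2)" by (rule lw_tail) simp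
  finally show ?thesis by simp
qed

lemma summable_lw: "summable lw"
  by (rule bounded_imp_summable[of _ "4 / ln 2"])
     (simp_all only: lw_nonneg lessThan_Suc_atMost[symmetric] lw_sum_le)

text \<open>A nonnegative series with finite expectation is finite almost surely.\<close>

lemma (in erw) AE_summable_path:
  assumes f: "\<And>k xs. f k xs \<ge> 0" and g: "summable g" "\<And>k. erw_ex k (f k) [] \<le> g k"
  shows "AE \<omega> in M. summable (\<lambda>k. f k (path k \<omega>))"
proof -
  have meas: "(\<lambda>\<omega>. ennreal (f k (path k \<omega>))) \<in> borel_measurable M" for k
    using borel_measurable_integrable[OF integrable_path[of "f k" k]] by simp
  have "(\<integral>\<^sup>+ \<omega>. (\<Sum>k. ennreal (f k (path k \<omega>))) \<partial>M) = (\<Sum>k. \<integral>\<^sup>+ \<omega>. ennreal (f k (path k \<omega>)) \<partial>M)"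
    by (rule nn_integral_suminf[OF meas])
  also have "\<dots> = (\<Sum>k. ennreal (erw_ex k (f k) []))"
    by (intro suminf_cong) (simp add: nn_integral_eq_integral[OF integrable_path] f expectation_path)
  also have "\<dots> \<le> (\<Sum>k. ennreal (g k))"
    by (intro suminf_le ennreal_leI g) auto
  also have "\<dots> < \<infinity>"
  proof -
    have "g k \<ge> 0" for k
      using g(2)[of k] erw_ex_mono[of "[] :: (real^'d) list" k "\<lambda>_. 0" "f k"] f by simp
    then show ?thesis using g(1) by (simp add: suminf_ennreal2)
  qed
  finally have "(\<integral>\<^sup>+ \<omega>. (\<Sum>k. ennreal (f k (path k \<omega>))) \<partial>M) \<noteq> \<infinity>" by simp
  then have "AE \<omega> in M. (\<Sum>k. ennreal (f k (path k \<omega>))) \<noteq> \<infinity>"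
    using meas by (intro nn_integral_PInf_AE borel_measurable_suminf) auto
  then show ?thesis
    by eventually_elim (auto intro!: summable_suminf_not_top f)
qed

lemma (in erw) AE_summable_gsum_diff:
  fixes h :: "real^'d \<Rightarrow> real"
  assumes h: "centered h b"
  shows "AE \<omega> in M. summable (\<lambda>k. (gsum h (path k \<omega>) / real k - 2/3 * hsum h (path k \<omega>))\<^sup>2 / (real k * ln (real k))\<^sup>2)"
proof (rule AE_summable_path[where f="\<lambda>k ys. (gsum h ys / real k - 2/3 * hsum h ys)\<^sup>2 / (real k * ln (real k))\<^sup>2"])
  show "summable (\<lambda>k. 5 * b\<^sup>2 * lw k)" by (intro summable_mult summable_lw)
  fix k
  have "erw_ex k (\<lambda>ys. (gsum h ys / real k - 2/3 * hsum h ys)\<^sup>2 / (real k * ln (real k))\<^sup>2) []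
      = (1 / (real k * ln (real k))\<^sup>2) * erw_ex k (\<lambda>ys. (gsum h ys / real k - 2/3 * hsum h ys)\<^sup>2) []"
    unfolding erw_ex_cmult[symmetric] by simp
  also have "\<dots> \<le> (1 / (real k * ln (real k))\<^sup>2) * (5 * b\<^sup>2 * real k)"
    by (intro mult_left_mono gsum_diff_second_moment[OF h]) auto
  also have "\<dots> = 5 * b\<^sup>2 * lw k" by (simp add: lw_def power2_eq_square)
  finally show "erw_ex k (\<lambda>ys. (gsum h ys / real k - 2/3 * hsum h ys)\<^sup>2 / (real k * ln (real k))\<^sup>2) [] \<le> 5 * b\<^sup>2 * lw k" .
qed simp

section \<open>Quadratic strong law\<close>

lemma lnln_step:
  fixes k :: nat
  assumes "k \<ge> 2"
  shows "1 / (real (Suc k) * ln (real (Suc k))) \<le> ln (ln (real (Suc k))) - ln (ln (real k))"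
    and "ln (ln (real (Suc k))) - ln (ln (real k)) \<le> 1 / (real k * ln (real k))"
proof -
  let ?k = "real k" and ?k' = "real k + 1"
  have k: "?k \<ge> 2" using assms by simp
  have l: "ln ?k > 0" "ln ?k' > 0" using k by auto
  have "ln ?k' - ln ?k = ln (?k' / ?k)" using k by (simp add: ln_div)
  also have "\<dots> \<le> ?k' / ?k - 1" using k by (intro ln_le_minus_one) auto
  also have "\<dots> = 1 / ?k" using k by (simp add: field_simps)
  finally have u: "ln ?k' - ln ?k \<le> 1 / ?k" .
  have "ln ?k - ln ?k' = ln (?k / ?k')" using k by (simp add: ln_div)
  also have "\<dots> \<le> ?k / ?k' - 1" using k by (intro ln_le_minus_one) auto
  also have "\<dots> = - (1 / ?k')" using k by (simp add: field_simps)
  finally have d: "1 / ?k' \<le> ln ?k' - ln ?k" by simp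
  have "ln (ln ?k') - ln (ln ?k) = ln (ln ?k' / ln ?k)" using l by (simp add: ln_div)
  also have "\<dots> \<le> ln ?k' / ln ?k - 1" using l by (intro ln_le_minus_one) auto
  also have "\<dots> = (ln ?k' - ln ?k) / ln ?k" using l by (simp add: diff_divide_distrib)
  also have "\<dots> \<le> (1 / ?k) / ln ?k" using u l by (intro divide_right_mono) auto
  finally show "ln (ln (real (Suc k))) - ln (ln ?k) \<le> 1 / (?k * ln ?k)" by (simp add: add.commute)
  have "(1 / ?k') / ln ?k' \<le> (ln ?k' - ln ?k) / ln ?k'" using d l by (intro divide_right_mono) auto
  also have "\<dots> = 1 - ln ?k / ln ?k'" using l by (simp add: diff_divide_distrib)
  also have "\<dots> \<le> - ln (ln ?k / ln ?k')" using ln_le_minus_one[of "ln ?k / ln ?k'"] l by simp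
  also have "\<dots> = ln (ln ?k') - ln (ln ?k)" using l by (simp add: ln_div)
  finally show "1 / (real (Suc k) * ln (real (Suc k))) \<le> ln (ln (real (Suc k))) - ln (ln ?k)"
    by (simp add: add.commute)
qed

lemma lnln_sum_bounds:
  assumes "n \<ge> 2"
  shows "ln (ln (real (Suc n))) - ln (ln 2) \<le> (\<Sum>k\<in>{2..n}. 1 / (real k * ln (real k)))"
    and "(\<Sum>k\<in>{2..n}. 1 / (real k * ln (real k))) \<le> 1 / (2 * ln 2) + ln (ln (real n)) - ln (ln 2)"
  using assms
proof (induction n rule: dec_induct)
  case base
  case 1 show ?case using lnln_step(2)[of 2] by simp
next
  case base
  case 2 show ?case by simp
next
  case (step n)
  case 1 show ?case using step lnln_step(2)[of "Suc n"] by simp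
next
  case (step n)
  case 2 show ?case using step lnln_step(1)[of n] by simp
qed

definition qA :: "(real^'d \<Rightarrow> real) \<Rightarrow> (real^'d) list \<Rightarrow> real" where
  "qA h xs = ((hsum h xs)\<^sup>2 + hsum (\<lambda>x. (h x)\<^sup>2) xs) / real (length xs)"

text \<open>Increments of the compensator of \<open>qA\<close>. The value at \<open>0\<close> is
  exceptional because a single step gives \<open>qA h [x] = 2 * (h x)^2\<close>, the squared sum and
  the sum of squares being equal.\<close>

definition qe :: "real \<Rightarrow> nat \<Rightarrow> real" where
  "qe s k = (if k = 0 then 2 * s else s / (real k + 1))"

definition qz :: "(real^'d \<Rightarrow> real) \<Rightarrow> (real^'d) list \<Rightarrow> real^'d \<Rightarrow> real" where
  "qz h xs x = qA h (xs @ [x]) - qA h xs - qe (erw_avg (\<lambda>x. (h x)\<^sup>2)) (length xs)"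

lemma qA_Nil [simp]: "qA h [] = 0"
  by (simp add: qA_def)

lemma qA_mult_length: "qA h xs * real (length xs) = (hsum h xs)\<^sup>2 + hsum (\<lambda>x. (h x)\<^sup>2) xs"
  by (cases "xs = []") (simp_all add: qA_def)

lemma qA_snoc:
  "qA h (xs @ [x]) = (qA h xs * real (length xs) + 2 * hsum h xs * h x + 2 * (h x)\<^sup>2) / (real (length xs) + 1)"
  unfolding qA_mult_length by (simp add: qA_def power2_eq_square algebra_simps)

text \<open>The compensator of \<open>(S\<^sub>n\<^sup>2 + \<Sum> X\<^sub>k\<^sup>2) / n\<close> is deterministic: the quadratic term added to
  \<open>S\<^sub>n\<^sup>2\<close> absorbs the fluctuations of the conditional variance.\<close>

lemma erw_next_qz:
  assumes h: "centered h b" and xs: "xs \<in> lists erw_dirs"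
  shows "erw_next xs (qz h xs) = 0"
proof -
  define s where "s = erw_avg (\<lambda>x. (h x)\<^sup>2)"
  define n where "n = real (length xs)"
  define H where "H = hsum h xs"
  define T where "T = hsum (\<lambda>x. (h x)\<^sup>2) xs"
  have n0: "n \<ge> 0" by (simp add: n_def)
  have "erw_next xs (\<lambda>x. qA h (xs @ [x]))
     = erw_next xs (\<lambda>x. qA h xs * n / (n + 1) + (2 * H / (n + 1)) * h x + (2 / (n + 1)) * (h x)\<^sup>2)"
    unfolding qA_snoc by (simp add: n_def[symmetric] H_def[symmetric] add_divide_distrib)
  also have "\<dots> = qA h xs * n / (n + 1) + (2 * H / (n + 1)) * erw_next xs h + (2 / (n + 1)) * erw_next xs (\<lambda>x. (h x)\<^sup>2)"
    by (simp only: erw_next_add erw_next_cmult erw_next_const)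
  also have "\<dots> = qA h xs + qe s (length xs)"
  proof (cases "xs = []")
    case True
    then show ?thesis using h by (simp add: erw_next_def centered_def n_def H_def qe_def s_def)
  next
    case False
    then have n: "n > 0" by (simp add: n_def)
    have e1: "erw_next xs h = H / (2 * n)" and e2: "erw_next xs (\<lambda>x. (h x)\<^sup>2) = (T / n + s) / 2"
      using False h by (simp_all add: erw_next_def centered_def n_def H_def T_def s_def)
    have q: "qA h xs * n = H\<^sup>2 + T" unfolding n_def qA_mult_length by (simp add: H_def T_def)
    have qa: "qA h xs = (H\<^sup>2 + T) / n" using q n by (simp add: field_simps)
    have qe': "qe s (length xs) = s / (n + 1)" using False by (simp add: qe_def n_def)
    have n2: "n + 1 \<noteq> 0" "n \<noteq> 0" using n by auto
    have "(2 * H / (n + 1)) * (H / (2 * n)) = (H\<^sup>2 / n) / (n + 1)"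
      using n2 by (simp add: power2_eq_square)
    moreover have "(2 / (n + 1)) * ((T / n + s) / 2) = (T / n) / (n + 1) + s / (n + 1)"
      using n2 by (simp add: add_divide_distrib)
    moreover have "(H\<^sup>2 + T) / (n + 1) + (H\<^sup>2 / n) / (n + 1) + (T / n) / (n + 1) = (H\<^sup>2 + T) / n"
    proof -
      have "(H\<^sup>2 + T) / (n + 1) + (H\<^sup>2 / n) / (n + 1) + (T / n) / (n + 1) = ((H\<^sup>2 + T) + (H\<^sup>2 + T) / n) / (n + 1)"
        by (simp add: add_divide_distrib)
      also have "(H\<^sup>2 + T) + (H\<^sup>2 + T) / n = ((H\<^sup>2 + T) / n) * (n + 1)" using n by (simp add: field_simps)
      finally show ?thesis using n2 by simp
    qed
    ultimately show ?thesis unfolding e1 e2 q qe' unfolding qa by linarith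
  qed
  finally show ?thesis
    unfolding qz_def by (simp only: erw_next_diff erw_next_const) (simp add: s_def)
qed

lemma qA_eq_msum: "qA h xs = msum (qz h) xs + (\<Sum>k<length xs. qe (erw_avg (\<lambda>x. (h x)\<^sup>2)) k)"
proof (induction xs rule: rev_induct)
  case (snoc x xs)
  then show ?case by (simp add: qz_def)
qed simp

lemma qe_sum: "n \<ge> 1 \<Longrightarrow> (\<Sum>k<n. qe s k) = s * (harm n + 1)"
proof (induction n rule: dec_induct)
  case base
  show ?case by (simp add: qe_def harm_def)
next
  case (step n)
  then show ?case by (simp add: qe_def harm_Suc inverse_eq_divide algebra_simps)
qed

lemma erw_ex_qA:
  fixes h :: "real^'d \<Rightarrow> real"
  assumes h: "centered h b"
  shows "erw_ex n (qA h) [] = (\<Sum>k<n. qe (erw_avg (\<lambda>x. (h x)\<^sup>2)) k)"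
proof (induction n)
  case (Suc n)
  let ?s = "erw_avg (\<lambda>x. (h x)\<^sup>2)"
  have "erw_ex (Suc n) (qA h) [] = erw_ex n (\<lambda>xs. qA h xs + qe ?s n) []"
    unfolding erw_ex_Suc_right
  proof (rule erw_ex_cong)
    fix xs :: "(real^'d) list" assume xs: "xs \<in> lists erw_dirs" "length xs = length ([] :: (real^'d) list) + n"
    have "erw_next xs (\<lambda>x. qA h (xs @ [x])) - qA h xs - qe ?s (length xs) = 0"
      using erw_next_qz[OF h xs(1)] unfolding qz_def by (simp only: erw_next_diff erw_next_const)
    then show "erw_next xs (\<lambda>x. qA h (xs @ [x])) = qA h xs + qe ?s n" using xs(2) by simp
  qed simp
  then show ?case using Suc by (simp add: erw_ex_add)
qed simp

lemma avg_sq_bounds: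
  assumes h: "centered h b"
  shows "0 \<le> erw_avg (\<lambda>x. (h x)\<^sup>2)" "erw_avg (\<lambda>x. (h x)\<^sup>2) \<le> b\<^sup>2"
proof -
  have hx: "(h x)\<^sup>2 \<le> b\<^sup>2" if "x \<in> erw_dirs" for x
    using h that by (auto simp: centered_def power2_le_iff_abs_le)
  then show "erw_avg (\<lambda>x. (h x)\<^sup>2) \<le> b\<^sup>2"
    using erw_avg_mono[of "\<lambda>x. (h x)\<^sup>2" "\<lambda>_. b\<^sup>2"] by (simp add: erw_avg_const)
  show "0 \<le> erw_avg (\<lambda>x. (h x)\<^sup>2)"
    using erw_avg_mono[of "\<lambda>_. 0" "\<lambda>x. (h x)\<^sup>2"] by (simp add: erw_avg_const)
qed

lemma hsum_sq_bounds:
  assumes h: "centered h b" and xs: "xs \<in> lists erw_dirs"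
  shows "0 \<le> hsum (\<lambda>x. (h x)\<^sup>2) xs" "hsum (\<lambda>x. (h x)\<^sup>2) xs \<le> b\<^sup>2 * real (length xs)"
proof -
  show "0 \<le> hsum (\<lambda>x. (h x)\<^sup>2) xs" by (induction xs) auto
  show "hsum (\<lambda>x. (h x)\<^sup>2) xs \<le> b\<^sup>2 * real (length xs)"
    using xs
  proof (induction xs)
    case (Cons x xs)
    then have "(h x)\<^sup>2 \<le> b\<^sup>2" using h by (auto simp: centered_def power2_le_iff_abs_le)
    then show ?case using Cons by (simp add: algebra_simps)
  qed simp
qed

lemma qA_nonneg:
  assumes h: "centered h b" and xs: "xs \<in> lists erw_dirs"
  shows "qA h xs \<ge> 0"
  using hsum_sq_bounds(1)[OF assms] by (simp add: qA_def)

text \<open>A bound linear in \<open>qA\<close> itself keeps the expectation computable from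
  \<open>erw_ex_qA\<close>, so fourth moments of \<open>hsum\<close> never have to be
  estimated.\<close>

lemma qz_square_le:
  assumes h: "centered h b" and xs: "xs \<in> lists erw_dirs" and x: "x \<in> erw_dirs"
  shows "(qz h xs x)\<^sup>2 \<le> 20 * b\<^sup>2 * (qA h xs + b\<^sup>2) / (real (length xs) + 1)"
proof -
  define s where "s = erw_avg (\<lambda>x. (h x)\<^sup>2)"
  define n where "n = real (length xs)"
  define H where "H = hsum h xs"
  define A where "A = qA h xs"
  have b: "b > 0" using h by (rule centered_pos)
  have s: "0 \<le> s" "s \<le> b\<^sup>2" using avg_sq_bounds[OF h] by (auto simp: s_def)
  have hx: "(h x)\<^sup>2 \<le> b\<^sup>2" using h x by (auto simp: centered_def power2_le_iff_abs_le)
  show ?thesis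
  proof (cases "xs = []")
    case True
    have "\<bar>(h x)\<^sup>2 - s\<bar> \<le> b\<^sup>2" 
    proof (rule abs_leI)
      show "(h x)\<^sup>2 - s \<le> b\<^sup>2" using add_mono[OF hx s(1)] by simp
      show "- ((h x)\<^sup>2 - s) \<le> b\<^sup>2" using add_mono[OF s(2) zero_le_power2[of "h x"]] by simp
    qed
    then have "\<bar>2 * ((h x)\<^sup>2 - s)\<bar> \<le> 2 * b\<^sup>2" by (simp add: abs_mult)
    then have "\<bar>2 * ((h x)\<^sup>2 - s)\<bar>\<^sup>2 \<le> (2 * b\<^sup>2)\<^sup>2" by (intro power_mono) auto
    also have "\<dots> = 4 * (b\<^sup>2 * b\<^sup>2)" by (simp add: power2_eq_square)
    also have "\<dots> \<le> 20 * (b\<^sup>2 * b\<^sup>2)" by (intro mult_right_mono) auto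
    finally have "(2 * ((h x)\<^sup>2 - s))\<^sup>2 \<le> 20 * (b\<^sup>2 * b\<^sup>2)" by (simp only: power2_abs)
    moreover have "qz h xs x = 2 * ((h x)\<^sup>2 - s)"
      using True unfolding qz_def qe_def s_def[symmetric] by (simp add: qA_def)
    ultimately show ?thesis using True by (simp add: mult.assoc)
  next
    case False
    then have n: "n \<ge> 1" by (cases xs) (auto simp: n_def)
    have A0: "A \<ge> 0" unfolding A_def by (rule qA_nonneg[OF h xs])
    have An: "A * n = H\<^sup>2 + hsum (\<lambda>x. (h x)\<^sup>2) xs" unfolding A_def n_def qA_mult_length H_def ..
    have H2: "H\<^sup>2 \<le> A * n" using hsum_sq_bounds(1)[OF h xs] An by linarith
    have "A * n \<le> (b * n)\<^sup>2 + b\<^sup>2 * n"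
      using An hsum_sq_bounds(2)[OF h xs] power_mono[OF hsum_bound[OF h xs], of 2] by (simp add: H_def n_def)
    then have "A * n \<le> (b\<^sup>2 * (n + 1)) * n" by (simp add: power2_eq_square algebra_simps)
    \<comment> \<open>This deterministic growth bound turns the term \<open>A^2\<close> below into
      one that is linear in \<open>A\<close>.\<close>
    then have Ale: "A \<le> b\<^sup>2 * (n + 1)" using n by simp
    have "qz h xs x = (2 * H * h x + 2 * (h x)\<^sup>2 - A - s) / (n + 1)"
    proof -
      have "(A * n + 2 * H * h x + 2 * (h x)\<^sup>2) / (n + 1) - A - s / (n + 1)
         = (A * n + 2 * H * h x + 2 * (h x)\<^sup>2 - A * (n + 1) - s) / (n + 1)"
        using n by (simp add: diff_divide_distrib)
      also have "A * n + 2 * H * h x + 2 * (h x)\<^sup>2 - A * (n + 1) - s = 2 * H * h x + 2 * (h x)\<^sup>2 - A - s"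
        by (simp add: algebra_simps)
      finally show ?thesis
        unfolding qz_def qA_snoc using False
        by (simp add: n_def[symmetric] H_def[symmetric] A_def[symmetric] qe_def s_def[symmetric])
    qed
    then have "(qz h xs x)\<^sup>2 = (2 * H * h x + 2 * (h x)\<^sup>2 - A - s)\<^sup>2 / (n + 1)\<^sup>2" by (simp add: power_divide)
    also have "\<dots> \<le> (20 * b\<^sup>2 * (A + b\<^sup>2) * (n + 1)) / (n + 1)\<^sup>2"
    proof (rule divide_right_mono)
      have four: "(p + q - r - t)\<^sup>2 \<le> 4 * (p\<^sup>2 + q\<^sup>2 + r\<^sup>2 + t\<^sup>2)" for p q r t :: real
      proof -
        have "4 * (p\<^sup>2 + q\<^sup>2 + r\<^sup>2 + t\<^sup>2) - (p + q - r - t)\<^sup>2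
          = (p - q)\<^sup>2 + (p + r)\<^sup>2 + (p + t)\<^sup>2 + (q + r)\<^sup>2 + (q + t)\<^sup>2 + (r - t)\<^sup>2"
          by (simp add: power2_eq_square algebra_simps)
        then show ?thesis by (smt (verit) zero_le_power2)
      qed
      have "(2 * H * h x + 2 * (h x)\<^sup>2 - A - s)\<^sup>2 \<le> 4 * ((2 * H * h x)\<^sup>2 + (2 * (h x)\<^sup>2)\<^sup>2 + A\<^sup>2 + s\<^sup>2)"
        by (rule four)
      also have "(2 * H * h x)\<^sup>2 \<le> 4 * ((A * n) * b\<^sup>2)"
        using mult_mono[OF H2 hx] A0 n by (simp add: power_mult_distrib)
      also have "(2 * (h x)\<^sup>2)\<^sup>2 \<le> 4 * (b\<^sup>2 * b\<^sup>2)"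
        using mult_mono[OF hx hx] by (simp add: power2_eq_square)
      also have "A\<^sup>2 \<le> A * (b\<^sup>2 * (n + 1))" unfolding power2_eq_square[of A] using Ale A0 by (intro mult_left_mono) auto
      also have "s\<^sup>2 \<le> b\<^sup>2 * b\<^sup>2" unfolding power2_eq_square[of s] using s by (intro mult_mono) auto
      also have "4 * (4 * (A * n * b\<^sup>2) + 4 * (b\<^sup>2 * b\<^sup>2) + A * (b\<^sup>2 * (n + 1)) + b\<^sup>2 * b\<^sup>2)
         \<le> 20 * b\<^sup>2 * (A + b\<^sup>2) * (n + 1)"
      proof -
        have "20 * b\<^sup>2 * (A + b\<^sup>2) * (n + 1) - 4 * (4 * (A * n * b\<^sup>2) + 4 * (b\<^sup>2 * b\<^sup>2) + A * (b\<^sup>2 * (n + 1)) + b\<^sup>2 * b\<^sup>2)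
           = 16 * (A * b\<^sup>2) + 20 * (b\<^sup>2 * b\<^sup>2) * n"
          by (simp add: algebra_simps)
        moreover have "16 * (A * b\<^sup>2) + 20 * (b\<^sup>2 * b\<^sup>2) * n \<ge> 0" using A0 n by simp
        ultimately show ?thesis by linarith
      qed
      finally show "(2 * H * h x + 2 * (h x)\<^sup>2 - A - s)\<^sup>2 \<le> 20 * b\<^sup>2 * (A + b\<^sup>2) * (n + 1)" by simp
    qed simp
    also have "\<dots> = 20 * b\<^sup>2 * (A + b\<^sup>2) / (n + 1)" using n by (simp add: power2_eq_square)
    finally show ?thesis by (simp add: A_def n_def)
  qed
qed

lemma ln_add_2_ge: "3 \<le> 5 * ln (real k + 2)"
proof -
  have "ln 2 \<le> ln (real k + 2)" by simp
  moreover have "(3/5::real) \<le> ln 2" using ln2_ge_two_thirds by simp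
  ultimately show ?thesis by linarith
qed

text \<open>The mean of \<open>qA\<close> is logarithmic, being a sum of the harmonic terms
  \<open>qe\<close>. The constant is \<open>120 = 20 * 6\<close>, the \<open>6\<close> absorbing
  additive constants by means of \<open>ln_add_2_ge\<close>.\<close>

lemma qz_second_moment:
  fixes h :: "real^'d \<Rightarrow> real"
  assumes h: "centered h b"
  shows "erw_ex k (\<lambda>xs. erw_next xs (\<lambda>x. (qz h xs x)\<^sup>2)) [] \<le> 120 * b ^ 4 * ln (real k + 2) / (real k + 1)"
proof -
  have b: "b > 0" using h by (rule centered_pos)
  define c where "c = 20 * b\<^sup>2 / (real k + 1)"
  have c0: "c \<ge> 0" by (simp add: c_def)
  have "erw_ex k (\<lambda>xs. erw_next xs (\<lambda>x. (qz h xs x)\<^sup>2)) [] \<le> erw_ex k (\<lambda>xs. c * (qA h xs + b\<^sup>2)) []"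
  proof (rule erw_ex_mono)
    fix xs :: "(real^'d) list" assume xs: "xs \<in> lists erw_dirs" "length xs = length ([] :: (real^'d) list) + k"
    have "erw_next xs (\<lambda>x. (qz h xs x)\<^sup>2) \<le> erw_next xs (\<lambda>x. 20 * b\<^sup>2 * (qA h xs + b\<^sup>2) / (real (length xs) + 1))"
      by (intro erw_next_mono xs(1) qz_square_le[OF h])
    then show "erw_next xs (\<lambda>x. (qz h xs x)\<^sup>2) \<le> c * (qA h xs + b\<^sup>2)" using xs(2) by (simp add: c_def)
  qed simp
  also have "\<dots> = c * ((\<Sum>i<k. qe (erw_avg (\<lambda>x. (h x)\<^sup>2)) i) + b\<^sup>2)"
    by (simp only: erw_ex_cmult erw_ex_add erw_ex_const erw_ex_qA[OF h])
  also have "\<dots> \<le> c * (b\<^sup>2 * (6 * ln (real k + 2)))"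
  proof (rule mult_left_mono)
    show "(\<Sum>i<k. qe (erw_avg (\<lambda>x. (h x)\<^sup>2)) i) + b\<^sup>2 \<le> b\<^sup>2 * (6 * ln (real k + 2))"
    proof (cases "k = 0")
      case True
      have "b\<^sup>2 * 1 \<le> b\<^sup>2 * (6 * ln (real k + 2))" using ln_add_2_ge[of k] by (intro mult_left_mono) auto
      then show ?thesis using True by simp
    next
      case False
      then have k1: "k \<ge> 1" by simp
      have "(\<Sum>i<k. qe (erw_avg (\<lambda>x. (h x)\<^sup>2)) i) \<le> b\<^sup>2 * (harm k + 1)"
        unfolding qe_sum[OF k1] using avg_sq_bounds(2)[OF h] harm_nonneg[of k, where 'a=real]
        by (intro mult_right_mono) auto
      moreover have "b\<^sup>2 * (harm k + 1 + 1) \<le> b\<^sup>2 * (6 * ln (real k + 2))"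
      proof (rule mult_left_mono)
        have "ln (real k) \<le> ln (real k + 2)" using k1 by simp
        then show "harm k + 1 + 1 \<le> 6 * ln (real k + 2)" using harm_le_ln[OF k1] ln_add_2_ge[of k] by linarith
      qed simp
      ultimately show ?thesis by (simp add: algebra_simps)
    qed
  qed (rule c0)
  also have "\<dots> = 120 * b ^ 4 * ln (real k + 2) / (real k + 1)"
    by (simp add: c_def power4_eq_xxxx power2_eq_square)
  finally show ?thesis .
qed

definition qQ :: "(real^'d \<Rightarrow> real) \<Rightarrow> nat \<Rightarrow> (real^'d) list \<Rightarrow> real" where
  "qQ h N ys = (\<Sum>k\<in>{1..N}. lw k * qA h (take k ys))"

text \<open>The expectation of \<open>qQ h N\<close>, by \<open>erw_ex_qA\<close>, when
  \<open>s\<close> is the uniform average of the square of \<open>h\<close>.\<close>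

definition qm :: "real \<Rightarrow> nat \<Rightarrow> real" where
  "qm s N = (\<Sum>k\<in>{1..N}. lw k * (\<Sum>i<k. qe s i))"

lemma lw_tail': "(\<Sum>k\<in>{Suc i..N}. lw k) \<le> 8 / ln (real i + 2)"
proof (cases "i = 0")
  case True
  have "(\<Sum>k\<in>{Suc i..N}. lw k) \<le> (\<Sum>k\<in>{..<Suc N}. lw k)"
    by (intro sum_mono2) (auto simp: lw_nonneg)
  also have "\<dots> \<le> 4 / ln 2" by (rule lw_sum_le)
  also have "\<dots> \<le> 8 / ln 2" by (simp add: divide_right_mono)
  finally show ?thesis using True by simp
next
  case False
  have "(\<Sum>k\<in>{Suc i..N}. lw k) = (\<Sum>k\<in>{Suc i..<Suc N}. lw k)" by (simp only: atLeastLessThanSuc_atLeastAtMost)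
  also have "\<dots> \<le> 4 / ln (real (Suc i))" using False by (intro lw_tail) simp
  also have "\<dots> = 8 / (2 * ln (real i + 1))" by (simp add: add.commute)
  also have "\<dots> \<le> 8 / ln (real i + 2)"
  proof (rule divide_left_mono)
    have i: "real i \<ge> 1" using False by simp
    then have "real i * 1 \<le> real i * real i" by (intro mult_left_mono) auto
    then have "real i + 2 \<le> (real i + 1)\<^sup>2" using i unfolding power2_eq_square distrib_left distrib_right by linarith
    then have "ln (real i + 2) \<le> ln ((real i + 1)\<^sup>2)" using i by (subst ln_le_cancel_iff) auto
    then show "ln (real i + 2) \<le> 2 * ln (real i + 1)" using i by (simp add: ln_realpow)
    show "0 < 2 * ln (real i + 1) * ln (real i + 2)" using i by simp
  qed simp
  finally show ?thesis .
qed

text \<open>Summation by parts: the increment leaving length \<open>i\<close> enters every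
  \<open>qA\<close> of larger index, so its total weight is a tail of \<open>lw\<close>, at most of
  order \<open>1 / ln i\<close>. The tail depends on the horizon \<open>N\<close>, which is why
  \<open>N\<close> is fixed.\<close>

lemma qQ_eq_msum:
  assumes "length ys = N"
  shows "qQ h N ys - qm (erw_avg (\<lambda>x. (h x)\<^sup>2)) N
     = msum (\<lambda>xs x. (\<Sum>k\<in>{Suc (length xs)..N}. lw k) * qz h xs x) ys"
proof -
  let ?s = "erw_avg (\<lambda>x. (h x)\<^sup>2)"
  let ?z = "\<lambda>i. qz h (take i ys) (ys ! i)"
  have "lw k * qA h (take k ys) = (\<Sum>i\<in>{i \<in> {..<N}. i < k}. lw k * ?z i) + lw k * (\<Sum>i<k. qe ?s i)" if "k \<in> {1..N}" for k
  proof -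
    have lk: "length (take k ys) = k" using that assms by simp
    have "qA h (take k ys) = (\<Sum>i<k. ?z i) + (\<Sum>i<k. qe ?s i)"
      unfolding qA_eq_msum[of h "take k ys"] msum_def lk
      by (intro arg_cong2[of _ _ _ _ "(+)"] sum.cong refl) (auto simp: min_def)
    moreover have "{i \<in> {..<N}. i < k} = {..<k}" using that by auto
    ultimately show ?thesis by (simp add: distrib_left sum_distrib_left)
  qed
  then have "qQ h N ys = (\<Sum>k\<in>{1..N}. \<Sum>i\<in>{i \<in> {..<N}. i < k}. lw k * ?z i) + qm ?s N"
    unfolding qQ_def qm_def sum.distrib[symmetric] by (intro sum.cong refl)
  also have "(\<Sum>k\<in>{1..N}. \<Sum>i\<in>{i \<in> {..<N}. i < k}. lw k * ?z i)
     = (\<Sum>i\<in>{..<N}. \<Sum>k\<in>{k \<in> {1..N}. i < k}. lw k * ?z i)"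
    by (rule sum.swap_restrict) auto
  also have "\<dots> = (\<Sum>i<N. (\<Sum>k\<in>{Suc i..N}. lw k) * ?z i)"
  proof (intro sum.cong refl)
    fix i
    have "{k \<in> {1..N}. i < k} = {Suc i..N}" by auto
    then show "(\<Sum>k\<in>{k \<in> {1..N}. i < k}. lw k * ?z i) = (\<Sum>k\<in>{Suc i..N}. lw k) * ?z i"
      by (simp add: sum_distrib_right)
  qed
  also have "\<dots> = msum (\<lambda>xs x. (\<Sum>k\<in>{Suc (length xs)..N}. lw k) * qz h xs x) ys"
    unfolding msum_def assms by (intro sum.cong refl) (use assms in auto)
  finally show ?thesis by simp
qed

text \<open>Squared weights \<open>1 / (ln k)^2\<close> meet increment variances of order
  \<open>ln k / k\<close>, and the resulting \<open>1 / (k * ln k)\<close> sums to a double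
  logarithm. The constant is \<open>64 * 120 * 2\<close>, the last factor paying for the change from
  \<open>k + 1\<close> to \<open>k + 2\<close>.\<close>

lemma qQ_variance:
  fixes h :: "real^'d \<Rightarrow> real"
  assumes h: "centered h b" and "N \<ge> 1"
  shows "erw_ex N (\<lambda>ys. (qQ h N ys - qm (erw_avg (\<lambda>x. (h x)\<^sup>2)) N)\<^sup>2) []
     \<le> 15360 * b ^ 4 * (1 / (2 * ln 2) + ln (ln (real (Suc N))) - ln (ln 2))"
proof -
  let ?D = "\<lambda>xs x. (\<Sum>k\<in>{Suc (length xs)..N}. lw k) * qz h xs x"
  have "erw_ex N (\<lambda>ys. (qQ h N ys - qm (erw_avg (\<lambda>x. (h x)\<^sup>2)) N)\<^sup>2) [] = erw_ex N (\<lambda>ys. (msum ?D ys)\<^sup>2) []"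
    by (rule erw_ex_cong) (simp_all add: qQ_eq_msum)
  also have "\<dots> = (\<Sum>k<N. erw_ex k (\<lambda>xs. erw_next xs (\<lambda>x. (?D xs x)\<^sup>2)) [])"
    by (rule erw_ex_msum_square) (simp add: erw_next_cmult erw_next_qz[OF h])
  also have "\<dots> \<le> (\<Sum>k<N. 15360 * b ^ 4 * (1 / (real (k + 2) * ln (real (k + 2)))))"
  proof (rule sum_mono)
    fix k
    define R where "R = (\<Sum>i\<in>{Suc k..N}. lw i)"
    have l: "ln (real k + 2) > 0" by simp
    have R: "0 \<le> R" "R \<le> 8 / ln (real k + 2)"
      unfolding R_def using lw_tail' by (auto intro!: sum_nonneg simp: lw_nonneg)
    have "erw_ex k (\<lambda>xs. erw_next xs (\<lambda>x. (?D xs x)\<^sup>2)) [] = erw_ex k (\<lambda>xs. R\<^sup>2 * erw_next xs (\<lambda>x. (qz h xs x)\<^sup>2)) []"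
      by (rule erw_ex_cong) (simp_all add: R_def power_mult_distrib erw_next_cmult)
    also have "\<dots> = R\<^sup>2 * erw_ex k (\<lambda>xs. erw_next xs (\<lambda>x. (qz h xs x)\<^sup>2)) []" by (rule erw_ex_cmult)
    also have "\<dots> \<le> R\<^sup>2 * (120 * b ^ 4 * ln (real k + 2) / (real k + 1))"
      by (intro mult_left_mono qz_second_moment[OF h]) auto
    also have "\<dots> \<le> (8 / ln (real k + 2))\<^sup>2 * (120 * b ^ 4 * ln (real k + 2) / (real k + 1))"
      using R l by (intro mult_right_mono power_mono) auto
    also have "\<dots> = 7680 * b ^ 4 * (1 / ((real k + 1) * ln (real k + 2)))"
      using l by (simp add: power2_eq_square)
    also have "\<dots> \<le> 7680 * b ^ 4 * (2 / ((real k + 2) * ln (real k + 2)))"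
    proof (rule mult_left_mono)
      have "1 / (real k + 1) \<le> 2 / (real k + 2)" by (simp add: divide_simps)
      then have "1 / (real k + 1) / ln (real k + 2) \<le> 2 / (real k + 2) / ln (real k + 2)"
        using l by (intro divide_right_mono) auto
      then show "1 / ((real k + 1) * ln (real k + 2)) \<le> 2 / ((real k + 2) * ln (real k + 2))" by simp
    qed simp
    also have "\<dots> = 15360 * b ^ 4 * (1 / (real (k + 2) * ln (real (k + 2))))" by (simp add: add.commute)
    finally show "erw_ex k (\<lambda>xs. erw_next xs (\<lambda>x. (?D xs x)\<^sup>2)) [] \<le> 15360 * b ^ 4 * (1 / (real (k + 2) * ln (real (k + 2))))" .
  qed
  also have "\<dots> = 15360 * b ^ 4 * (\<Sum>k<N. 1 / (real (k + 2) * ln (real (k + 2))))" by (simp only: sum_distrib_left)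
  also have "(\<Sum>k<N. 1 / (real (k + 2) * ln (real (k + 2)))) = (\<Sum>k\<in>{2..Suc N}. 1 / (real k * ln (real k)))"
    by (rule sum.reindex_bij_witness[of _ "\<lambda>k. k - 2" "\<lambda>k. k + 2"]) auto
  also have "15360 * b ^ 4 * (\<Sum>k\<in>{2..Suc N}. 1 / (real k * ln (real k)))
     \<le> 15360 * b ^ 4 * (1 / (2 * ln 2) + ln (ln (real (Suc N))) - ln (ln 2))"
    using assms(2) by (intro mult_left_mono lnln_sum_bounds(2)) auto
  finally show ?thesis .
qed

text \<open>Replacing \<open>harm k + 1\<close> by \<open>ln k\<close> makes a bounded error, and a
  bounded error weighted by \<open>lw\<close> is summable. What remains is comparable to the
  integral of \<open>1 / (x * ln x)\<close>.\<close>

lemma qm_ratio: "(\<lambda>n. qm s n / ln (ln (real n))) \<longlonglongrightarrow> s"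
proof -
  define c where "c k = (harm k + 1 - ln (real k)) * lw k" for k
  define S where "S n = (\<Sum>k\<in>{2..n}. 1 / (real k * ln (real k)))" for n :: nat
  have qm_eq: "qm s n = s * S n + s * (\<Sum>k\<in>{2..n}. c k)" for n
  proof -
    have "qm s n = (\<Sum>k\<in>{1..n}. lw k * (s * (harm k + 1)))"
      unfolding qm_def by (intro sum.cong refl) (simp add: qe_sum)
    also have "\<dots> = (\<Sum>k\<in>{2..n}. lw k * (s * (harm k + 1)))"
    proof (rule sum.mono_neutral_right)
      show "\<forall>i\<in>{1..n} - {2..n}. lw i * (s * (harm i + 1)) = 0"
      proof
        fix i assume "i \<in> {1..n} - {2..n}"
        then have "i = Suc 0" by auto
        then show "lw i * (s * (harm i + 1)) = 0" by simp
      qed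
    qed auto
    also have "\<dots> = (\<Sum>k\<in>{2..n}. s * (1 / (real k * ln (real k))) + s * c k)"
    proof (rule sum.cong[OF refl])
      fix k assume "k \<in> {2..n}"
      then have l: "ln (real k) > 0" by simp
      have "lw k * ln (real k) = 1 / (real k * ln (real k))" using l by (simp add: lw_def power2_eq_square)
      then show "lw k * (s * (harm k + 1)) = s * (1 / (real k * ln (real k))) + s * c k"
        unfolding c_def by (metis (no_types, opaque_lifting) mult.assoc mult.commute add_diff_cancel_left' diff_add_cancel distrib_left)
    qed
    finally show ?thesis unfolding S_def by (simp add: sum.distrib sum_distrib_left)
  qed
  have c_bounds: "0 \<le> (\<Sum>k\<in>{2..n}. c k)" "(\<Sum>k\<in>{2..n}. c k) \<le> 2 * (4 / ln 2)" for n
  proof -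
    have ck: "0 \<le> c k \<and> c k \<le> 2 * lw k" if "k \<in> {2..n}" for k
    proof -
      have k: "k \<ge> 1" using that by simp
      have "ln (real k) \<le> ln (real k + 1)" using k by simp
      then have "0 \<le> harm k + 1 - ln (real k)" using ln_le_harm[of k] by linarith
      moreover have "harm k + 1 - ln (real k) \<le> 2" using harm_le_ln[OF k] by linarith
      ultimately show ?thesis unfolding c_def using lw_nonneg[of k] by (auto intro: mult_right_mono)
    qed
    then show "0 \<le> (\<Sum>k\<in>{2..n}. c k)" by (intro sum_nonneg) auto
    have "(\<Sum>k\<in>{2..n}. c k) \<le> (\<Sum>k\<in>{2..n}. 2 * lw k)" using ck by (intro sum_mono) auto
    also have "\<dots> = 2 * (\<Sum>k\<in>{2..n}. lw k)" by (simp add: sum_distrib_left)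
    also have "(\<Sum>k\<in>{2..n}. lw k) \<le> (\<Sum>k\<in>{..<Suc n}. lw k)" by (intro sum_mono2) (auto simp: lw_nonneg)
    also have "\<dots> \<le> 4 / ln 2" by (rule lw_sum_le)
    finally show "(\<Sum>k\<in>{2..n}. c k) \<le> 2 * (4 / ln 2)" by simp
  qed
  have lpos: "eventually (\<lambda>n::nat. ln (ln (real n)) > 0) sequentially" by real_asymp
  have "(\<lambda>n. S n / ln (ln (real n))) \<longlonglongrightarrow> 1"
  proof (rule tendsto_sandwich)
    show "eventually (\<lambda>n. (ln (ln (real (Suc n))) - ln (ln 2)) / ln (ln (real n)) \<le> S n / ln (ln (real n))) sequentially"
      using lpos eventually_ge_at_top[of 2]
      by eventually_elim (auto intro!: divide_right_mono lnln_sum_bounds(1) simp: S_def simp del: of_nat_Suc)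
    show "eventually (\<lambda>n. S n / ln (ln (real n)) \<le> (1 / (2 * ln 2) + ln (ln (real n)) - ln (ln 2)) / ln (ln (real n))) sequentially"
      using lpos eventually_ge_at_top[of 2]
      by eventually_elim (auto intro!: divide_right_mono lnln_sum_bounds(2) simp: S_def)
    show "(\<lambda>n. (ln (ln (real (Suc n))) - ln (ln 2)) / ln (ln (real n))) \<longlonglongrightarrow> 1" by real_asymp
    show "(\<lambda>n. (1 / (2 * ln 2) + ln (ln (real n)) - ln (ln 2)) / ln (ln (real n))) \<longlonglongrightarrow> 1" by real_asymp
  qed
  moreover have "(\<lambda>n. (\<Sum>k\<in>{2..n}. c k) / ln (ln (real n))) \<longlonglongrightarrow> 0"
  proof (rule tendsto_sandwich)
    show "eventually (\<lambda>n. 0 \<le> (\<Sum>k\<in>{2..n}. c k) / ln (ln (real n))) sequentially"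
      using lpos by eventually_elim (simp add: c_bounds)
    show "eventually (\<lambda>n. (\<Sum>k\<in>{2..n}. c k) / ln (ln (real n)) \<le> 2 * (4 / ln 2) / ln (ln (real n))) sequentially"
      using lpos by eventually_elim (intro divide_right_mono c_bounds, simp)
    show "(\<lambda>n::nat. 2 * (4 / ln 2) / ln (ln (real n))) \<longlonglongrightarrow> 0" by real_asymp
  qed simp
  ultimately have "(\<lambda>n. s * (S n / ln (ln (real n))) + s * ((\<Sum>k\<in>{2..n}. c k) / ln (ln (real n)))) \<longlonglongrightarrow> s * 1 + s * 0"
    by (intro tendsto_intros)
  then show ?thesis by (simp add: qm_eq add_divide_distrib)
qed

section \<open>From variance bounds to almost sure limits\<close>

lemma erw_ex_chebyshev:
  assumes "y > 0" "xs \<in> lists erw_dirs"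
  shows "erw_ex n (\<lambda>ys. of_bool (y \<le> \<bar>f ys\<bar>)) xs \<le> erw_ex n (\<lambda>ys. (f ys)\<^sup>2) xs / y\<^sup>2"
proof -
  have "erw_ex n (\<lambda>ys. of_bool (y \<le> \<bar>f ys\<bar>)) xs \<le> erw_ex n (\<lambda>ys. (1 / y\<^sup>2) * (f ys)\<^sup>2) xs"
  proof (rule erw_ex_mono[OF assms(2)])
    fix ys :: "(real^'a) list"
    have "y\<^sup>2 \<le> (f ys)\<^sup>2" if "y \<le> \<bar>f ys\<bar>" using power_mono[OF that, of 2] assms(1) by simp
    then show "of_bool (y \<le> \<bar>f ys\<bar>) \<le> (1 / y\<^sup>2) * (f ys)\<^sup>2" using assms(1) by auto
  qed
  then show ?thesis unfolding erw_ex_cmult by simp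
qed

text \<open>Between two points of the subsequence, monotonicity of both \<open>Q\<close> and
  \<open>L\<close> traps the ratio, and \<open>lim2\<close> closes the gap. The bound
  \<open>start\<close> excludes small indices at which an iterated logarithm fails to be
  positive.\<close>

lemma tendsto_ratio_of_subseq:
  fixes Q L :: "nat \<Rightarrow> real" and N :: "nat \<Rightarrow> nat"
  assumes Q: "incseq Q" "\<And>n. 0 \<le> Q n"
    and L: "\<And>n. n \<ge> start \<Longrightarrow> 0 < L n" "\<And>m n. start \<le> m \<Longrightarrow> m \<le> n \<Longrightarrow> L m \<le> L n"
    and N: "filterlim N at_top sequentially"
    and lim1: "(\<lambda>j. Q (N j) / L (N j)) \<longlonglongrightarrow> l"
    and lim2: "(\<lambda>j. L (N (Suc j)) / L (N j)) \<longlonglongrightarrow> 1"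
  shows "(\<lambda>n. Q n / L n) \<longlonglongrightarrow> l"
proof (rule LIMSEQ_I)
  fix e :: real assume "e > 0"
  have "(\<lambda>j. (Q (N j) / L (N j)) / (L (N (Suc j)) / L (N j))) \<longlonglongrightarrow> l / 1"
    by (intro tendsto_divide lim1 lim2) simp
  then have ev1: "eventually (\<lambda>j. (Q (N j) / L (N j)) / (L (N (Suc j)) / L (N j)) > l - e) sequentially"
    using \<open>e > 0\<close> by (intro order_tendstoD(1)) auto
  have "(\<lambda>j. (Q (N (Suc j)) / L (N (Suc j))) * (L (N (Suc j)) / L (N j))) \<longlonglongrightarrow> l * 1"
    by (intro tendsto_mult LIMSEQ_Suc[OF lim1] lim2)
  then have ev2: "eventually (\<lambda>j. (Q (N (Suc j)) / L (N (Suc j))) * (L (N (Suc j)) / L (N j)) < l + e) sequentially"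
    using \<open>e > 0\<close> by (intro order_tendstoD(2)) auto
  have ev3: "eventually (\<lambda>j. start \<le> N j) sequentially" using N by (simp add: filterlim_at_top)
  obtain J where J: "\<And>j. j \<ge> J \<Longrightarrow> (Q (N j) / L (N j)) / (L (N (Suc j)) / L (N j)) > l - e"
     "\<And>j. j \<ge> J \<Longrightarrow> (Q (N (Suc j)) / L (N (Suc j))) * (L (N (Suc j)) / L (N j)) < l + e"
     "\<And>j. j \<ge> J \<Longrightarrow> start \<le> N j"
    using eventually_conj[OF ev1 eventually_conj[OF ev2 ev3]] unfolding eventually_sequentially by blast
  show "\<exists>no. \<forall>n\<ge>no. norm (Q n / L n - l) < e"
  proof (intro exI allI impI)
    fix n assume "N J \<le> n"
    then obtain j where j: "j \<ge> J" "N j \<le> n" "n < N (Suc j)" using block_index[OF N] by blast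
    have st: "start \<le> N j" "start \<le> n" using J(3)[OF j(1)] j by auto
    have pos: "L (N j) > 0" "L (N (Suc j)) > 0" "L n > 0" using st j by (auto intro: L)
    have "Q (N j) / L (N (Suc j)) \<le> Q n / L n"
      using Q j st pos by (intro frac_le incseqD[OF Q(1)] L(2)) auto
    moreover have "Q n / L n \<le> Q (N (Suc j)) / L (N j)"
      using Q j st pos by (intro frac_le incseqD[OF Q(1)] L(2)) auto
    moreover have "Q (N j) / L (N (Suc j)) > l - e" using J(1)[OF j(1)] pos by simp
    moreover have "Q (N (Suc j)) / L (N j) < l + e" using J(2)[OF j(1)] pos by simp
    ultimately show "norm (Q n / L n - l) < e" by (simp add: abs_less_iff)
  qed
qed

lemma (in erw) qQ_path: "qQ h n (path n \<omega>) = (\<Sum>k\<in>{1..n}. lw k * qA h (path k \<omega>))"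
  unfolding qQ_def by (intro sum.cong refl) (auto simp: take_path)

lemma (in erw) AE_qQ_ratio:
  fixes h :: "real^'d \<Rightarrow> real"
  assumes h: "centered h b"
  shows "AE \<omega> in M. (\<lambda>n. qQ h n (path n \<omega>) / ln (ln (real n))) \<longlonglongrightarrow> erw_avg (\<lambda>x. (h x)\<^sup>2)"
proof -
  define s where "s = erw_avg (\<lambda>x. (h x)\<^sup>2)"
  \<comment> \<open>Along this sequence \<open>LL (N j)\<close> lies between \<open>j^2\<close> and
    \<open>j^2 + 1\<close>. Chebyshev's bound is then of order \<open>1 / j^2\<close>, which is
    summable, while consecutive ratios still tend to one.\<close>
  define N where "N j = nat \<lceil>exp (exp ((real j)\<^sup>2))\<rceil>" for j
  define LL where "LL n = ln (ln (real n))" for n :: nat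
  have b: "b > 0" using h by (rule centered_pos)
  have Nge: "exp (exp ((real j)\<^sup>2)) \<le> real (N j)" for j by (simp add: N_def)
  have Nle: "real (N j) \<le> exp (exp ((real j)\<^sup>2)) + 1" for j unfolding N_def by (simp add: of_nat_nat)
  have N1: "N j \<ge> 1" for j using Nge[of j] exp_gt_zero[of "exp ((real j)\<^sup>2)"] by (cases "N j") auto
  have Nlim: "filterlim N at_top sequentially"
  proof -
    have "filterlim (\<lambda>j. exp (exp ((real j)\<^sup>2))) at_top sequentially" by real_asymp
    then have "filterlim (\<lambda>j. real (N j)) at_top sequentially"
      by (rule filterlim_at_top_mono) (simp add: Nge)
    then show ?thesis unfolding filterlim_at_top by (metis (mono_tags, lifting) eventually_mono of_nat_le_iff)
  qed
  have LLge: "(real j)\<^sup>2 \<le> LL (N j)" for j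
  proof -
    have "exp ((real j)\<^sup>2) \<le> ln (real (N j))" using Nge[of j] N1[of j] by (subst ln_ge_iff) auto
    moreover have "ln (real (N j)) > 0" using calculation exp_gt_zero[of "(real j)\<^sup>2"] by linarith
    ultimately show ?thesis unfolding LL_def by (subst ln_ge_iff) auto
  qed
  have LLle: "LL (N j) \<le> (real j)\<^sup>2 + 1" for j
  proof -
    let ?x = "exp ((real j)\<^sup>2)"
    have x1: "?x \<ge> 1" by simp
    have e2: "exp 1 \<ge> (2::real)" using exp_ge_add_one_self[of "1::real"] by simp
    have double: "y + 1 \<le> y * exp 1" if "y \<ge> 1" for y :: real
    proof -
      have "y * 2 \<le> y * exp 1" using e2 that by (intro mult_left_mono) auto
      then show ?thesis using that by linarith
    qed
    have "real (N j) \<le> exp ?x * exp 1" using Nle[of j] double[of "exp ?x"] by simp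
    then have "ln (real (N j)) \<le> ln (exp ?x * exp 1)" using N1[of j] by (subst ln_le_cancel_iff) auto
    also have "\<dots> = ?x + 1" by (simp add: ln_mult)
    also have "\<dots> \<le> ?x * exp 1" by (rule double[OF x1])
    finally have 1: "ln (real (N j)) \<le> ?x * exp 1" .
    have "?x \<le> ln (real (N j))" using Nge[of j] N1[of j] by (subst ln_ge_iff) auto
    then have "ln (real (N j)) > 0" using x1 by linarith
    then have "LL (N j) \<le> ln (?x * exp 1)" unfolding LL_def using 1 by (subst ln_le_cancel_iff) auto
    also have "\<dots> = (real j)\<^sup>2 + 1" by (simp add: ln_mult)
    finally show ?thesis .
  qed
  \<comment> \<open>The tolerances are \<open>1 / (r + 1)\<close>, so that only countably many null
    sets have to be united.\<close>
  have "AE \<omega> in M. eventually (\<lambda>j. \<not> (1 / real (Suc r)) * LL (N j) \<le> \<bar>qQ h (N j) (path (N j) \<omega>) - qm s (N j)\<bar>) sequentially" for r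
  proof -
    define C where "C = 30720 * b ^ 4 * (real (Suc r))\<^sup>2"
    have "summable (\<lambda>j. C * (1 / (real j)\<^sup>2))"
      using summable_mult[OF inverse_power_summable[of 2, where 'a=real], of C] by (simp add: divide_inverse)
    moreover have "eventually (\<lambda>j. erw_ex (N j) (\<lambda>ys. of_bool ((1 / real (Suc r)) * LL (N j) \<le> \<bar>qQ h (N j) ys - qm s (N j)\<bar>)) []
        \<le> C * (1 / (real j)\<^sup>2)) sequentially"
    proof -
      have "eventually (\<lambda>n. 1 / (2 * ln 2) + ln (ln (real (Suc n))) - ln (ln 2) \<le> 2 * LL n) sequentially"
        unfolding LL_def by real_asymp
      from eventually_compose_filterlim[OF this Nlim] eventually_ge_at_top[of 1]
      show ?thesis
      proof eventually_elim
        case (elim j)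
        have j: "(real j)\<^sup>2 > 0" using elim(2) by simp
        have LL0: "LL (N j) > 0" using LLge[of j] j by linarith
        let ?y = "(1 / real (Suc r)) * LL (N j)"
        have y0: "?y > 0" using LL0 by simp
        have "erw_ex (N j) (\<lambda>ys. of_bool (?y \<le> \<bar>qQ h (N j) ys - qm s (N j)\<bar>)) []
          \<le> erw_ex (N j) (\<lambda>ys. (qQ h (N j) ys - qm s (N j))\<^sup>2) [] / ?y\<^sup>2"
          by (rule erw_ex_chebyshev[OF y0]) simp
        also have "\<dots> \<le> (15360 * b ^ 4 * (2 * LL (N j))) / ?y\<^sup>2"
        proof (rule divide_right_mono)
          have "erw_ex (N j) (\<lambda>ys. (qQ h (N j) ys - qm s (N j))\<^sup>2) []
             \<le> 15360 * b ^ 4 * (1 / (2 * ln 2) + ln (ln (real (Suc (N j)))) - ln (ln 2))"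
            unfolding s_def by (rule qQ_variance[OF h N1])
          also have "\<dots> \<le> 15360 * b ^ 4 * (2 * LL (N j))" using elim(1) by (intro mult_left_mono) auto
          finally show "erw_ex (N j) (\<lambda>ys. (qQ h (N j) ys - qm s (N j))\<^sup>2) [] \<le> 15360 * b ^ 4 * (2 * LL (N j))" .
        qed simp
        also have "\<dots> = C * (1 / LL (N j))"
          using LL0 by (simp add: C_def power_divide power2_eq_square)
        also have "\<dots> \<le> C * (1 / (real j)\<^sup>2)"
          using LLge[of j] j LL0 by (intro mult_left_mono divide_left_mono) (auto simp: C_def)
        finally show ?case .
      qed
    qed
    ultimately show ?thesis by (rule path_borel_cantelli)
  qed
  then have "AE \<omega> in M. \<forall>r. eventually (\<lambda>j. \<not> (1 / real (Suc r)) * LL (N j) \<le> \<bar>qQ h (N j) (path (N j) \<omega>) - qm s (N j)\<bar>) sequentially"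
    by (subst AE_all_countable) blast
  then show ?thesis
  proof eventually_elim
    case (elim \<omega>)
    let ?Q = "\<lambda>n. qQ h n (path n \<omega>)"
    have evj: "eventually (\<lambda>j. LL (N j) > 0) sequentially"
      using eventually_ge_at_top[of 1]
    proof eventually_elim
      case (elim j)
      then have "(real j)\<^sup>2 > 0" by simp
      then show ?case using LLge[of j] by linarith
    qed
    have d0: "(\<lambda>j. (?Q (N j) - qm s (N j)) / LL (N j)) \<longlonglongrightarrow> 0"
    proof (rule tendstoI)
      fix e :: real assume "e > 0"
      then obtain r where r: "1 / real (Suc r) < e" using nat_approx_posE by blast
      from elim have "eventually (\<lambda>j. \<not> (1 / real (Suc r)) * LL (N j) \<le> \<bar>?Q (N j) - qm s (N j)\<bar>) sequentially" by blast
      then show "eventually (\<lambda>j. dist ((?Q (N j) - qm s (N j)) / LL (N j)) 0 < e) sequentially"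
        using evj
      proof eventually_elim
        case (elim j)
        have "\<bar>?Q (N j) - qm s (N j)\<bar> < (1 / real (Suc r)) * LL (N j)" using elim(1) by (simp only: not_le)
        then have "\<bar>?Q (N j) - qm s (N j)\<bar> / LL (N j) < 1 / real (Suc r)" using elim(2) by (simp only: pos_divide_less_eq)
        moreover have "\<bar>(?Q (N j) - qm s (N j)) / LL (N j)\<bar> = \<bar>?Q (N j) - qm s (N j)\<bar> / LL (N j)"
          using elim(2) by (simp only: abs_divide abs_of_pos)
        ultimately show ?case using r by (simp only: dist_real_def diff_zero)
      qed
    qed
    have "(\<lambda>j. qm s (N j) / LL (N j)) \<longlonglongrightarrow> s"
      using filterlim_compose[OF qm_ratio[of s] Nlim] by (simp only: LL_def)
    from tendsto_add[OF d0 this] have lim1: "(\<lambda>j. ?Q (N j) / LL (N j)) \<longlonglongrightarrow> s"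
      by (simp add: diff_divide_distrib)
    have lim2: "(\<lambda>j. LL (N (Suc j)) / LL (N j)) \<longlonglongrightarrow> 1"
    proof (rule tendsto_sandwich)
      show "eventually (\<lambda>j. (real (Suc j))\<^sup>2 / ((real j)\<^sup>2 + 1) \<le> LL (N (Suc j)) / LL (N j)) sequentially"
        using evj
      proof eventually_elim
        case (elim j)
        then show ?case using LLge[of "Suc j"] LLle[of j]
          by (intro frac_le) (auto intro: order_trans[OF zero_le_power2] simp del: of_nat_Suc)
      qed
      show "eventually (\<lambda>j. LL (N (Suc j)) / LL (N j) \<le> ((real (Suc j))\<^sup>2 + 1) / (real j)\<^sup>2) sequentially"
        using eventually_ge_at_top[of 1]
      proof eventually_elim
        case (elim j)
        then show ?case using LLge[of j] LLle[of "Suc j"]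
          by (intro frac_le) (auto intro: add_nonneg_nonneg simp del: of_nat_Suc)
      qed
      show "(\<lambda>j. (real (Suc j))\<^sup>2 / ((real j)\<^sup>2 + 1)) \<longlonglongrightarrow> 1" by real_asymp
      show "(\<lambda>j. ((real (Suc j))\<^sup>2 + 1) / (real j)\<^sup>2) \<longlonglongrightarrow> 1" by real_asymp
    qed
    have nonneg: "lw k * qA h (path k \<omega>) \<ge> 0" for k
      using lw_nonneg qA_nonneg[OF h path_in_lists] by (intro mult_nonneg_nonneg)
    have "(\<lambda>n. ?Q n / LL n) \<longlonglongrightarrow> s"
    proof (rule tendsto_ratio_of_subseq[where start=3, OF _ _ _ _ Nlim lim1 lim2])
      show "incseq ?Q" unfolding qQ_path
        by (intro incseq_SucI) (simp add: nonneg)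
      show "0 \<le> ?Q n" for n unfolding qQ_path by (intro sum_nonneg nonneg)
      have ln3: "1 < ln (real n)" if "n \<ge> 3" for n :: nat
      proof -
        have "exp 1 < (3::real)" using e_less_272 by simp
        then have "ln (exp 1) < ln (real n)" using that by (subst ln_less_cancel_iff) auto
        then show ?thesis by simp
      qed
      show "0 < LL n" if "3 \<le> n" for n unfolding LL_def using ln3[OF that] by simp
      show "LL m \<le> LL n" if "3 \<le> m" "m \<le> n" for m n
      proof -
        have "ln (real m) \<le> ln (real n)" using that by (subst ln_le_cancel_iff) auto
        then show ?thesis unfolding LL_def using ln3[OF that(1)] by (subst ln_le_cancel_iff) auto
      qed
    qed
    then show ?case by (simp only: LL_def s_def)
  qed
qed

text \<open>\<open>qA\<close> exceeds the wanted normalized square by the empirical second moment of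
  \<open>h\<close>, which is at most \<open>b^2\<close>; weighted by \<open>lw\<close> it has
  bounded sums and vanishes after division.\<close>

lemma (in erw) AE_hsum_quadratic:
  fixes h :: "real^'d \<Rightarrow> real"
  assumes h: "centered h b"
  shows "AE \<omega> in M. (\<lambda>n. (\<Sum>k\<in>{2..n}. (hsum h (path k \<omega>))\<^sup>2 / (real k * ln (real k))\<^sup>2) / ln (ln (real n)))
     \<longlonglongrightarrow> erw_avg (\<lambda>x. (h x)\<^sup>2)"
  using AE_qQ_ratio[OF h]
proof eventually_elim
  case (elim \<omega>)
  let ?P = "\<lambda>n. \<Sum>k\<in>{2..n}. (hsum h (path k \<omega>))\<^sup>2 / (real k * ln (real k))\<^sup>2"
  define c where "c k = lw k * (hsum (\<lambda>x. (h x)\<^sup>2) (path k \<omega>) / real k)" for k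
  have P: "?P n = qQ h n (path n \<omega>) - (\<Sum>k\<in>{1..n}. c k)" for n
  proof -
    have "?P n = (\<Sum>k\<in>{1..n}. (hsum h (path k \<omega>))\<^sup>2 / (real k * ln (real k))\<^sup>2)"
    proof (rule sum.mono_neutral_left)
      show "\<forall>i\<in>{1..n} - {2..n}. (hsum h (path i \<omega>))\<^sup>2 / (real i * ln (real i))\<^sup>2 = 0"
      proof
        fix i assume "i \<in> {1..n} - {2..n}"
        then have "i = 1" by auto
        then show "(hsum h (path i \<omega>))\<^sup>2 / (real i * ln (real i))\<^sup>2 = 0" by simp
      qed
    qed auto
    also have "\<dots> = (\<Sum>k\<in>{1..n}. lw k * qA h (path k \<omega>) - c k)"
      by (intro sum.cong refl)
         (simp add: c_def qA_def lw_def add_divide_distrib power_mult_distrib power2_eq_square distrib_left mult_ac)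
    finally show ?thesis by (simp add: qQ_path sum_subtractf)
  qed
  have cb: "0 \<le> (\<Sum>k\<in>{1..n}. c k)" "(\<Sum>k\<in>{1..n}. c k) \<le> b\<^sup>2 * (4 / ln 2)" for n
  proof -
    have ck: "0 \<le> c k \<and> c k \<le> b\<^sup>2 * lw k" if "k \<in> {1..n}" for k
    proof -
      have "0 \<le> hsum (\<lambda>x. (h x)\<^sup>2) (path k \<omega>)" "hsum (\<lambda>x. (h x)\<^sup>2) (path k \<omega>) \<le> b\<^sup>2 * real k"
        using hsum_sq_bounds[OF h path_in_lists, of k \<omega>] by auto
      then have "0 \<le> hsum (\<lambda>x. (h x)\<^sup>2) (path k \<omega>) / real k" "hsum (\<lambda>x. (h x)\<^sup>2) (path k \<omega>) / real k \<le> b\<^sup>2"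
        using that by (auto simp: divide_le_eq)
      then show ?thesis unfolding c_def using lw_nonneg[of k]
        by (metis mult.commute mult_left_mono mult_nonneg_nonneg)
    qed
    then show "0 \<le> (\<Sum>k\<in>{1..n}. c k)" by (intro sum_nonneg) auto
    have "(\<Sum>k\<in>{1..n}. c k) \<le> (\<Sum>k\<in>{1..n}. b\<^sup>2 * lw k)" using ck by (intro sum_mono) auto
    also have "\<dots> = b\<^sup>2 * (\<Sum>k\<in>{1..n}. lw k)" by (simp add: sum_distrib_left)
    also have "\<dots> \<le> b\<^sup>2 * (4 / ln 2)"
    proof (rule mult_left_mono)
      have "(\<Sum>k\<in>{1..n}. lw k) \<le> (\<Sum>k\<in>{..<Suc n}. lw k)" by (intro sum_mono2) (auto simp: lw_nonneg)
      then show "(\<Sum>k\<in>{1..n}. lw k) \<le> 4 / ln 2" using lw_sum_le[of "Suc n"] by linarith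
    qed simp
    finally show "(\<Sum>k\<in>{1..n}. c k) \<le> b\<^sup>2 * (4 / ln 2)" .
  qed
  have lpos: "eventually (\<lambda>n::nat. ln (ln (real n)) > 0) sequentially" by real_asymp
  have "(\<lambda>n. (\<Sum>k\<in>{1..n}. c k) / ln (ln (real n))) \<longlonglongrightarrow> 0"
  proof (rule tendsto_sandwich)
    show "eventually (\<lambda>n. 0 \<le> (\<Sum>k\<in>{1..n}. c k) / ln (ln (real n))) sequentially"
      using lpos by eventually_elim (intro divide_nonneg_pos cb)
    show "eventually (\<lambda>n. (\<Sum>k\<in>{1..n}. c k) / ln (ln (real n)) \<le> b\<^sup>2 * (4 / ln 2) / ln (ln (real n))) sequentially"
      using lpos by eventually_elim (intro divide_right_mono cb, simp)
    show "(\<lambda>n::nat. b\<^sup>2 * (4 / ln 2) / ln (ln (real n))) \<longlonglongrightarrow> 0"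
      by (rule real_tendsto_divide_at_top[OF tendsto_const]) real_asymp
  qed simp
  from tendsto_diff[OF elim this] show ?case by (simp add: P diff_divide_distrib)
qed

text \<open>The center of mass splits into a main part \<open>a\<close> and an error
  \<open>d\<close> with summable squares. By Cauchy-Schwarz the cross term is of order
  \<open>sqrt (ln (ln n))\<close> and disappears in the limit.\<close>

lemma (in erw) AE_gsum_quadratic:
  fixes h :: "real^'d \<Rightarrow> real"
  assumes h: "centered h b"
  shows "AE \<omega> in M. (\<lambda>n. (\<Sum>k\<in>{2..n}. (gsum h (path k \<omega>) / real k)\<^sup>2 / (real k * ln (real k))\<^sup>2) / ln (ln (real n)))
     \<longlonglongrightarrow> 4/9 * erw_avg (\<lambda>x. (h x)\<^sup>2)"
  using AE_hsum_quadratic[OF h] AE_summable_gsum_diff[OF h]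
proof eventually_elim
  case (elim \<omega>)
  define s where "s = erw_avg (\<lambda>x. (h x)\<^sup>2)"
  define a where "a k = 2/3 * hsum h (path k \<omega>) / (real k * ln (real k))" for k
  define d where "d k = (gsum h (path k \<omega>) / real k - 2/3 * hsum h (path k \<omega>)) / (real k * ln (real k))" for k
  define L where "L n = ln (ln (real n))" for n :: nat
  define A where "A n = (\<Sum>k\<in>{2..n}. (a k)\<^sup>2)" for n :: nat
  define E where "E n = (\<Sum>k\<in>{2..n}. (d k)\<^sup>2)" for n :: nat
  define C where "C = (\<Sum>k. (d k)\<^sup>2)"
  have lpos: "eventually (\<lambda>n. L n > 0) sequentially" unfolding L_def by real_asymp
  have invL: "(\<lambda>n. c / L n) \<longlonglongrightarrow> 0" for c
    by (rule real_tendsto_divide_at_top[OF tendsto_const]) (unfold L_def, real_asymp)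
  have limA: "(\<lambda>n. A n / L n) \<longlonglongrightarrow> 4/9 * s"
  proof -
    have A: "A n = 4/9 * (\<Sum>k\<in>{2..n}. (hsum h (path k \<omega>))\<^sup>2 / (real k * ln (real k))\<^sup>2)" for n
      unfolding A_def sum_distrib_left a_def by (intro sum.cong refl) (simp add: power_divide power_mult_distrib)
    have "A n / L n = 4/9 * ((\<Sum>k\<in>{2..n}. (hsum h (path k \<omega>))\<^sup>2 / (real k * ln (real k))\<^sup>2) / ln (ln (real n)))" for n
      unfolding A L_def by simp
    moreover have "(\<lambda>n. 4/9 * ((\<Sum>k\<in>{2..n}. (hsum h (path k \<omega>))\<^sup>2 / (real k * ln (real k))\<^sup>2) / ln (ln (real n)))) \<longlonglongrightarrow> 4/9 * s"
      using elim(1) unfolding s_def by (intro tendsto_mult tendsto_const)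
    ultimately show ?thesis by (simp only:)
  qed
  have sd: "summable (\<lambda>k. (d k)\<^sup>2)" using elim(2) by (simp add: d_def power_divide)
  have E0: "0 \<le> E n" and EC: "E n \<le> C" for n
    unfolding E_def C_def by (auto intro!: sum_nonneg sum_le_suminf[OF sd])
  have A0: "0 \<le> A n" for n unfolding A_def by (auto intro!: sum_nonneg)
  have ad: "(\<Sum>k\<in>{2..n}. (gsum h (path k \<omega>) / real k)\<^sup>2 / (real k * ln (real k))\<^sup>2) = A n + (2 * (\<Sum>k\<in>{2..n}. a k * d k) + E n)" for n
  proof -
    have "(gsum h (path k \<omega>) / real k)\<^sup>2 / (real k * ln (real k))\<^sup>2 = (a k)\<^sup>2 + (2 * (a k * d k) + (d k)\<^sup>2)" for k
    proof -
      have "gsum h (path k \<omega>) / real k / (real k * ln (real k)) = a k + d k"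
        unfolding a_def d_def add_divide_distrib[symmetric] by simp
      then have "(gsum h (path k \<omega>) / real k)\<^sup>2 / (real k * ln (real k))\<^sup>2 = (a k + d k)\<^sup>2"
        by (simp only: power_divide[symmetric])
      then show ?thesis by (simp add: power2_sum)
    qed
    then show ?thesis unfolding A_def E_def by (simp add: sum.distrib sum_distrib_left)
  qed
  have "(\<lambda>n. (2 * (\<Sum>k\<in>{2..n}. a k * d k) + E n) / L n) \<longlonglongrightarrow> 0"
  proof (rule Lim_null_comparison)
    show "(\<lambda>n. 2 * (sqrt (A n / L n) * sqrt (C / L n)) + C / L n) \<longlonglongrightarrow> 0"
    proof -
      have "(\<lambda>n. 2 * (sqrt (A n / L n) * sqrt (C / L n)) + C / L n) \<longlonglongrightarrow> 2 * (sqrt (4/9 * s) * sqrt 0) + 0"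
        by (intro tendsto_intros limA invL)
      then show ?thesis by simp
    qed
    show "eventually (\<lambda>n. norm ((2 * (\<Sum>k\<in>{2..n}. a k * d k) + E n) / L n)
        \<le> 2 * (sqrt (A n / L n) * sqrt (C / L n)) + C / L n) sequentially"
      using lpos
    proof eventually_elim
      case (elim n)
      have "(\<Sum>k\<in>{2..n}. a k * d k)\<^sup>2 \<le> A n * E n"
        unfolding A_def E_def by (rule Cauchy_Schwarz_ineq_sum)
      also have "\<dots> \<le> A n * C" using A0 EC by (intro mult_left_mono)
      finally have "\<bar>\<Sum>k\<in>{2..n}. a k * d k\<bar> \<le> sqrt (A n * C)" by (rule real_le_rsqrt[of "\<bar>_\<bar>", simplified])
      then have "\<bar>2 * (\<Sum>k\<in>{2..n}. a k * d k) + E n\<bar> \<le> 2 * sqrt (A n * C) + C"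
        using E0[of n] EC[of n] by linarith
      then have "\<bar>2 * (\<Sum>k\<in>{2..n}. a k * d k) + E n\<bar> / L n \<le> (2 * sqrt (A n * C) + C) / L n"
        using elim by (intro divide_right_mono) auto
      also have "sqrt (A n * C) = sqrt (A n / L n) * sqrt (C / L n) * L n"
      proof -
        have "sqrt (A n / L n) * sqrt (C / L n) * L n = (sqrt (A n) * sqrt C) * (L n / (sqrt (L n) * sqrt (L n)))"
          by (simp add: real_sqrt_divide del: real_sqrt_mult_self)
        also have "L n / (sqrt (L n) * sqrt (L n)) = 1" using elim by simp
        finally show ?thesis by (simp add: real_sqrt_mult)
      qed
      also have "(2 * (sqrt (A n / L n) * sqrt (C / L n) * L n) + C) / L n = 2 * (sqrt (A n / L n) * sqrt (C / L n)) + C / L n"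
        using elim by (simp add: add_divide_distrib)
      finally show ?case using elim by (simp add: abs_divide)
    qed
  qed
  from tendsto_add[OF limA this] show ?case
    unfolding ad by (simp add: add_divide_distrib L_def s_def)
qed

section \<open>Passage to vectors\<close>

definition lil :: "nat \<Rightarrow> real" where
  "lil n = sqrt (2 * real n * ln (real n) * ln (ln (ln (real n))))"

lemma lil_nonneg_ev: "eventually (\<lambda>n. 0 \<le> ln (real n) \<and> 0 \<le> ln (ln (ln (real n))) \<and> 0 < 2 * real n * ln (real n) * ln (ln (ln (real n)))) sequentially"
proof -
  have "eventually (\<lambda>n::nat. 0 < ln (real n)) sequentially" "eventually (\<lambda>n::nat. 0 < ln (ln (ln (real n)))) sequentially"
    "eventually (\<lambda>n::nat. 0 < real n) sequentially"
    by real_asymp+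
  then show ?thesis by eventually_elim auto
qed

text \<open>Extracts \<open>sqrt (alpha_lim / n)\<close>, the asymptotic value of
  \<open>alpha (n - 1)\<close>. On returning from \<open>wsum h alpha\<close> to
  \<open>hsum h\<close> this factor cancels.\<close>

lemma lil_scale:
  assumes "n \<ge> 1" "s \<ge> 0"
  shows "sqrt (2 * (s * alpha_lim) * ln (real n) * ln (ln (ln (real n)))) = sqrt (alpha_lim / real n) * (sqrt s * lil n)"
proof -
  have "2 * (s * alpha_lim) * ln (real n) * ln (ln (ln (real n)))
     = (alpha_lim / real n) * (s * (2 * real n * ln (real n) * ln (ln (ln (real n)))))"
    using assms by simp
  then show ?thesis by (simp only: lil_def real_sqrt_mult)
qed

lemma (in erw) AE_hsum_lil_upper:
  fixes h :: "real^'d \<Rightarrow> real"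
  assumes h: "centered h b" and s: "s = erw_avg (\<lambda>x. (h x)\<^sup>2)" "s > 0" and \<epsilon>: "0 < \<epsilon>"
  shows "AE \<omega> in M. eventually (\<lambda>n. hsum h (path n \<omega>) \<le> (1 + \<epsilon>) * (sqrt s * lil n)) sequentially"
  using lil_upper[OF assms]
proof eventually_elim
  case (elim \<omega>)
  then show ?case using lil_nonneg_ev eventually_ge_at_top[of 1]
  proof eventually_elim
    case (elim n)
    let ?H = "hsum h (path n \<omega>)"
    have n: "real n > 0" using elim(3) by simp
    have l0: "lil n \<ge> 0" unfolding lil_def using elim(2) by simp
    have r0: "0 \<le> (1 + \<epsilon>) * (sqrt s * lil n)" using \<epsilon> s(2) l0 by simp
    \<comment> \<open>The lower bound for \<open>alpha (n - 1)\<close> helps only when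
      \<open>?H\<close> is positive; otherwise the right-hand side is nonnegative anyway.\<close>
    show ?case
    proof (cases "?H \<le> 0")
      case True
      then show ?thesis using r0 by linarith
    next
      case False
      define k where "k = sqrt (alpha_lim / real n)"
      have k0: "k > 0" using n by (simp add: k_def)
      have ne: "path n \<omega> \<noteq> []" using elim(3) length_path[of n \<omega>] by (auto simp del: length_path)
      have ka: "k \<le> alpha (n - 1)"
      proof (rule power2_le_imp_le)
        have "real (n - 1) + 1 = real n" using elim(3) by simp
        then show "k\<^sup>2 \<le> (alpha (n - 1))\<^sup>2" using alpha_sq_ge[of "n - 1"] n by (simp add: k_def less_imp_le)
      qed (use alpha_pos[of "n - 1"] in simp)
      have "k * ?H \<le> alpha (n - 1) * ?H" using ka False by (intro mult_right_mono) auto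
      also have "\<dots> = wsum h alpha (path n \<omega>)" using wsum_alpha[OF ne, of h] by simp
      also have "\<dots> \<le> (1 + \<epsilon>) * (k * (sqrt s * lil n))"
        using elim(1) lil_scale[OF elim(3), of s] s(2) by (simp only: k_def less_imp_le)
      finally have "k * ?H \<le> k * ((1 + \<epsilon>) * (sqrt s * lil n))" by (simp only: mult_ac)
      then show ?thesis using k0 by simp
    qed
  qed
qed

lemma (in erw) AE_hsum_lil_lower:
  fixes h :: "real^'d \<Rightarrow> real"
  assumes h: "centered h b" and s: "s = erw_avg (\<lambda>x. (h x)\<^sup>2)" "s > 0" and \<epsilon>: "0 < \<epsilon>" "\<epsilon> \<le> 1"
  shows "AE \<omega> in M. frequently (\<lambda>n. (1 - 2 * \<epsilon>) * (sqrt s * lil n) \<le> hsum h (path n \<omega>)) sequentially"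
  using lil_lower[OF assms]
proof eventually_elim
  case (elim \<omega>)
  have "eventually (\<lambda>n::nat. 1 / (4 * real n) \<le> \<epsilon>) sequentially" using \<epsilon>(1) by real_asymp
  with lil_nonneg_ev eventually_ge_at_top[of 1]
  have "eventually (\<lambda>n. (1 - \<epsilon>) * sqrt (2 * (s * alpha_lim) * ln (real n) * ln (ln (ln (real n)))) \<le> wsum h alpha (path n \<omega>)
      \<longrightarrow> (1 - 2 * \<epsilon>) * (sqrt s * lil n) \<le> hsum h (path n \<omega>)) sequentially"
  proof eventually_elim
    case (elim n)
    show ?case
    proof
      assume a: "(1 - \<epsilon>) * sqrt (2 * (s * alpha_lim) * ln (real n) * ln (ln (ln (real n)))) \<le> wsum h alpha (path n \<omega>)"
      let ?H = "hsum h (path n \<omega>)"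
      have n: "real n \<ge> 1" using elim(2) by simp
      have l0: "lil n \<ge> 0" unfolding lil_def using elim(1) by simp
      have ne: "path n \<omega> \<noteq> []" using elim(2) length_path[of n \<omega>] by (auto simp del: length_path)
      define y where "y = sqrt s * lil n"
      have y0: "y \<ge> 0" using s(2) l0 by (simp add: y_def)
      define k where "k = sqrt (alpha_lim / real n)"
      \<comment> \<open>\<open>alpha_sq_le\<close> at \<open>n - 1\<close> has denominator
        \<open>n - 1 + 3/4\<close>. One factor \<open>1 - \<epsilon>\<close> absorbs the ratio of
        \<open>k'\<close> to \<open>k\<close>, and the square of \<open>1 - \<epsilon>\<close> is at
        least \<open>1 - 2 * \<epsilon>\<close>.\<close>
      define k' where "k' = sqrt (alpha_lim / (real n - 1/4))"
      have k0: "k > 0" "k' > 0" using n by (auto simp: k_def k'_def)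
      have al: "alpha (n - 1) \<le> k'"
      proof (rule power2_le_imp_le)
        have "real (n - 1) + 3/4 = real n - 1/4" using elim(2) by simp
        then show "(alpha (n - 1))\<^sup>2 \<le> k'\<^sup>2" using alpha_sq_le[of "n - 1"] n by (simp add: k'_def less_imp_le)
      qed (use k0 in simp)
      have w: "wsum h alpha (path n \<omega>) = alpha (n - 1) * ?H" using wsum_alpha[OF ne, of h] by simp
      have a': "(1 - \<epsilon>) * (k * y) \<le> alpha (n - 1) * ?H"
        using a lil_scale[OF elim(2), of s] s(2) unfolding w k_def y_def by (simp only: less_imp_le)
      have H0: "?H \<ge> 0"
      proof -
        have "0 \<le> (1 - \<epsilon>) * (k * y)" using \<epsilon> k0 y0 by simp
        then have "0 \<le> alpha (n - 1) * ?H" using a' by linarith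
        then show ?thesis using alpha_pos[of "n - 1"] by (simp add: zero_le_mult_iff)
      qed
      have kk: "k' * (1 - \<epsilon>) \<le> k"
      proof (rule power2_le_imp_le)
        have e1: "(1 - \<epsilon>) * (1 - \<epsilon>) \<le> 1 * (1 - \<epsilon>)" using \<epsilon> by (intro mult_right_mono) auto
        have e2: "1 - \<epsilon> \<le> (real n - 1/4) / real n" using elim(3) n by (simp add: diff_divide_distrib)
        have "(k' * (1 - \<epsilon>))\<^sup>2 = alpha_lim / (real n - 1/4) * ((1 - \<epsilon>) * (1 - \<epsilon>))"
        proof -
          have "k'\<^sup>2 = alpha_lim / (real n - 1/4)" using n by (simp add: k'_def less_imp_le)
          then show ?thesis by (simp only: power_mult_distrib power2_eq_square[of "1 - \<epsilon>"])
        qed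
        also have "\<dots> \<le> alpha_lim / (real n - 1/4) * ((real n - 1/4) / real n)"
          using e1 e2 n by (intro mult_left_mono) (auto simp: less_imp_le)
        also have "\<dots> = k\<^sup>2" using n by (simp add: k_def less_imp_le)
        finally show "(k' * (1 - \<epsilon>))\<^sup>2 \<le> k\<^sup>2" .
      qed (use k0 in simp)
      have "k' * ((1 - \<epsilon>) * (1 - \<epsilon>) * y) = (1 - \<epsilon>) * ((k' * (1 - \<epsilon>)) * y)" by simp
      also have "\<dots> \<le> (1 - \<epsilon>) * (k * y)" using kk \<epsilon> y0 by (intro mult_left_mono mult_right_mono) auto
      also have "\<dots> \<le> k' * ?H" using a' mult_right_mono[OF al H0] by linarith
      finally have "(1 - \<epsilon>) * (1 - \<epsilon>) * y \<le> ?H" using k0 by simp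
      moreover have "(1 - 2 * \<epsilon>) * y \<le> (1 - \<epsilon>) * (1 - \<epsilon>) * y"
        using y0 by (intro mult_right_mono) (simp_all add: algebra_simps)
      ultimately show "(1 - 2 * \<epsilon>) * (sqrt s * lil n) \<le> ?H" unfolding y_def by linarith
    qed
  qed
  with elim show ?case by (rule frequently_rev_mp)
qed


text \<open>The quotient of the two scales is \<open>sqrt (2 * ln (ln (ln n)))\<close>, which
  diverges; this makes the error in \<open>AE_gsum_diff\<close> negligible.\<close>

lemma lil_dominates:
  assumes "\<epsilon> > 0"
  shows "eventually (\<lambda>n. C * sqrt (real n * ln (real n)) \<le> \<epsilon> * lil n) sequentially"
proof -
  have "eventually (\<lambda>n::nat. C \<le> \<epsilon> * sqrt (2 * ln (ln (ln (real n))))) sequentially"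
    using assms by real_asymp
  then show ?thesis using lil_nonneg_ev
  proof eventually_elim
    case (elim n)
    have "C * sqrt (real n * ln (real n)) \<le> \<epsilon> * sqrt (2 * ln (ln (ln (real n)))) * sqrt (real n * ln (real n))"
      using elim by (intro mult_right_mono) auto
    also have "\<dots> = \<epsilon> * sqrt ((2 * ln (ln (ln (real n)))) * (real n * ln (real n)))"
      by (simp only: real_sqrt_mult mult.assoc)
    also have "(2 * ln (ln (ln (real n)))) * (real n * ln (real n)) = 2 * real n * ln (real n) * ln (ln (ln (real n)))"
      by simp
    finally show ?case by (simp only: lil_def)
  qed
qed

lemma (in erw) AE_gsum_lil_upper:
  fixes h :: "real^'d \<Rightarrow> real"
  assumes h: "centered h b" and s: "s = erw_avg (\<lambda>x. (h x)\<^sup>2)" "s > 0" and \<epsilon>: "0 < \<epsilon>"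
  shows "AE \<omega> in M. eventually (\<lambda>n. gsum h (path n \<omega>) / real n \<le> (2/3 * sqrt s + \<epsilon>) * lil n) sequentially"
proof -
  have sq: "sqrt s > 0" using s(2) by simp
  define r where "r = sqrt s + 1"
  have r: "r > 0" "sqrt s \<le> r" using sq unfolding r_def by linarith+
  define e where "e = \<epsilon> / (2 * r)"
  have e0: "e > 0" using \<epsilon> r by (simp add: e_def)
  have es: "e * sqrt s \<le> \<epsilon> / 2"
  proof -
    have "e * sqrt s \<le> e * r" using e0 r by (intro mult_left_mono) auto
    also have "\<dots> = \<epsilon> / 2" using r by (simp add: e_def)
    finally show ?thesis .
  qed
  show ?thesis using AE_hsum_lil_upper[OF h s e0] AE_gsum_diff[OF h]
  proof eventually_elim
    case (elim \<omega>)
    have "eventually (\<lambda>n. (6 * b\<^sup>2 + b + 2) * sqrt (real n * ln (real n)) \<le> \<epsilon> / 2 * lil n) sequentially"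
      using \<epsilon> by (intro lil_dominates) simp
    with elim show ?case using lil_nonneg_ev
    proof eventually_elim
      case (elim n)
      have l0: "lil n \<ge> 0" unfolding lil_def using elim(4) by simp
      have "gsum h (path n \<omega>) / real n \<le> 2/3 * hsum h (path n \<omega>) + \<epsilon> / 2 * lil n"
        using elim(2,3) by linarith
      also have "\<dots> \<le> 2/3 * ((1 + e) * (sqrt s * lil n)) + \<epsilon> / 2 * lil n" using elim(1) by simp
      also have "\<dots> = (2/3 * sqrt s + 2/3 * (e * sqrt s) + \<epsilon> / 2) * lil n" by (simp add: algebra_simps)
      also have "\<dots> \<le> (2/3 * sqrt s + \<epsilon>) * lil n"
      proof (rule mult_right_mono[OF _ l0])
        have "0 \<le> e * sqrt s" using e0 sq by simp
        then show "2/3 * sqrt s + 2/3 * (e * sqrt s) + \<epsilon> / 2 \<le> 2/3 * sqrt s + \<epsilon>" using es \<epsilon> by linarith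
      qed
      finally show ?case .
    qed
  qed
qed

lemma (in erw) AE_gsum_lil_lower:
  fixes h :: "real^'d \<Rightarrow> real"
  assumes h: "centered h b" and s: "s = erw_avg (\<lambda>x. (h x)\<^sup>2)" "s > 0" and \<epsilon>: "0 < \<epsilon>"
  shows "AE \<omega> in M. frequently (\<lambda>n. (2/3 * sqrt s - \<epsilon>) * lil n \<le> gsum h (path n \<omega>) / real n) sequentially"
proof -
  have sq: "sqrt s > 0" using s(2) by simp
  define r where "r = sqrt s + 1"
  have r: "r > 0" "sqrt s \<le> r" using sq unfolding r_def by linarith+
  define e where "e = min 1 (\<epsilon> / (4 * r))"
  have "\<epsilon> / (4 * r) > 0" using \<epsilon> r by simp
  then have e0: "e > 0" "e \<le> 1" unfolding e_def by auto
  have es: "e * sqrt s \<le> \<epsilon> / 4"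
  proof -
    have "e * sqrt s \<le> (\<epsilon> / (4 * r)) * r"
      using e0 sq \<epsilon> r by (intro mult_mono) (auto simp: e_def)
    also have "\<dots> = \<epsilon> / 4" using r by simp
    finally show ?thesis .
  qed
  show ?thesis using AE_hsum_lil_lower[OF h s e0] AE_gsum_diff[OF h]
  proof eventually_elim
    case (elim \<omega>)
    have "eventually (\<lambda>n. (6 * b\<^sup>2 + b + 2) * sqrt (real n * ln (real n)) \<le> \<epsilon> / 2 * lil n) sequentially"
      using \<epsilon> by (intro lil_dominates) simp
    with elim(2) lil_nonneg_ev
    have "eventually (\<lambda>n. (1 - 2 * e) * (sqrt s * lil n) \<le> hsum h (path n \<omega>)
        \<longrightarrow> (2/3 * sqrt s - \<epsilon>) * lil n \<le> gsum h (path n \<omega>) / real n) sequentially"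
    proof eventually_elim
      case (elim n)
      show ?case
      proof
        assume a: "(1 - 2 * e) * (sqrt s * lil n) \<le> hsum h (path n \<omega>)"
        have l0: "lil n \<ge> 0" unfolding lil_def using elim(2) by simp
        have "(2/3 * sqrt s - \<epsilon>) * lil n \<le> (2/3 * sqrt s - 4/3 * (e * sqrt s) - \<epsilon> / 2) * lil n"
        proof (rule mult_right_mono[OF _ l0])
          show "2/3 * sqrt s - \<epsilon> \<le> 2/3 * sqrt s - 4/3 * (e * sqrt s) - \<epsilon> / 2" using es \<epsilon> by linarith
        qed
        also have "\<dots> = 2/3 * ((1 - 2 * e) * (sqrt s * lil n)) - \<epsilon> / 2 * lil n" by (simp add: algebra_simps)
        also have "\<dots> \<le> 2/3 * hsum h (path n \<omega>) - \<epsilon> / 2 * lil n" using a by linarith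
        also have "\<dots> \<le> gsum h (path n \<omega>) / real n" using elim(1,3) by linarith
        finally show "(2/3 * sqrt s - \<epsilon>) * lil n \<le> gsum h (path n \<omega>) / real n" .
      qed
    qed
    with elim(1) show ?case by (rule frequently_rev_mp)
  qed
qed

section \<open>Linear functionals, finite nets and polarization\<close>

lemma erw_avg_inner: "erw_avg (\<lambda>x. u \<bullet> x) = 0"
  by (simp add: erw_avg_def sum_erw_dirs inner_axis)

text \<open>Isotropy of the directions, and the source of the factor \<open>1/d\<close> in the
  limits.\<close>

lemma erw_avg_inner_square: "erw_avg (\<lambda>x. (u \<bullet> x)\<^sup>2) = (norm (u :: real^'d))\<^sup>2 / real CARD('d)"
proof -
  have "(norm u)\<^sup>2 = (\<Sum>i\<in>UNIV. (u $ i)\<^sup>2)"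
    unfolding power2_norm_eq_inner inner_vec_def by (simp add: power2_eq_square)
  then show ?thesis
    by (simp add: erw_avg_def sum_erw_dirs inner_axis mult_2[symmetric] sum_distrib_left[symmetric])
qed

text \<open>The \<open>+ 1\<close> keeps the bound positive for \<open>u = 0\<close>, a vector that
  occurs in the polarization when \<open>i = j\<close>.\<close>

lemma centered_inner: "centered (\<lambda>x. u \<bullet> x) (norm u + 1)"
proof -
  have "\<bar>u \<bullet> x\<bar> \<le> norm u + 1" if "x \<in> erw_dirs" for x
  proof -
    have "norm x = 1" using that by (auto simp: erw_dirs_def norm_eq_1 inner_axis_axis)
    then show ?thesis using Cauchy_Schwarz_ineq2[of u x] by simp
  qed
  then show ?thesis by (simp add: centered_def erw_avg_inner add_nonneg_pos)
qed

lemma (in erw) hsum_inner: "hsum (\<lambda>x. u \<bullet> x) (path n \<omega>) = u \<bullet> erw_S Xd n \<omega>"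
  by (induction n) (simp_all add: path_Suc erw_S_def inner_add_right)

lemma (in erw) gsum_inner: "gsum (\<lambda>x. u \<bullet> x) (path n \<omega>) / real n = u \<bullet> erw_G Xd n \<omega>"
proof -
  have "gsum (\<lambda>x. u \<bullet> x) (path n \<omega>) = (\<Sum>k\<in>{1..n}. u \<bullet> erw_S Xd k \<omega>)"
    unfolding gsum_def by (intro sum.cong) (auto simp: take_path hsum_inner)
  then show ?thesis by (simp add: erw_G_def inner_sum_right)
qed

text \<open>The exceptional set and the starting index of the scalar law depend on the direction.
  Compactness reduces the norm to finitely many directions, for which both can be chosen in
  common.\<close>

lemma sphere_net:
  assumes "0 < \<eta>"
  shows "\<exists>U. finite U \<and> (\<forall>u\<in>U. norm u = 1) \<and> (\<forall>v :: real^'d. \<exists>u\<in>U. (1 - \<eta>) * norm v \<le> u \<bullet> v)"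
proof -
  have "compact (sphere (0 :: real^'d) 1)" by simp
  moreover have "sphere (0 :: real^'d) 1 \<subseteq> (\<Union>u\<in>sphere 0 1. ball u \<eta>)" using assms by auto
  ultimately obtain U where U: "U \<subseteq> sphere (0 :: real^'d) 1" "finite U" "sphere 0 1 \<subseteq> (\<Union>u\<in>U. ball u \<eta>)"
    using compactE_image[of "sphere (0 :: real^'d) 1" "sphere 0 1" "\<lambda>u. ball u \<eta>"] by auto
  have unit: "\<exists>u\<in>U. 1 - \<eta> \<le> u \<bullet> w" if "norm w = 1" for w
  proof -
    obtain u where u: "u \<in> U" "dist u w < \<eta>" using U(3) \<open>norm w = 1\<close> by auto
    have "1 - u \<bullet> w = (w - u) \<bullet> w" using that by (simp add: inner_diff_left dot_square_norm)
    also have "\<dots> \<le> norm (w - u) * norm w" by (rule norm_cauchy_schwarz)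
    also have "\<dots> \<le> \<eta>" using u that by (simp add: dist_norm norm_minus_commute)
    finally show ?thesis using u by (intro bexI[of _ u]) auto
  qed
  have "\<exists>u\<in>U. (1 - \<eta>) * norm v \<le> u \<bullet> v" for v :: "real^'d"
  proof (cases "v = 0")
    case True
    obtain u where "u \<in> U" using unit[of "axis undefined 1"] by auto
    then show ?thesis using True by auto
  next
    case False
    then have nv: "norm v > 0" by simp
    obtain u where u: "u \<in> U" "1 - \<eta> \<le> u \<bullet> ((1 / norm v) *\<^sub>R v)"
      using unit[of "(1 / norm v) *\<^sub>R v"] nv by auto
    then have "(1 - \<eta>) * norm v \<le> u \<bullet> v" using nv by (simp add: field_simps)
    then show ?thesis using u by blast
  qed
  then show ?thesis using U by (intro exI[of _ U]) auto
qed

lemma limsup_ereal_eqI: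
  fixes f :: "nat \<Rightarrow> real"
  assumes "\<And>e. e > 0 \<Longrightarrow> eventually (\<lambda>n. f n \<le> l + e) sequentially"
    and "\<And>e. e > 0 \<Longrightarrow> frequently (\<lambda>n. l - e \<le> f n) sequentially"
  shows "limsup (\<lambda>n. ereal (f n)) = ereal l"
proof (rule antisym)
  show "limsup (\<lambda>n. ereal (f n)) \<le> ereal l"
  proof (rule ereal_le_epsilon2)
    fix e :: real assume "0 < e"
    from assms(1)[OF this] have "eventually (\<lambda>n. ereal (f n) \<le> ereal (l + e)) sequentially" by simp
    then show "limsup (\<lambda>n. ereal (f n)) \<le> ereal l + ereal e" by (simp add: Limsup_bounded)
  qed
  show "ereal l \<le> limsup (\<lambda>n. ereal (f n))"
  proof (rule ereal_le_epsilon2)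
    fix e :: real assume "0 < e"
    have "ereal (l - e) \<le> limsup (\<lambda>n. ereal (f n))"
    proof (rule ccontr)
      assume "\<not> ereal (l - e) \<le> limsup (\<lambda>n. ereal (f n))"
      then have "eventually (\<lambda>n. ereal (f n) < ereal (l - e)) sequentially" by (intro Limsup_lessD) simp
      then have "eventually (\<lambda>n. \<not> l - e \<le> f n) sequentially" by eventually_elim simp
      then show False using assms(2)[OF \<open>0 < e\<close>] by (simp add: frequently_def)
    qed
    then have "ereal (l - e) + ereal e \<le> limsup (\<lambda>n. ereal (f n)) + ereal e" by (intro add_right_mono)
    then show "ereal l \<le> limsup (\<lambda>n. ereal (f n)) + ereal e" by simp
  qed
qed

lemma (in erw) AE_G_quadratic:
  "AE \<omega> in M. \<forall>i\<in>UNIV. \<forall>j\<in>UNIV. (\<lambda>n. (\<Sum>k\<in>{2..n}. (erw_G Xd k \<omega> $ i) * (erw_G Xd k \<omega> $ j) / (real k * ln (real k))\<^sup>2)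
       / ln (ln (real n))) \<longlonglongrightarrow> 4 / (9 * real CARD('d)) * (if i = j then 1 else 0)"
proof (subst AE_finite_all, simp, intro ballI, subst AE_finite_all, simp, intro ballI)
  fix i j :: 'd
  define u where "u = (axis i 1 + axis j 1 :: real^'d)"
  define v where "v = (axis i 1 - axis j 1 :: real^'d)"
  let ?q = "\<lambda>u \<omega> n. (\<Sum>k\<in>{2..n}. (u \<bullet> erw_G Xd k \<omega>)\<^sup>2 / (real k * ln (real k))\<^sup>2) / ln (ln (real n))"
  have lim: "AE \<omega> in M. ?q w \<omega> \<longlonglongrightarrow> 4/9 * ((norm w)\<^sup>2 / real CARD('d))" for w
    using AE_gsum_quadratic[OF centered_inner[of w]] by (simp only: gsum_inner erw_avg_inner_square)
  show "AE \<omega> in M. (\<lambda>n. (\<Sum>k\<in>{2..n}. (erw_G Xd k \<omega> $ i) * (erw_G Xd k \<omega> $ j) / (real k * ln (real k))\<^sup>2)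
       / ln (ln (real n))) \<longlonglongrightarrow> 4 / (9 * real CARD('d)) * (if i = j then 1 else 0)"
    using lim[of u] lim[of v]
  proof eventually_elim
    case (elim \<omega>)
    have "(\<lambda>n. (?q u \<omega> n - ?q v \<omega> n) / 4)
        \<longlonglongrightarrow> (4/9 * ((norm u)\<^sup>2 / real CARD('d)) - 4/9 * ((norm v)\<^sup>2 / real CARD('d))) / 4"
      by (intro tendsto_intros elim) auto
    moreover have "(?q u \<omega> n - ?q v \<omega> n) / 4
       = (\<Sum>k\<in>{2..n}. (erw_G Xd k \<omega> $ i) * (erw_G Xd k \<omega> $ j) / (real k * ln (real k))\<^sup>2) / ln (ln (real n))" for n
    proof -
      have "x * y / c = ((x + y)\<^sup>2 / c - (x - y)\<^sup>2 / c) / 4" for x y c :: real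
        by (simp add: diff_divide_distrib[symmetric] power2_eq_square algebra_simps)
      then have "(\<Sum>k\<in>{2..n}. (erw_G Xd k \<omega> $ i) * (erw_G Xd k \<omega> $ j) / (real k * ln (real k))\<^sup>2)
        = (\<Sum>k\<in>{2..n}. ((u \<bullet> erw_G Xd k \<omega>)\<^sup>2 / (real k * ln (real k))\<^sup>2 - (v \<bullet> erw_G Xd k \<omega>)\<^sup>2 / (real k * ln (real k))\<^sup>2) / 4)"
        by (simp only: u_def v_def inner_add_left inner_diff_left cart_eq_inner_axis inner_commute[of "axis _ _"])
      also have "\<dots> = ((\<Sum>k\<in>{2..n}. (u \<bullet> erw_G Xd k \<omega>)\<^sup>2 / (real k * ln (real k))\<^sup>2)
          - (\<Sum>k\<in>{2..n}. (v \<bullet> erw_G Xd k \<omega>)\<^sup>2 / (real k * ln (real k))\<^sup>2)) / 4"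
        by (simp only: sum_divide_distrib[symmetric] sum_subtractf)
      finally show ?thesis by (simp only: diff_divide_distrib) simp
    qed
    moreover have "(4/9 * ((norm u)\<^sup>2 / real CARD('d)) - 4/9 * ((norm v)\<^sup>2 / real CARD('d))) / 4
       = 4 / (9 * real CARD('d)) * (if i = j then 1 else 0)"
    proof -
      have "(norm u)\<^sup>2 - (norm v)\<^sup>2 = 4 * (axis i 1 \<bullet> (axis j 1 :: real^'d))"
        unfolding power2_norm_eq_inner u_def v_def
        by (simp add: inner_add_left inner_diff_left inner_add_right inner_diff_right inner_commute)
      also have "\<dots> = 4 * (if i = j then 1 else 0)" by (simp add: inner_axis_axis)
      finally have "(norm u)\<^sup>2 - (norm v)\<^sup>2 = 4 * (if i = j then 1 else 0)" .
      moreover have "(4/9 * ((norm u)\<^sup>2 / real CARD('d)) - 4/9 * ((norm v)\<^sup>2 / real CARD('d))) / 4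
         = ((norm u)\<^sup>2 - (norm v)\<^sup>2) / (9 * real CARD('d))"
        by (simp add: diff_divide_distrib)
      ultimately show ?thesis by simp
    qed
    ultimately show ?case by (simp only:)
  qed
qed

lemma (in erw) AE_norm_G_upper:
  assumes "\<epsilon> > 0"
  shows "AE \<omega> in M. eventually (\<lambda>n. norm (erw_G Xd n \<omega>) \<le> (2 / 3 * sqrt (1 / real CARD('d)) + \<epsilon>) * lil n) sequentially"
proof -
  define a where "a = 2 / 3 * sqrt (1 / real CARD('d))"
  have a0: "a > 0" by (simp add: a_def)
  \<comment> \<open>Solves
    \<open>(1 - \<eta>) * (a + \<epsilon>) = a + \<epsilon> / 2\<close>.\<close>
  define \<eta> where "\<eta> = \<epsilon> / (2 * (a + \<epsilon>))"
  have \<eta>0: "\<eta> > 0" using assms a0 by (simp add: \<eta>_def)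
  have \<eta>a: "\<eta> * (a + \<epsilon>) = \<epsilon> / 2"
  proof -
    have "a + \<epsilon> \<noteq> 0" using assms a0 by linarith
    then show ?thesis by (simp add: \<eta>_def divide_simps)
  qed
  have \<eta>1: "\<eta> < 1"
  proof (rule ccontr)
    assume "\<not> \<eta> < 1"
    then have "1 * (a + \<epsilon>) \<le> \<eta> * (a + \<epsilon>)" using assms a0 by (intro mult_right_mono) auto
    then have "a + \<epsilon> \<le> \<epsilon> / 2" by (simp only: \<eta>a mult_1_left)
    then show False using assms a0 by linarith
  qed
  obtain U where U: "finite U" "\<And>u. u \<in> U \<Longrightarrow> norm u = 1"
     "\<And>v :: real^'d. \<exists>u\<in>U. (1 - \<eta>) * norm v \<le> u \<bullet> v"
    using sphere_net[OF \<eta>0, where 'd='d] by auto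
  have "AE \<omega> in M. eventually (\<lambda>n. u \<bullet> erw_G Xd n \<omega> \<le> (a + \<epsilon> / 2) * lil n) sequentially" if "u \<in> U" for u
  proof -
    have "1 / real CARD('d) = erw_avg (\<lambda>x. (u \<bullet> x)\<^sup>2)" using U(2)[OF that] by (simp add: erw_avg_inner_square)
    from AE_gsum_lil_upper[OF centered_inner this, of "\<epsilon> / 2"] show ?thesis
      using assms by (simp add: gsum_inner a_def)
  qed
  then have "AE \<omega> in M. \<forall>u\<in>U. eventually (\<lambda>n. u \<bullet> erw_G Xd n \<omega> \<le> (a + \<epsilon> / 2) * lil n) sequentially"
    using U(1) by (subst AE_finite_all) auto
  then show ?thesis
  proof eventually_elim
    case (elim \<omega>)
    then have "eventually (\<lambda>n. \<forall>u\<in>U. u \<bullet> erw_G Xd n \<omega> \<le> (a + \<epsilon> / 2) * lil n) sequentially"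
      using U(1) by (simp add: eventually_ball_finite)
    then show ?case using lil_nonneg_ev
    proof eventually_elim
      case (elim n)
      have l0: "lil n \<ge> 0" unfolding lil_def using elim(2) by simp
      obtain u where u: "u \<in> U" "(1 - \<eta>) * norm (erw_G Xd n \<omega>) \<le> u \<bullet> erw_G Xd n \<omega>" using U(3) by blast
      then have "(1 - \<eta>) * norm (erw_G Xd n \<omega>) \<le> (a + \<epsilon> / 2) * lil n" using elim(1) by force
      also have "\<dots> = (1 - \<eta>) * ((a + \<epsilon>) * lil n)"
      proof -
        have "a + \<epsilon> / 2 = (1 - \<eta>) * (a + \<epsilon>)" using \<eta>a by (simp add: left_diff_distrib)
        then show ?thesis by (simp only: mult.assoc)
      qed
      finally have "norm (erw_G Xd n \<omega>) \<le> (a + \<epsilon>) * lil n" using \<eta>1 by simp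
      then show ?case by (simp add: a_def)
    qed
  qed
qed

text \<open>A single unit vector suffices, since the norm dominates its inner product and by
  isotropy every direction has the same constant.\<close>

lemma (in erw) AE_norm_G_lower:
  assumes "\<epsilon> > 0"
  shows "AE \<omega> in M. frequently (\<lambda>n. (2 / 3 * sqrt (1 / real CARD('d)) - \<epsilon>) * lil n \<le> norm (erw_G Xd n \<omega>)) sequentially"
proof -
  define u where "u = (axis undefined 1 :: real^'d)"
  have u: "norm u = 1" by (simp add: u_def)
  have "1 / real CARD('d) = erw_avg (\<lambda>x. (u \<bullet> x)\<^sup>2)" using u by (simp add: erw_avg_inner_square)
  from AE_gsum_lil_lower[OF centered_inner this _ assms]
  have "AE \<omega> in M. frequently (\<lambda>n. (2 / 3 * sqrt (1 / real CARD('d)) - \<epsilon>) * lil n \<le> u \<bullet> erw_G Xd n \<omega>) sequentially"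
    by (simp add: gsum_inner)
  then show ?thesis
  proof eventually_elim
    case (elim \<omega>)
    have "u \<bullet> erw_G Xd n \<omega> \<le> norm (erw_G Xd n \<omega>)" for n
      using norm_cauchy_schwarz[of u "erw_G Xd n \<omega>"] u by simp
    with elim show ?case by (auto elim!: frequently_mono[rotated] intro: order_trans)
  qed
qed

lemma (in erw) AE_limsup_G:
  "AE \<omega> in M. limsup (\<lambda>n. ereal ((norm (erw_G Xd n \<omega>))\<^sup>2 / (2 * real n * ln (real n) * ln (ln (ln (real n))))))
     = ereal (4 / (9 * real CARD('d)))"
proof -
  define a where "a = 2 / 3 * sqrt (1 / real CARD('d))"
  have a0: "a > 0" by (simp add: a_def)
  have d1: "real CARD('d) \<ge> 1" by (simp add: Suc_le_eq)
  have a1: "a \<le> 1"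
  proof -
    have "sqrt (1 / real CARD('d)) \<le> 1" using d1 by (simp add: divide_le_eq)
    then show ?thesis unfolding a_def by linarith
  qed
  have a2: "a\<^sup>2 = 4 / (9 * real CARD('d))" using d1 by (simp add: a_def power_mult_distrib power_divide)
  have "AE \<omega> in M. \<forall>m. eventually (\<lambda>n. norm (erw_G Xd n \<omega>) \<le> (a + 1 / real (Suc m)) * lil n) sequentially"
    unfolding a_def by (subst AE_all_countable) (intro allI AE_norm_G_upper, simp)
  moreover have "AE \<omega> in M. \<forall>m. frequently (\<lambda>n. (a - 1 / real (Suc m)) * lil n \<le> norm (erw_G Xd n \<omega>)) sequentially"
    unfolding a_def by (subst AE_all_countable) (intro allI AE_norm_G_lower, simp)
  ultimately show ?thesis
  proof eventually_elim
    case (elim \<omega>)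
    let ?g = "\<lambda>n. norm (erw_G Xd n \<omega>)"
    let ?l = "\<lambda>n. 2 * real n * ln (real n) * ln (ln (ln (real n)))"
    have lil2: "eventually (\<lambda>n. 0 < lil n \<and> (lil n)\<^sup>2 = ?l n) sequentially"
      using lil_nonneg_ev by eventually_elim (simp add: lil_def)
    have "limsup (\<lambda>n. ereal ((?g n)\<^sup>2 / ?l n)) = ereal (a\<^sup>2)"
    proof (rule limsup_ereal_eqI)
      fix e :: real assume e: "e > 0"
      \<comment> \<open>As \<open>a \<le> 1\<close> and the increment is below one, squaring
        \<open>a\<close> plus the increment adds at most three times the increment.\<close>
      obtain m where m: "1 / real (Suc m) < min 1 (e / 3)" using nat_approx_posE[of "min 1 (e / 3)"] e by auto
      let ?d = "1 / real (Suc m)"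
      have d0: "?d > 0" by simp
      show "eventually (\<lambda>n. (?g n)\<^sup>2 / ?l n \<le> a\<^sup>2 + e) sequentially"
        using elim(1)[rule_format, of m] lil2
      proof eventually_elim
        case (elim n)
        have "(?g n)\<^sup>2 \<le> ((a + ?d) * lil n)\<^sup>2" using elim(1) by (intro power_mono) auto
        also have "\<dots> = (a + ?d)\<^sup>2 * ?l n" using elim(2) by (simp only: power_mult_distrib)
        finally have "(?g n)\<^sup>2 / ?l n \<le> (a + ?d)\<^sup>2"
          using elim(2) by (subst pos_divide_le_eq) (metis zero_less_power)+
        also have "(a + ?d)\<^sup>2 = a\<^sup>2 + 2 * (a * ?d) + ?d * ?d" unfolding power2_eq_square by (simp only: distrib_left distrib_right mult_2 mult.commute add_ac)
        also have "\<dots> \<le> a\<^sup>2 + 2 * ?d + ?d"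
        proof -
          have "a * ?d \<le> 1 * ?d" using a1 d0 by (intro mult_right_mono) auto
          moreover have "?d * ?d \<le> 1 * ?d" using m d0 by (intro mult_right_mono) auto
          ultimately show ?thesis by linarith
        qed
        also have "\<dots> \<le> a\<^sup>2 + e" using m by linarith
        finally show ?case .
      qed
    next
      fix e :: real assume e: "e > 0"
      \<comment> \<open>Staying below \<open>a\<close> keeps the lower bound nonnegative, so that it
        may be squared.\<close>
      obtain m where m: "1 / real (Suc m) < min a (e / 2)" using nat_approx_posE[of "min a (e / 2)"] e a0 by auto
      let ?d = "1 / real (Suc m)"
      have d0: "?d > 0" by simp
      have "eventually (\<lambda>n. (a - ?d) * lil n \<le> ?g n \<longrightarrow> a\<^sup>2 - e \<le> (?g n)\<^sup>2 / ?l n) sequentially"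
        using lil2
      proof eventually_elim
        case (elim n)
        show ?case
        proof
          assume g: "(a - ?d) * lil n \<le> ?g n"
          have "a * ?d \<le> 1 * ?d" using a1 d0 by (intro mult_right_mono) auto
          moreover have "(a - ?d)\<^sup>2 = a\<^sup>2 - 2 * (a * ?d) + ?d\<^sup>2" by (simp only: power2_diff mult.assoc)
          moreover have "?d\<^sup>2 \<ge> 0" by simp
          ultimately have "a\<^sup>2 - e \<le> (a - ?d)\<^sup>2" using m by linarith
          also have "(a - ?d)\<^sup>2 \<le> (?g n)\<^sup>2 / ?l n"
          proof -
            have ad: "a - ?d \<ge> 0" using m by linarith
            have l0: "?l n > 0" using elim by (metis zero_less_power)
            have "(a - ?d)\<^sup>2 * ?l n = ((a - ?d) * lil n)\<^sup>2" using elim by (simp only: power_mult_distrib)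
            also have "\<dots> \<le> (?g n)\<^sup>2" using g ad elim by (intro power_mono mult_nonneg_nonneg) auto
            finally show ?thesis using l0 by (subst pos_le_divide_eq)
          qed
          finally show "a\<^sup>2 - e \<le> (?g n)\<^sup>2 / ?l n" .
        qed
      qed
      with elim(2)[rule_format, of m] show "frequently (\<lambda>n. a\<^sup>2 - e \<le> (?g n)\<^sup>2 / ?l n) sequentially"
        by (rule frequently_rev_mp)
    qed
    then show ?case unfolding a2 .
  qed
qed

theorem theorem2p5:
  fixes M :: "'a measure" and X :: "nat \<Rightarrow> 'a \<Rightarrow> real^'d"
  assumes "prob_space M"
    and "\<And>k. X k \<in> borel_measurable M"
    and "\<And>n xs. measure M {\<omega> \<in> space M. map (\<lambda>k. X k \<omega>) [1..<n+1] = xs}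
           = pmf (erw_path ((2 * real CARD('d) + 1) / (4 * real CARD('d))) n) xs"
  shows "AE \<omega> in M.
     ((\<lambda>n. (1 / ln (ln (real n))) *\<^sub>R
          (\<Sum>k\<in>{2..n}. (1 / (real k * ln (real k))^2) *\<^sub>R outer (erw_G X k \<omega>)))
        \<longlonglongrightarrow> (4 / (9 * real CARD('d))) *\<^sub>R mat 1)
   \<and> ((\<lambda>n. (1 / ln (ln (real n))) *
          (\<Sum>k\<in>{2..n}. norm (erw_G X k \<omega>)^2 / (real k * ln (real k))^2))
        \<longlonglongrightarrow> 4 / 9)
   \<and> limsup (\<lambda>n. ereal (norm (erw_G X n \<omega>)^2 /
          (2 * real n * ln (real n) * ln (ln (ln (real n))))))
        = ereal (4 / (9 * real CARD('d)))"
proof -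
  interpret prob_space M by (rule assms(1))
  interpret erw M X by unfold_locales (rule assms(2), rule assms(3))
  show ?thesis
    using AE_Xd_eq AE_G_quadratic AE_limsup_G
  proof eventually_elim
    case (elim \<omega>)
    have S: "erw_S X n \<omega> = erw_S Xd n \<omega>" for n
      unfolding erw_S_def using elim(1) by (intro sum.cong) auto
    have G: "erw_G X n \<omega> = erw_G Xd n \<omega>" for n
      unfolding erw_G_def S ..
    let ?G = "\<lambda>n. erw_G Xd n \<omega>"
    let ?d = "real CARD('d)"
    have lim: "(\<lambda>n. (\<Sum>k\<in>{2..n}. (?G k $ i) * (?G k $ j) / (real k * ln (real k))\<^sup>2) / ln (ln (real n)))
        \<longlonglongrightarrow> 4 / (9 * ?d) * (if i = j then 1 else 0)" for i j
      using elim(2) by blast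
    have 1: "(\<lambda>n. (1 / ln (ln (real n))) *\<^sub>R
          (\<Sum>k\<in>{2..n}. (1 / (real k * ln (real k))^2) *\<^sub>R outer (?G k)))
        \<longlonglongrightarrow> (4 / (9 * ?d)) *\<^sub>R mat 1"
    proof (rule vec_tendstoI, rule vec_tendstoI)
      fix i j
      show "(\<lambda>n. ((1 / ln (ln (real n))) *\<^sub>R
          (\<Sum>k\<in>{2..n}. (1 / (real k * ln (real k))^2) *\<^sub>R outer (?G k))) $ i $ j)
        \<longlonglongrightarrow> ((4 / (9 * ?d)) *\<^sub>R mat 1 :: real^'d^'d) $ i $ j"
        using lim[of i j] by (simp add: outer_def mat_def)
    qed
    have 2: "(\<lambda>n. (1 / ln (ln (real n))) * (\<Sum>k\<in>{2..n}. norm (?G k)^2 / (real k * ln (real k))^2)) \<longlonglongrightarrow> 4 / 9"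
    proof -
      \<comment> \<open>The norm law is the trace of the matrix law: the \<open>d\<close> diagonal
        limits add up to \<open>4/9\<close>.\<close>
      have "(\<lambda>n. \<Sum>i\<in>UNIV. (\<Sum>k\<in>{2..n}. (?G k $ i) * (?G k $ i) / (real k * ln (real k))\<^sup>2) / ln (ln (real n)))
         \<longlonglongrightarrow> (\<Sum>i\<in>(UNIV :: 'd set). 4 / (9 * ?d))"
        using lim[of i i for i] by (intro tendsto_sum) simp
      moreover have "(\<Sum>i\<in>(UNIV :: 'd set). 4 / (9 * ?d)) = 4 / 9" by simp
      moreover have "(\<Sum>i\<in>UNIV. (\<Sum>k\<in>{2..n}. (?G k $ i) * (?G k $ i) / (real k * ln (real k))\<^sup>2) / ln (ln (real n)))
         = (1 / ln (ln (real n))) * (\<Sum>k\<in>{2..n}. norm (?G k)^2 / (real k * ln (real k))^2)" for n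
      proof -
        have "(\<Sum>i\<in>UNIV. \<Sum>k\<in>{2..n}. (?G k $ i) * (?G k $ i) / (real k * ln (real k))\<^sup>2)
            = (\<Sum>k\<in>{2..n}. \<Sum>i\<in>UNIV. (?G k $ i) * (?G k $ i) / (real k * ln (real k))\<^sup>2)"
          by (rule sum.swap)
        also have "\<dots> = (\<Sum>k\<in>{2..n}. norm (?G k)^2 / (real k * ln (real k))^2)"
          unfolding power2_norm_eq_inner inner_vec_def by (simp add: sum_divide_distrib)
        finally show ?thesis by (simp add: sum_divide_distrib[symmetric])
      qed
      ultimately show ?thesis by (simp only:)
    qed
    show ?case using 1 2 elim(3) unfolding G by blast
  qed
qed

end
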